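(* $\mathcal{E}(\mathcal{P}_{3,6}^e)\subset\mathcal{E}(\mathcal{P}_{3,6})$.
   Context: $\mathcal{P}_{3,6}$ is the set of homogeneous polynomials $f\in\mathbb{R}[x,y,z]$ of degree $6$ (including $0$) with $f(x,y,z)\ge0$ for all $(x,y,z)\in\mathbb{R}^3$, and $\mathcal{P}_{3,6}^e:=\mathcal{P}_{3,6}\cap\mathbb{R}[x^2,y^2,z^2]$. For a closed convex cone $\mathcal{P}$ containing no lines, a nonzero $f\in\mathcal{P}$ is extremal if $f=g+h$ with $g,h\in\mathcal{P}$ implies that $g$ and $h$ are scalar multiples of $f$; $\mathcal{E}(\mathcal{P})$ is the set of extremal elements of $\mathcal{P}$. *)

theory Defs
  imports Complex_Main "HOL-Library.Poly_Mapping" "HOL-Library.Product_Plus"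
begin

text \<open>\<open>\<real>[x,y,z]\<close> as the monoid algebra of \<open>\<nat>\<^sup>3\<close>: the finitely supported function \<open>f\<close> stands for
  the sum of the terms \<open>lookup f (i, j, k) x\<^sup>i y\<^sup>j z\<^sup>k\<close>.  Exponent triples are added componentwise,
  so the ring operations of \<^type>\<open>poly_mapping\<close> are those of \<open>\<real>[x,y,z]\<close>.\<close>

type_synonym poly3 = "(nat \<times> nat \<times> nat) \<Rightarrow>\<^sub>0 real"

definition Const :: "real \<Rightarrow> poly3" where
  "Const c = Poly_Mapping.single 0 c"

definition X :: poly3 where "X = Poly_Mapping.single (1, 0, 0) 1"
definition Y :: poly3 where "Y = Poly_Mapping.single (0, 1, 0) 1"
definition Z :: poly3 where "Z = Poly_Mapping.single (0, 0, 1) 1"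

text \<open>Value of a polynomial at a point of a commutative \<open>\<real>\<close>-algebra with structure map \<open>\<phi>\<close>.
  It is used for real points (with \<open>\<phi>\<close> the identity) and for substituting polynomials
  (with \<open>\<phi> = Const\<close>).\<close>

definition eval3 :: "(real \<Rightarrow> 'a) \<Rightarrow> poly3 \<Rightarrow> 'a \<Rightarrow> 'a \<Rightarrow> 'a \<Rightarrow> 'a::comm_ring_1" where
  "eval3 \<phi> f x y z =
     (\<Sum>(i, j, k)\<in>Poly_Mapping.keys f. \<phi> (Poly_Mapping.lookup f (i, j, k)) * x ^ i * y ^ j * z ^ k)"

definition homogeneous :: "nat \<Rightarrow> poly3 \<Rightarrow> bool" where
  "homogeneous d f \<longleftrightarrow> (\<forall>(i, j, k)\<in>Poly_Mapping.keys f. i + j + k = d)"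

definition psd_forms :: "nat \<Rightarrow> poly3 set" where
  "psd_forms d = {f. homogeneous d f \<and> (\<forall>x y z :: real. eval3 (\<lambda>c. c) f x y z \<ge> 0)}"

text \<open>\<open>\<real>[x\<^sup>2,y\<^sup>2,z\<^sup>2]\<close> as the set of all \<open>g(x\<^sup>2,y\<^sup>2,z\<^sup>2)\<close> with \<open>g \<in> \<real>[x,y,z]\<close>.\<close>

definition even_polys :: "poly3 set" where
  "even_polys = {eval3 Const g (X ^ 2) (Y ^ 2) (Z ^ 2) | g. True}"

definition even_psd_forms :: "nat \<Rightarrow> poly3 set" where
  "even_psd_forms d = psd_forms d \<inter> even_polys"

text \<open>The scalar multiples of \<open>f\<close> are the products \<open>Const c * f\<close> with \<open>c\<close> an arbitrary real.\<close>

definition extremal :: "poly3 set \<Rightarrow> poly3 set" where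
  "extremal P = {f \<in> P. f \<noteq> 0 \<and>
     (\<forall>g\<in>P. \<forall>h\<in>P. f = g + h \<longrightarrow> (\<exists>c. g = Const c * f) \<and> (\<exists>c. h = Const c * f))}"

end

theory Submission
  imports Defs "HOL-Analysis.Analysis"
begin

text \<open>An even sextic is \<open>f = F(x\<^sup>2,y\<^sup>2,z\<^sup>2)\<close> for a ternary cubic \<open>F\<close>, and \<open>f\<close> is nonnegative
exactly when \<open>F\<close> is nonnegative on the closed orthant (copositive).  Let \<open>f\<close> be extremal among the
even forms and \<open>f = g + h\<close> with \<open>g\<close>, \<open>h\<close> nonnegative sextics.  Averaging over the sign changes of the
variables shows that the even part of \<open>g\<close> is \<open>c f\<close>.  The rest of \<open>g\<close> is
\<open>xy Q(x\<^sup>2,y\<^sup>2,z\<^sup>2)\<close> plus the two similar terms for \<open>zx\<close> and \<open>yz\<close>; averaging over fewer signs gives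
\<open>|xy Q(x\<^sup>2,y\<^sup>2,z\<^sup>2)| \<le> c f\<close>, that is, \<open>x y Q\<^sup>2 \<le> c\<^sup>2 F\<^sup>2\<close> on the orthant.  So the claim is that an
extremal copositive cubic \<open>F\<close> admits such a bound only for \<open>Q = 0\<close>
(\<open>extremal_cubic_main\<close>); permuting the variables covers all three terms.

Extremality is used in this form: every cubic \<open>C\<close> with \<open>|C| \<le> k F\<close> on the orthant is a multiple of
\<open>F\<close>.  Cubics form a space of dimension 10, hence no system of eight linear conditions on \<open>C\<close> can imply
\<open>|C| \<le> k F\<close> (\<open>too_few_conditions\<close>).

If \<open>F\<close> has a variable as a factor, then \<open>Q\<close> has the same factor, and both can be divided by it; this leads to
extremal copositive quadratic forms (\<open>extremal_quadric_main\<close>).  Otherwise, since \<open>F\<close> does not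
dominate \<open>xyz\<close>, the minima of \<open>F - \<epsilon> xyz\<close> accumulate at a singular point \<open>P\<close> of \<open>F\<close> in the orthant
(\<open>has_singular_point\<close>), and \<open>P\<close> is not a vertex.  Along rays through \<open>P\<close> one has
\<open>F(b + t P) = F(b) + t q(b)\<close> with a quadratic form \<open>q\<close>, so \<open>|C| \<le> k F\<close> needs to be tested only on
the three coordinate faces, besides the analogous bound for \<open>q\<close> (\<open>dominated_from_faces\<close>).  On a
face \<open>F\<close> is a nonnegative binary cubic; what is needed there is that \<open>C\<close> vanishes at its zeros to the same order,
which costs one condition for each vertex where \<open>F\<close> vanishes and at most two for a double zero, of which a
face has at most one (\<open>binary_cases\<close>).

The polynomial \<open>Q\<close> brings the number of conditions below the critical one.  The bound \<open>x y Q\<^sup>2 \<le> k F\<^sup>2\<close>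
makes \<open>Q\<close> singular at \<open>P\<close> and forces it to vanish at \<open>(1,0,0)\<close> and \<open>(0,1,0)\<close> if \<open>F\<close> does, at the
double zeros of \<open>F\<close> on \<open>x = 0\<close> and \<open>y = 0\<close>, and to order two at a double zero on \<open>z = 0\<close>.  The zeros of a nonzero
quadratic form that is singular at \<open>P\<close> lie on at most two lines through \<open>P\<close>.  A line through \<open>P\<close> and two further
zeros of \<open>F\<close> in the orthant is contained in the zero set of \<open>F\<close>; then the square of its equation divides \<open>F\<close>, and
extremality makes the remaining factor a variable, which was excluded (\<open>line_in_zero_set\<close>).  So \<open>F\<close> has few
zeros, and at most eight conditions remain, whether \<open>P\<close> lies in the interior (\<open>interior_case\<close>), on the face
\<open>z = 0\<close> (\<open>edge3_case\<close>), or on \<open>x = 0\<close> (\<open>edge1_case\<close>); exchanging \<open>x\<close> and \<open>y\<close>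
gives the case \<open>y = 0\<close>.\<close>

section \<open>Ternary cubics and quadrics as coefficient vectors\<close>

type_synonym vec = "real \<times> real \<times> real"
type_synonym cubic = "real \<times> real \<times> real \<times> real \<times> real \<times> real \<times> real \<times> real \<times> real \<times> real"
type_synonym quadric = "real \<times> real \<times> real \<times> real \<times> real \<times> real"

fun ev :: "cubic \<Rightarrow> vec \<Rightarrow> real" where
  "ev (a,b,c,d,e,f,g,h,i,j) (x,y,z) = a*x^3 + b*y^3 + c*z^3 + d*x^2*y + e*x^2*z + f*x*y^2
     + g*y^2*z + h*x*z^2 + i*y*z^2 + j*x*y*z"

text \<open>Derivative of the cubic at the first point in the direction of the second one.\<close>

fun gr :: "cubic \<Rightarrow> vec \<Rightarrow> vec \<Rightarrow> real" where
  "gr (a,b,c,d,e,f,g,h,i,j) (x,y,z) (u,v,w) =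
     (3*a*x^2 + 2*d*x*y + 2*e*x*z + f*y^2 + h*z^2 + j*y*z) * u
   + (3*b*y^2 + d*x^2 + 2*f*x*y + 2*g*y*z + i*z^2 + j*x*z) * v
   + (3*c*z^2 + e*x^2 + g*y^2 + 2*h*x*z + 2*i*y*z + j*x*y) * w"

fun qv :: "quadric \<Rightarrow> vec \<Rightarrow> real" where
  "qv (a,b,c,d,e,f) (x,y,z) = a*x^2 + b*y^2 + c*z^2 + d*x*y + e*x*z + f*y*z"

text \<open>Polar form of the quadric, normalised by \<open>pol Q v v = 2 * qv Q v\<close>.\<close>

fun pol :: "quadric \<Rightarrow> vec \<Rightarrow> vec \<Rightarrow> real" where
  "pol (a,b,c,d,e,f) (x,y,z) (p,q,r) = 2*a*x*p + 2*b*y*q + 2*c*z*r + d*(x*q+y*p) + e*(x*r+z*p) + f*(y*r+z*q)"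

fun nonneg :: "vec \<Rightarrow> bool" where "nonneg (x,y,z) \<longleftrightarrow> 0 \<le> x \<and> 0 \<le> y \<and> 0 \<le> z"

fun positive :: "vec \<Rightarrow> bool" where "positive (x,y,z) \<longleftrightarrow> 0 < x \<and> 0 < y \<and> 0 < z"

fun det3 :: "vec \<Rightarrow> vec \<Rightarrow> vec \<Rightarrow> real" where
  "det3 (a,b,c) (d,e,f) (g,h,i) = a*(e*i-f*h) - b*(d*i-f*g) + c*(d*h-e*g)"

lemma ev_add: "\<And>C D v. ev (C+D) v = ev C v + ev D v"
  by (simp add: split_paired_all algebra_simps)

lemma ev_scale: "\<And>c C v. ev (c *\<^sub>R C) v = c * ev C v"
  by (simp add: split_paired_all algebra_simps)

lemma gr_add: "\<And>C D u v. gr (C+D) u v = gr C u v + gr D u v"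
  by (simp only: split_paired_all gr.simps add_Pair) algebra

lemma gr_scale: "\<And>c C u v. gr (c *\<^sub>R C) u v = c * gr C u v"
  by (simp only: split_paired_all gr.simps scaleR_Pair real_scaleR_def) algebra

lemma linear_ev: "linear (\<lambda>C. ev C v)"
  by (rule linearI) (simp_all add: ev_add ev_scale)

lemma linear_gr: "linear (\<lambda>C. gr C u v)"
  by (rule linearI) (simp_all add: gr_add gr_scale)

lemmas poly_eval = split_paired_all ev.simps gr.simps qv.simps pol.simps det3.simps
  add_Pair scaleR_Pair real_scaleR_def

lemma ev_line: "\<And>F u l v. ev F (u + l *\<^sub>R v) = ev F u + l * gr F u v + l^2 * gr F v u + l^3 * ev F v"
  by (simp only: poly_eval) algebra

lemma euler: "\<And>F v. gr F v v = 3 * ev F v"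
  by (simp only: poly_eval) algebra

lemma ev_hom: "\<And>F c v. ev F (c *\<^sub>R v) = c^3 * ev F v"
  by (simp only: poly_eval) algebra

lemma gr_hom: "\<And>F c u v. gr F (c *\<^sub>R u) v = c^2 * gr F u v"
  by (simp only: poly_eval) algebra

lemma gr_line: "\<And>F v l P. gr F (v + l *\<^sub>R P) P = gr F v P + 2*l*gr F P v + l^2 * gr F P P"
  by (simp only: poly_eval) algebra

lemma qv_line: "\<And>Q u l v. qv Q (u + l *\<^sub>R v) = qv Q u + l * pol Q u v + l^2 * qv Q v"
  by (simp only: poly_eval) algebra

text \<open>A linear functional is an inner product with a fixed vector, and fewer vectors than the dimension have a
common nonzero orthogonal vector.\<close>

lemma kernel:
  fixes fs :: "('a::euclidean_space \<Rightarrow> real) list"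
  assumes "\<And>f. f \<in> set fs \<Longrightarrow> linear f" "length fs < DIM('a)"
  shows "\<exists>c. c \<noteq> 0 \<and> (\<forall>f\<in>set fs. f c = 0)"
proof -
  let ?S = "(\<lambda>f. adjoint f 1) ` set fs"
  have "dim ?S \<le> card ?S" by (rule dim_le_card') simp
  also have "\<dots> \<le> length fs" by (meson card_image_le card_length finite_set le_trans)
  finally have "dim ?S < DIM('a)" using assms(2) by simp
  then obtain c where c: "c \<noteq> 0" "\<And>y. y \<in> span ?S \<Longrightarrow> orthogonal c y"
    using orthogonal_to_subspace_exists by blast
  have "f c = 0" if "f \<in> set fs" for f
  proof -
    have "f c \<bullet> 1 = c \<bullet> adjoint f 1" using adjoint_works[OF assms(1)[OF that], of c 1] by simp
    also have "\<dots> = 0" using c(2)[of "adjoint f 1"] that by (auto simp: orthogonal_def span_base)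
    finally show ?thesis by simp
  qed
  with c show ?thesis by blast
qed

definition copositive :: "cubic \<Rightarrow> bool" where "copositive F \<longleftrightarrow> (\<forall>v. nonneg v \<longrightarrow> 0 \<le> ev F v)"

text \<open>For an extremal cubic \<open>F\<close> the face of the copositive cone that \<open>F\<close> generates is a ray.  The
linear span of this face is the set of all \<open>C\<close> with \<open>dominated C F\<close>; hence the form of
\<open>extremal_cubic\<close> below, which avoids decompositions into summands.\<close>

definition dominated :: "cubic \<Rightarrow> cubic \<Rightarrow> bool" where
  "dominated C F \<longleftrightarrow> (\<exists>k. \<forall>v. nonneg v \<longrightarrow> \<bar>ev C v\<bar> \<le> k * ev F v)"

definition extremal_cubic :: "cubic \<Rightarrow> bool" where
  "extremal_cubic F \<longleftrightarrow> copositive F \<and> F \<noteq> 0 \<and> (\<forall>C. dominated C F \<longrightarrow> (\<exists>c. C = c *\<^sub>R F))"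

text \<open>Eight conditions leave room for one more, orthogonality to \<open>F\<close>: a common solution is then
dominated, so a multiple of \<open>F\<close>, and orthogonal to \<open>F\<close>.\<close>

lemma too_few_conditions:
  fixes fs :: "(cubic \<Rightarrow> real) list"
  assumes "extremal_cubic F" "\<And>f. f \<in> set fs \<Longrightarrow> linear f" "length fs \<le> 8"
   "\<And>C. (\<And>f. f \<in> set fs \<Longrightarrow> f C = 0) \<Longrightarrow> dominated C F"
  shows False
proof -
  have "\<exists>c. c \<noteq> 0 \<and> (\<forall>f\<in>set ((\<lambda>C. C \<bullet> F) # fs). f c = 0)"
    by (rule kernel) (use assms(2,3) in \<open>auto simp: bounded_linear.linear bounded_linear_inner_left\<close>)
  then obtain C where C: "C \<noteq> 0" "C \<bullet> F = 0" "\<And>f. f \<in> set fs \<Longrightarrow> f C = 0" by auto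
  then obtain c where c: "C = c *\<^sub>R F" using assms(1,4) unfolding extremal_cubic_def by blast
  with C show False by auto
qed

text \<open>The two limit lemmas read off the vanishing order of \<open>Q\<close> at a zero of \<open>F\<close>: the inequality
\<open>x y Q\<^sup>2 \<le> k F\<^sup>2\<close> is restricted to a curve that runs into the zero, and powers of the curve parameter
are cancelled.\<close>

lemma vanishes_at_zero:
  fixes g w :: "real \<Rightarrow> real"
  assumes "isCont g 0" "isCont w 0" "\<And>r. 0 < r \<Longrightarrow> r < 1 \<Longrightarrow> (g r)^2 \<le> r * w r"
  shows "g 0 = 0"
proof -
  have 1: "((\<lambda>r. (g r)^2) \<longlongrightarrow> (g 0)^2) (at_right 0)"
    using assms(1) by (intro tendsto_intros) (auto simp: isCont_def filterlim_at_split)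
  have 2: "((\<lambda>r. r * w r) \<longlongrightarrow> 0 * w 0) (at_right 0)"
    using assms(2) by (intro tendsto_intros) (auto simp: isCont_def filterlim_at_split)
  have "eventually (\<lambda>r. (g r)^2 \<le> r * w r) (at_right (0::real))"
    unfolding eventually_at_right_field using assms(3) by (intro exI[of _ 1]) auto
  from tendsto_le[OF _ 2 1 this] show ?thesis by simp
qed

lemma vanishes_doubly_at_zero:
  fixes h w :: "real \<Rightarrow> real"
  assumes "isCont h 0" "isCont w 0" "\<And>r. 0 < r \<Longrightarrow> r < 1 \<Longrightarrow> (a + b * r + r^2 * h r)^2 \<le> r^3 * w r"
  shows "a = 0 \<and> b = 0"
proof
  have "(a + b * 0 + 0^2 * h 0) = 0"
    by (rule vanishes_at_zero[where w = "\<lambda>r. r^2 * w r"])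
      (use assms in \<open>auto simp: power3_eq_cube power2_eq_square mult.assoc intro!: continuous_intros\<close>)
  then show a: "a = 0" by simp
  have "(b + 0 * h 0) = 0"
  proof (rule vanishes_at_zero[where w = w])
    fix r :: real assume r: "0 < r" "r < 1"
    have "r^2 * (b + r * h r)^2 \<le> r^2 * (r * w r)"
      using assms(3)[OF r] a by (simp add: power2_eq_square power3_eq_cube algebra_simps)
    with r show "(b + r * h r)^2 \<le> r * w r" by simp
  qed (use assms in \<open>auto intro!: continuous_intros\<close>)
  then show "b = 0" by simp
qed

lemma compact_compare:
  fixes E E' :: "'a::topological_space \<Rightarrow> real"
  assumes "compact K" "continuous_on K E" "continuous_on K E'" "\<And>v. v \<in> K \<Longrightarrow> E v > 0"
  shows "\<exists>k. \<forall>v\<in>K. \<bar>E' v\<bar> \<le> k * E v"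
proof -
  have "compact ((\<lambda>v. E' v / E v) ` K)"
    using assms by (intro compact_continuous_image continuous_intros) force+
  then obtain k where k: "\<And>v. v \<in> K \<Longrightarrow> \<bar>E' v / E v\<bar> \<le> k"
    using compact_imp_bounded[THEN bounded_iff[THEN iffD1]] by fastforce
  show ?thesis
  proof (intro exI ballI)
    fix v assume v: "v \<in> K"
    have "\<bar>E' v\<bar> / E v \<le> k" using k[OF v] assms(4)[OF v] by (simp add: abs_div)
    then show "\<bar>E' v\<bar> \<le> k * E v" using assms(4)[OF v] by (simp add: divide_simps mult.commute)
  qed
qed

lemma min_deriv:
  fixes f :: "real \<Rightarrow> real"
  assumes "(f has_real_derivative D) (at x)" "x > 0" "\<And>s. s \<ge> 0 \<Longrightarrow> f s \<ge> 0" "f x = 0"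
  shows "D = 0"
  by (rule DERIV_local_min[OF assms(1,2)]) (use assms in auto)

section \<open>Nonnegative binary cubics\<close>

type_synonym binary_cubic = "real \<times> real \<times> real \<times> real"

fun beval :: "binary_cubic \<Rightarrow> real \<Rightarrow> real \<Rightarrow> real" where
  "beval (a,b,c,d) s t = a * s^3 + b * s^2*t + c * s*t^2 + d*t^3"

fun bderiv_s :: "binary_cubic \<Rightarrow> real \<Rightarrow> real \<Rightarrow> real" where
  "bderiv_s (a,b,c,d) s t = 3*a * s^2 + 2*b * s*t + c*t^2"

fun bderiv_t :: "binary_cubic \<Rightarrow> real \<Rightarrow> real \<Rightarrow> real" where
  "bderiv_t (a,b,c,d) s t = b * s^2 + 2*c * s*t + 3*d*t^2"

definition bdominated :: "binary_cubic \<Rightarrow> binary_cubic \<Rightarrow> bool" where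
  "bdominated q p \<longleftrightarrow> (\<exists>k. \<forall>s\<ge>0. \<forall>t\<ge>0. \<bar>beval q s t\<bar> \<le> k * beval p s t)"

definition bnonneg :: "binary_cubic \<Rightarrow> bool" where
  "bnonneg p \<longleftrightarrow> (\<forall>s\<ge>0. \<forall>t\<ge>0. 0 \<le> beval p s t)"

lemma ratio_bound:
  fixes a d x y a' d' :: real
  assumes "0 \<le> a" "0 \<le> d" "a = 0 \<Longrightarrow> a' = 0" "d = 0 \<Longrightarrow> d' = 0" "0 \<le> x" "0 \<le> y"
  shows "\<bar>a' * x + d' * y\<bar> \<le> (\<bar>a'\<bar>/a + \<bar>d'\<bar>/d) * (a * x + d * y)"
proof -
  have 1: "\<bar>a'\<bar> \<le> (\<bar>a'\<bar>/a + \<bar>d'\<bar>/d) * a" using assms(1-4) by (cases "a = 0") (auto simp: field_simps)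
  have 2: "\<bar>d'\<bar> \<le> (\<bar>a'\<bar>/a + \<bar>d'\<bar>/d) * d" using assms(1-4) by (cases "d = 0") (auto simp: field_simps)
  have "\<bar>a' * x + d' * y\<bar> \<le> \<bar>a'\<bar> * x + \<bar>d'\<bar> * y"
    using assms(5,6) by (metis abs_mult abs_of_nonneg abs_triangle_ineq)
  also have "\<dots> \<le> ((\<bar>a'\<bar>/a + \<bar>d'\<bar>/d) * a) * x + ((\<bar>a'\<bar>/a + \<bar>d'\<bar>/d) * d) * y"
    using 1 2 assms(5,6) by (intro add_mono mult_right_mono)
  also have "\<dots> = (\<bar>a'\<bar>/a + \<bar>d'\<bar>/d) * (a * x + d * y)"
    by (simp only: distrib_left distrib_right mult.assoc)
  finally show ?thesis .
qed

text \<open>Clearing denominators in the factorisation with \<open>(\<tau> s - \<sigma> t)\<^sup>2\<close>; the remaining linear factor is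
determined by the two end coefficients.\<close>

lemma double_zero_factor:
  "bderiv_s (a,b,c,d) \<sigma> \<tau> = 0 \<Longrightarrow> bderiv_t (a,b,c,d) \<sigma> \<tau> = 0 \<Longrightarrow>
   \<sigma>^2 * \<tau>^2 * beval (a,b,c,d) s t = (\<tau>* s - \<sigma>*t)^2 * (a * (\<sigma>^2 * s) + d * (\<tau>^2 * t))"
  unfolding beval.simps bderiv_s.simps bderiv_t.simps by algebra

text \<open>After the square of the common linear factor is removed, two linear forms with nonnegative
coefficients in the denominator are compared.\<close>

lemma bdominated_interior_double:
  assumes p: "p = (a,b,c,d)" and nonneg: "0 \<le> a" "0 \<le> d" and \<sigma>: "0 < \<sigma>" "0 < \<tau>"
    and z: "bderiv_s p \<sigma> \<tau> = 0" "bderiv_t p \<sigma> \<tau> = 0"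
    and q: "q = (a',b',c',d')" "bderiv_s q \<sigma> \<tau> = 0" "bderiv_t q \<sigma> \<tau> = 0" "a = 0 \<Longrightarrow> a' = 0" "d = 0 \<Longrightarrow> d' = 0"
  shows "bdominated q p"
  unfolding bdominated_def
proof (intro exI allI impI)
  fix s t :: real assume st: "0 \<le> s" "0 \<le> t"
  let ?k = "\<bar>a'\<bar>/a + \<bar>d'\<bar>/d"
  have "\<sigma>^2 * \<tau>^2 * \<bar>beval q s t\<bar> = \<bar>\<sigma>^2 * \<tau>^2 * beval q s t\<bar>" by (simp add: abs_mult)
  also have "\<dots> = (\<tau>* s - \<sigma>*t)^2 * \<bar>a' * (\<sigma>^2 * s) + d' * (\<tau>^2 * t)\<bar>"
    using double_zero_factor q unfolding q(1) by (simp add: abs_mult)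
  also have "\<dots> \<le> (\<tau>* s - \<sigma>*t)^2 * (?k * (a * (\<sigma>^2 * s) + d * (\<tau>^2 * t)))"
    by (intro mult_left_mono ratio_bound) (use nonneg q st in auto)
  also have "\<dots> = ?k * (\<sigma>^2 * \<tau>^2 * beval p s t)"
    using double_zero_factor[OF z[unfolded p], of s t] p by simp
  also have "\<dots> = \<sigma>^2 * \<tau>^2 * (?k * beval p s t)" by simp
  finally show "\<bar>beval q s t\<bar> \<le> ?k * beval p s t" using \<sigma> by simp
qed

lemma quadrant_compare:
  fixes E E' :: "real \<Rightarrow> real \<Rightarrow> real"
  assumes h: "\<And>c s t. E (c * s) (c*t) = c^n * E s t" "\<And>c s t. E' (c * s) (c*t) = c^n * E' s t" "n \<noteq> 0"
   and c: "continuous_on UNIV (\<lambda>v. E (fst v) (snd v))" "continuous_on UNIV (\<lambda>v. E' (fst v) (snd v))"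
   and positive: "\<And>s t. 0 \<le> s \<Longrightarrow> 0 \<le> t \<Longrightarrow> s + t > 0 \<Longrightarrow> E s t > 0"
  shows "\<exists>k. \<forall>s\<ge>0. \<forall>t\<ge>0. \<bar>E' s t\<bar> \<le> k * E s t"
proof -
  let ?K = "(\<lambda>s. (s, 1 - s)) ` {0..1::real}"
  have "\<exists>k. \<forall>v\<in>?K. \<bar>E' (fst v) (snd v)\<bar> \<le> k * E (fst v) (snd v)"
    by (intro compact_compare compact_continuous_image)
      (auto intro!: continuous_intros continuous_on_subset[OF c(1)] continuous_on_subset[OF c(2)] positive)
  then obtain k where "\<forall>v\<in>?K. \<bar>E' (fst v) (snd v)\<bar> \<le> k * E (fst v) (snd v)" by blast
  then have k: "\<And>s. 0 \<le> s \<Longrightarrow> s \<le> 1 \<Longrightarrow> \<bar>E' s (1-s)\<bar> \<le> k * E s (1-s)" by auto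
  show ?thesis
  proof (intro exI allI impI)
    fix s t :: real assume st: "0 \<le> s" "0 \<le> t"
    show "\<bar>E' s t\<bar> \<le> k * E s t"
    proof (cases "s + t = 0")
      case True
      then have "s = 0" "t = 0" using st by auto
      then show ?thesis using h(1)[of 0 0 0] h(2)[of 0 0 0] h(3) by (auto simp: power_0_left)
    next
      case False
      let ?c = "s + t"
      have c: "?c > 0" using False st by auto
      have e: "s = ?c * (s / ?c)" "t = ?c * (1 - s / ?c)" using c by (auto simp: field_simps)
      have "\<bar>E' s t\<bar> = ?c^n * \<bar>E' (s/?c) (1 - s/?c)\<bar>"
        using h(2)[of ?c "s/?c" "1 - s/?c"] e c by (simp add: abs_mult)
      also have "\<dots> \<le> ?c^n * (k * E (s/?c) (1 - s/?c))"
        using st c by (intro mult_left_mono k) auto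
      also have "\<dots> = k * E s t"
        using h(1)[of ?c "s/?c" "1 - s/?c"] e by simp
      finally show ?thesis .
    qed
  qed
qed

definition inherits_end_zeros :: "binary_cubic \<Rightarrow> binary_cubic \<Rightarrow> bool" where
  "inherits_end_zeros p q \<longleftrightarrow> (beval p 1 0 = 0 \<longrightarrow> beval q 1 0 = 0) \<and> (beval p 0 1 = 0 \<longrightarrow> beval q 0 1 = 0)"

lemma bdominated_mult:
  assumes "\<exists>k. \<forall>s\<ge>0. \<forall>t\<ge>0. \<bar>E' s t\<bar> \<le> k * E s t"
    "\<And>s t. beval p s t = D s t * E s t" "\<And>s t. beval q s t = D s t * E' s t"
    "\<And>s t. 0 \<le> s \<Longrightarrow> 0 \<le> t \<Longrightarrow> 0 \<le> D s t"
  shows "bdominated q p"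
proof -
  obtain k where k: "\<And>s t. 0 \<le> s \<Longrightarrow> 0 \<le> t \<Longrightarrow> \<bar>E' s t\<bar> \<le> k * E s t" using assms(1) by blast
  show ?thesis unfolding bdominated_def
  proof (intro exI allI impI)
    fix s t :: real assume st: "0 \<le> s" "0 \<le> t"
    show "\<bar>beval q s t\<bar> \<le> k * beval p s t"
      using mult_left_mono[OF k[OF st] assms(4)[OF st]] assms(4)[OF st]
      by (simp add: assms(2,3) abs_mult mult.left_commute)
  qed
qed

text \<open>With a zero at \<open>(1,0)\<close> and no zero elsewhere, the cubic is \<open>t\<close>, \<open>t\<^sup>2\<close> or \<open>t\<^sup>3\<close> times
a factor that is positive on the quadrant away from the origin; the three alternatives are these vanishing orders.\<close>

lemma bdominated_end_cases:
  assumes p: "p = (0,b,c,d)" and nonneg: "bnonneg p" and d: "d > 0"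
    and noz: "\<forall>s>0. \<forall>t>0. beval p s t \<noteq> 0"
  shows "(\<forall>q. inherits_end_zeros p q \<longrightarrow> bdominated q p) \<or> (b = 0 \<and> (\<forall>q. inherits_end_zeros p q \<and> bderiv_t q 1 0 = 0 \<longrightarrow> bdominated q p))
     \<or> (b = 0 \<and> c = 0 \<and> (\<forall>q. inherits_end_zeros p q \<and> bderiv_t q 1 0 = 0 \<and> bderiv_s q 0 1 = 0 \<longrightarrow> bdominated q p))"
proof -
  have ge: "0 \<le> t * (b * s^2 + c * s*t + d*t^2)" if "0 \<le> s" "0 \<le> t" for s t
  proof -
    have "0 \<le> beval p s t" using nonneg that unfolding bnonneg_def by blast
    also have "\<dots> = t * (b * s^2 + c * s * t + d*t^2)" unfolding p beval.simps by algebra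
    finally show ?thesis .
  qed
  have b0: "b \<ge> 0"
  proof -
    have lim: "((\<lambda>t. b + c*t + d*t^2) \<longlongrightarrow> b + c*0+d*0^2) (at_right 0)" by (intro tendsto_intros)
    have "eventually (\<lambda>t. 0 \<le> b + c*t + d*t^2) (at_right (0::real))"
      unfolding eventually_at_right_field
    proof (intro exI[of _ 1] conjI allI impI)
      fix t :: real assume "0 < t" "t < 1"
      then show "0 \<le> b + c*t + d*t^2" using ge[of 1 t] by (simp add: zero_le_mult_iff)
    qed simp
    from tendsto_lowerbound[OF lim this] show ?thesis by simp
  qed
  have gt: "0 < b * s^2 + c * s*t + d*t^2" if "0 < s" "0 < t" for s t
  proof -
    have "beval p s t = t * (b * s^2 + c * s * t + d*t^2)" unfolding p beval.simps by algebra
    then have "b * s^2 + c * s * t + d*t^2 \<noteq> 0" using noz that by auto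
    moreover have "0 \<le> b * s^2 + c * s * t + d*t^2" using ge[of s t] that by (simp add: zero_le_mult_iff)
    ultimately show ?thesis by simp
  qed
  consider "b > 0" | "b = 0" "c > 0" | "b = 0" "c = 0" | "b = 0" "c < 0" using b0 by linarith
  then show ?thesis
  proof cases
    case 1
    have "bdominated q p" if "inherits_end_zeros p q" for q
    proof -
      obtain a' b' c' d' where q: "q = (a',b',c',d')" by (cases q)
      have a': "a' = 0" using that p q by (simp add: inherits_end_zeros_def)
      have "\<exists>k. \<forall>s\<ge>0. \<forall>t\<ge>0. \<bar>b'* s^2 + c'* s*t + d'*t^2\<bar> \<le> k * (b * s^2 + c * s*t + d*t^2)"
      proof (rule quadrant_compare[where n = 2])
        fix s t :: real assume "0 \<le> s" "0 \<le> t" "s + t > 0"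
        then show "0 < b * s^2 + c * s*t + d*t^2" using gt 1 d by (cases "s = 0"; cases "t = 0") auto
      qed (auto simp: algebra_simps power2_eq_square intro!: continuous_intros)
      then show ?thesis
        by (rule bdominated_mult[where D = "\<lambda>s t. t"])
          (auto simp: p q a' algebra_simps power2_eq_square power3_eq_cube)
    qed
    then show ?thesis by blast
  next
    case 2
    have "bdominated q p" if "inherits_end_zeros p q" "bderiv_t q 1 0 = 0" for q
    proof -
      obtain a' b' c' d' where q: "q = (a',b',c',d')" by (cases q)
      have a': "a' = 0" "b' = 0" using that p q by (simp_all add: inherits_end_zeros_def)
      have "\<exists>k. \<forall>s\<ge>0. \<forall>t\<ge>0. \<bar>c'* s + d'*t\<bar> \<le> k * (c * s + d*t)"
        by (intro exI allI impI, rule ratio_bound) (use 2 d in auto)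
      then show ?thesis
        by (rule bdominated_mult[where D = "\<lambda>s t. t^2"])
          (auto simp: p q a' 2 algebra_simps power2_eq_square power3_eq_cube)
    qed
    with 2 show ?thesis by blast
  next
    case 3
    have "bdominated q p" if "inherits_end_zeros p q" "bderiv_t q 1 0 = 0" "bderiv_s q 0 1 = 0" for q
    proof -
      obtain a' b' c' d' where q: "q = (a',b',c',d')" by (cases q)
      have a': "a' = 0" "b' = 0" "c' = 0" using that p q by (simp_all add: inherits_end_zeros_def)
      have "\<exists>k. \<forall>s\<ge>0. \<forall>t\<ge>0. \<bar>0 * s + d'*t\<bar> \<le> k * (0 * s + d*t)"
        by (intro exI allI impI, rule ratio_bound) (use d in auto)
      then show ?thesis
        by (rule bdominated_mult[where D = "\<lambda>s t. t^2"])
          (auto simp: p q a' 3 algebra_simps power2_eq_square power3_eq_cube)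
    qed
    with 3 show ?thesis by blast
  next
    case 4
    have "0 < b * (2*d)^2 + c * (2*d) * (-c) + d*(-c)^2" using 4 d by (intro gt) auto
    also have "\<dots> = - (c^2 * d)" using 4 by (simp add: power2_eq_square)
    finally show ?thesis using d by (simp add: mult_less_0_iff)
  qed
qed

fun breverse :: "binary_cubic \<Rightarrow> binary_cubic" where "breverse (a,b,c,d) = (d,c,b,a)"

lemma breverse_simps[simp]: "\<And>p s t. beval (breverse p) s t = beval p t s" "\<And>p s t. bderiv_s (breverse p) s t = bderiv_t p t s"
  "\<And>p s t. bderiv_t (breverse p) s t = bderiv_s p t s" "\<And>p. breverse (breverse p) = p"
  by (simp_all add: split_paired_all)

lemma breverse_dominated: "bdominated (breverse q) (breverse p) \<longleftrightarrow> bdominated q p"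
  by (auto simp: bdominated_def)

lemma breverse_end_zeros: "inherits_end_zeros (breverse p) q \<longleftrightarrow> inherits_end_zeros p (breverse q)"
  by (auto simp: inherits_end_zeros_def)

text \<open>A double zero \<open>(\<sigma>,\<tau>)\<close> of \<open>p\<close> together with linear conditions \<open>L\<close> which, added to
vanishing at the ends where \<open>p\<close> vanishes, imply domination by \<open>p\<close>.  The last clauses record what the counting
needs: if the double zero lies between the ends, then at most one end is a zero, and a double zero at an end costs only one
condition unless it is a triple zero.\<close>

definition double_zero :: "binary_cubic \<Rightarrow> real \<Rightarrow> real \<Rightarrow> (binary_cubic \<Rightarrow> real) list \<Rightarrow> bool" where
  "double_zero p \<sigma> \<tau> L \<longleftrightarrow> 0 \<le> \<sigma> \<and> 0 \<le> \<tau> \<and> \<sigma> + \<tau> > 0 \<and> bderiv_s p \<sigma> \<tau> = 0 \<and> bderiv_t p \<sigma> \<tau> = 0 \<and>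
    (\<forall>f\<in>set L. linear f) \<and> length L \<le> 2 \<and> (\<forall>q. inherits_end_zeros p q \<and> (\<forall>f\<in>set L. f q = 0) \<longrightarrow> bdominated q p) \<and>
    (0 < \<sigma> \<and> 0 < \<tau> \<longrightarrow> beval p 1 0 \<noteq> 0 \<or> beval p 0 1 \<noteq> 0) \<and>
    (\<tau> = 0 \<longrightarrow> length L \<le> 1 \<or> bderiv_s p 0 1 = 0) \<and> (\<sigma> = 0 \<longrightarrow> length L \<le> 1 \<or> bderiv_t p 1 0 = 0)"

lemma linear_binary: "linear (\<lambda>q. beval q s t)" "linear (\<lambda>q. bderiv_s q s t)" "linear (\<lambda>q. bderiv_t q s t)"
proof -
  have "\<And>q r s t. beval (q+r) s t = beval q s t + beval r s t" "\<And>q r s t. bderiv_s (q+r) s t = bderiv_s q s t + bderiv_s r s t"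
   "\<And>q r s t. bderiv_t (q+r) s t = bderiv_t q s t + bderiv_t r s t" "\<And>c q s t. beval (c *\<^sub>R q) s t = c * beval q s t"
   "\<And>c q s t. bderiv_s (c *\<^sub>R q) s t = c * bderiv_s q s t" "\<And>c q s t. bderiv_t (c *\<^sub>R q) s t = c * bderiv_t q s t"
    by (simp_all add: split_paired_all algebra_simps)
  then show "linear (\<lambda>q. beval q s t)" "linear (\<lambda>q. bderiv_s q s t)" "linear (\<lambda>q. bderiv_t q s t)"
    by (auto intro!: linearI)
qed

lemma double_zero_at_end:
  assumes "p = (0,b,c,d)" "bnonneg p" "d > 0" "\<forall>s>0. \<forall>t>0. beval p s t \<noteq> 0"
  shows "(\<forall>q. inherits_end_zeros p q \<longrightarrow> bdominated q p) \<or> (\<exists>L. double_zero p 1 0 L)"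
  using bdominated_end_cases[OF assms]
proof (elim disjE)
  assume *: "b = 0 \<and> (\<forall>q. inherits_end_zeros p q \<and> bderiv_t q 1 0 = 0 \<longrightarrow> bdominated q p)"
  have "double_zero p 1 0 [\<lambda>q. bderiv_t q 1 0]"
    unfolding double_zero_def using * by (auto simp: assms(1) linear_binary)
  then show ?thesis by blast
next
  assume *: "b = 0 \<and> c = 0 \<and> (\<forall>q. inherits_end_zeros p q \<and> bderiv_t q 1 0 = 0 \<and> bderiv_s q 0 1 = 0 \<longrightarrow> bdominated q p)"
  have "double_zero p 1 0 [\<lambda>q. bderiv_t q 1 0, \<lambda>q. bderiv_s q 0 1]"
    unfolding double_zero_def using * by (auto simp: assms(1) linear_binary)
  then show ?thesis by blast
qed blast

lemma linear_breverse: "linear breverse"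
proof -
  have "\<And>x y. breverse (x + y) = breverse x + breverse y" "\<And>c x. breverse (c *\<^sub>R x) = c *\<^sub>R breverse x"
    by (simp_all add: split_paired_all)
  then show ?thesis by (intro linearI)
qed

lemma double_zero_breverse:
  assumes "double_zero (breverse p) \<sigma> \<tau> L"
  shows "double_zero p \<tau> \<sigma> (map (\<lambda>f. f \<circ> breverse) L)"
proof -
  have "bdominated q p" if "inherits_end_zeros p q" "\<forall>f\<in>set L. f (breverse q) = 0" for q
  proof -
    have "inherits_end_zeros (breverse p) (breverse q)" using that(1) by (simp add: inherits_end_zeros_def)
    with assms that(2) have "bdominated (breverse q) (breverse p)" unfolding double_zero_def by blast
    then show ?thesis by (simp only: breverse_dominated)
  qed
  then show ?thesis using assms unfolding double_zero_def
    by (auto simp: add.commute intro!: linear_compose[OF linear_breverse])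
qed

text \<open>An interior zero is a minimum, hence double.  Without interior zeros everything is decided by the vanishing
orders at the two ends.\<close>

lemma binary_cases:
  assumes nonneg: "bnonneg p" and nz: "p \<noteq> 0"
  shows "(\<forall>q. inherits_end_zeros p q \<longrightarrow> bdominated q p) \<or> (\<exists>\<sigma> \<tau> L. double_zero p \<sigma> \<tau> L)"
proof -
  obtain a b c d where p: "p = (a,b,c,d)" by (cases p)
  have a: "0 \<le> a" using nonneg[unfolded bnonneg_def, rule_format, of 1 0] p by simp
  have d: "0 \<le> d" using nonneg[unfolded bnonneg_def, rule_format, of 0 1] p by simp
  show ?thesis
  proof (cases "\<exists>s t. 0 < s \<and> 0 < t \<and> beval p s t = 0")
    case True
    then obtain s t where st: "0 < s" "0 < t" "beval p s t = 0" by blast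
    have z1: "bderiv_s p s t = 0"
      by (rule min_deriv[of "\<lambda>s. beval p s t" _ s])
        (use st nonneg[unfolded bnonneg_def] in \<open>auto simp: p intro!: derivative_eq_intros\<close>)
    have z2: "bderiv_t p s t = 0"
      by (rule min_deriv[of "\<lambda>t. beval p s t" _ t])
        (use st nonneg[unfolded bnonneg_def] in \<open>auto simp: p intro!: derivative_eq_intros\<close>)
    have nab: "\<not> (a = 0 \<and> d = 0)"
    proof
      assume ad: "a = 0 \<and> d = 0"
      have "s * t * b = 0" "s*t*c = 0" using z1 z2 unfolding p bderiv_s.simps bderiv_t.simps using st ad by algebra+
      then show False using ad nz st by (simp add: p zero_prod_def)
    qed
    have "double_zero p s t [\<lambda>q. bderiv_s q s t, \<lambda>q. bderiv_t q s t]"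
      unfolding double_zero_def
    proof (intro conjI impI allI)
      fix q assume "inherits_end_zeros p q \<and> (\<forall>f\<in>set [\<lambda>q. bderiv_s q s t, \<lambda>q. bderiv_t q s t]. f q = 0)"
      moreover obtain a' b' c' d' where q: "q = (a',b',c',d')" by (cases q)
      ultimately show "bdominated q p" by (intro bdominated_interior_double[OF p a d st(1,2) z1 z2 q]) (auto simp: q p inherits_end_zeros_def)
    qed (use st z1 z2 nab in \<open>auto simp: p linear_binary\<close>)
    then show ?thesis by blast
  next
    case False
    then have noz: "\<forall>s>0. \<forall>t>0. beval p s t \<noteq> 0" by blast
    consider "a > 0" "d > 0" | "a = 0" "d > 0" | "a > 0" "d = 0" | "a = 0" "d = 0" using a d by linarith
    then show ?thesis
    proof cases
      case 1
      have "bdominated q p" for q unfolding bdominated_def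
      proof (rule quadrant_compare[where n = 3])
        fix s t :: real assume st: "0 \<le> s" "0 \<le> t" "s + t > 0"
        have "0 \<le> beval p s t" using nonneg st unfolding bnonneg_def by blast
        moreover have "beval p s t \<noteq> 0" using noz st 1 p by (cases "s = 0"; cases "t = 0") auto
        ultimately show "0 < beval p s t" by simp
      next
        fix cc s t show "beval p (cc * s) (cc*t) = cc^3 * beval p s t" unfolding p beval.simps by algebra
      next
        fix cc s t
        obtain a' b' c' d' where q: "q = (a',b',c',d')" by (cases q)
        show "beval q (cc * s) (cc*t) = cc^3 * beval q s t" unfolding q beval.simps by algebra
      next
        show "continuous_on UNIV (\<lambda>v. beval p (fst v) (snd v))" by (auto simp: p intro!: continuous_intros)
        show "continuous_on UNIV (\<lambda>v. beval q (fst v) (snd v))" by (cases q) (auto intro!: continuous_intros)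
      qed simp
      then show ?thesis by blast
    next
      case 2 then show ?thesis using double_zero_at_end[of p b c d] nonneg noz p by blast
    next
      case 3
      have "(\<forall>q. inherits_end_zeros (breverse p) q \<longrightarrow> bdominated q (breverse p)) \<or> (\<exists>L. double_zero (breverse p) 1 0 L)"
      proof (rule double_zero_at_end[of _ c b a])
        show "bnonneg (breverse p)" "\<forall>s>0. \<forall>t>0. beval (breverse p) s t \<noteq> 0" using nonneg noz by (simp_all only: bnonneg_def breverse_simps) blast+
      qed (use 3 in \<open>auto simp: p\<close>)
      then show ?thesis using double_zero_breverse by (metis breverse_simps(4) breverse_dominated breverse_end_zeros)
    next
      case 4
      have ge: "0 \<le> s * t * (b * s + c*t)" if "0 \<le> s" "0 \<le> t" for s t
      proof -
        have "0 \<le> beval p s t" using nonneg that unfolding bnonneg_def by blast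
        also have "\<dots> = s * t * (b * s + c * t)" unfolding p beval.simps using 4 by algebra
        finally show ?thesis .
      qed
      have bc0: "b \<ge> 0 \<and> c \<ge> 0"
      proof -
        have "0 \<le> b + c * t" if "t > 0" for t using ge[of 1 t] that by (simp add: zero_le_mult_iff)
        moreover have "0 \<le> c + b * t" if "t > 0" for t using ge[of t 1] that by (simp add: zero_le_mult_iff add.commute)
        moreover have "x \<ge> 0" if "\<And>t. t > 0 \<Longrightarrow> 0 \<le> x + y * t" for x y :: real
        proof -
          have lim: "((\<lambda>t. x + y * t) \<longlongrightarrow> x + y * 0) (at_right 0)" by (intro tendsto_intros)
          have "eventually (\<lambda>t. 0 \<le> x + y * t) (at_right (0::real))"
            using that eventually_at_right_less[of "0::real"] by (auto elim: eventually_mono)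
          from tendsto_lowerbound[OF lim this] show ?thesis by simp
        qed
        ultimately show ?thesis by blast
      qed
      have key: "bdominated q p" if "inherits_end_zeros p q" "b = 0 \<Longrightarrow> bderiv_t q 1 0 = 0" "c = 0 \<Longrightarrow> bderiv_s q 0 1 = 0" for q
      proof -
        obtain a' b' c' d' where q: "q = (a',b',c',d')" by (cases q)
        have ad: "a' = 0" "d' = 0" using that(1) by (simp_all add: p q 4 inherits_end_zeros_def)
        have "\<exists>k. \<forall>s\<ge>0. \<forall>t\<ge>0. \<bar>b' * s + c' * t\<bar> \<le> k * (b * s + c * t)"
          by (intro exI allI impI, rule ratio_bound) (use bc0 that q in auto)
        then show ?thesis
          by (rule bdominated_mult[where D = "\<lambda>s t. s * t"]) (auto simp: p q 4 ad algebra_simps power2_eq_square)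
      qed
      consider "b > 0" "c > 0" | "b = 0" "c > 0" | "b > 0" "c = 0"
        using bc0 nz 4 p by (auto simp: zero_prod_def less_le)
      then show ?thesis
      proof cases
        case 1 then show ?thesis using key by auto
      next
        case 2
        have "double_zero p 1 0 [\<lambda>q. bderiv_t q 1 0]" unfolding double_zero_def
          using 2 key by (auto simp: p 4 linear_binary)
        then show ?thesis by blast
      next
        case 3
        have "double_zero p 0 1 [\<lambda>q. bderiv_s q 0 1]" unfolding double_zero_def
          using 3 key by (auto simp: p 4 linear_binary)
        then show ?thesis by blast
      qed
    qed
  qed
qed

section \<open>Domination of ternary cubics is decided on the faces\<close>

lemma cubic_exhaust:
  fixes F :: cubic obtains a b c d e f g h i j where "F = (a,b,c,d,e,f,g,h,i,j)"
  by (metis prod.exhaust)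

fun face_x :: "cubic \<Rightarrow> binary_cubic" where "face_x (a,b,c,d,e,f,g,h,i,j) = (b,g,i,c)"

fun face_y :: "cubic \<Rightarrow> binary_cubic" where "face_y (a,b,c,d,e,f,g,h,i,j) = (a,e,h,c)"

fun face_z :: "cubic \<Rightarrow> binary_cubic" where "face_z (a,b,c,d,e,f,g,h,i,j) = (a,d,f,b)"

lemma face_simps:
  "\<And>F s t. beval (face_x F) s t = ev F (0,s,t)" "\<And>F s t. beval (face_y F) s t = ev F (s,0,t)" "\<And>F s t. beval (face_z F) s t = ev F (s,t,0)"
  "\<And>F s t. bderiv_s (face_x F) s t = gr F (0,s,t) (0,1,0)" "\<And>F s t. bderiv_t (face_x F) s t = gr F (0,s,t) (0,0,1)"
  "\<And>F s t. bderiv_s (face_y F) s t = gr F (s,0,t) (1,0,0)" "\<And>F s t. bderiv_t (face_y F) s t = gr F (s,0,t) (0,0,1)"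
  "\<And>F s t. bderiv_s (face_z F) s t = gr F (s,t,0) (1,0,0)" "\<And>F s t. bderiv_t (face_z F) s t = gr F (s,t,0) (0,1,0)"
  by (simp_all add: split_paired_all)

lemma linear_face: "linear face_x" "linear face_y" "linear face_z"
proof -
  have "\<And>x y. face_x (x + y) = face_x x + face_x y" "\<And>x y. face_y (x + y) = face_y x + face_y y" "\<And>x y. face_z (x + y) = face_z x + face_z y"
   "\<And>c x. face_x (c *\<^sub>R x) = c *\<^sub>R face_x x" "\<And>c x. face_y (c *\<^sub>R x) = c *\<^sub>R face_y x" "\<And>c x. face_z (c *\<^sub>R x) = c *\<^sub>R face_z x"
    by (simp_all add: split_paired_all)
  then show "linear face_x" "linear face_y" "linear face_z" by (auto intro!: linearI)
qed

definition no_variable_factor :: "cubic \<Rightarrow> bool" where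
  "no_variable_factor F \<longleftrightarrow> face_x F \<noteq> 0 \<and> face_y F \<noteq> 0 \<and> face_z F \<noteq> 0"

lemma copositive_face: "copositive F \<Longrightarrow> bnonneg (face_x F)" "copositive F \<Longrightarrow> bnonneg (face_y F)" "copositive F \<Longrightarrow> bnonneg (face_z F)"
  by (auto simp: copositive_def bnonneg_def face_simps)

text \<open>Subtract from \<open>v\<close> the largest multiple of \<open>P\<close> that stays in the orthant.\<close>

lemma ray_to_face:
  assumes "nonneg v" "nonneg P" "P \<noteq> 0"
  shows "\<exists>l b. 0 \<le> l \<and> nonneg b \<and> v = b + l *\<^sub>R P \<and> ((\<exists>s t. b = (0,s,t)) \<or> (\<exists>s t. b = (s,0,t)) \<or> (\<exists>s t. b = (s,t,0)))"
proof -
  obtain x y z where v: "v = (x,y,z)" by (cases v)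
  obtain p q r where P: "P = (p,q,r)" by (cases P)
  let ?L = "(\<lambda>(v,p). v / p) ` {w \<in> {(x,p),(y,q),(z,r)}. snd w > 0}"
  \<comment> \<open>the largest multiple of \<open>P\<close> that can be subtracted\<close>
  define l where "l = Min ?L"
  have fin: "finite ?L" by simp
  have ne: "?L \<noteq> {}" using assms(2,3) by (auto simp: P zero_prod_def less_le)
  have mem: "l \<in> ?L" unfolding l_def using fin ne by (rule Min_in)
  have le: "l * snd w \<le> fst w" if "w \<in> {(x,p),(y,q),(z,r)}" for w
  proof (cases "snd w > 0")
    case True
    then have "l \<le> fst w / snd w" unfolding l_def using that by (intro Min_le[OF fin]) force
    then show ?thesis using True by (simp add: field_simps)
  next
    case False
    then have "snd w = 0" using that assms(2) by (auto simp: P)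
    then show ?thesis using that assms(1) by (auto simp: v)
  qed
  have l0: "0 \<le> l" using mem assms(1) by (auto simp: v)
  have le': "l * p \<le> x" "l * q \<le> y" "l * r \<le> z" using le by force+
  have "x = l * p \<or> y = l * q \<or> z = l * r" using mem by (auto simp: field_simps)
  then show ?thesis
    by (intro exI[of _ l] exI[of _ "(x - l*p, y - l*q, z - l*r)"]) (use l0 le' in \<open>auto simp: v P\<close>)
qed

definition singular :: "cubic \<Rightarrow> vec \<Rightarrow> bool" where "singular F P \<longleftrightarrow> (\<forall>v. gr F P v = 0)"

lemma singularD: "singular F P \<Longrightarrow> gr F P v = 0"
  unfolding singular_def by (rule spec)

lemma singular_zero: "singular F P \<Longrightarrow> ev F P = 0"
  using euler[of F P] singularD[of F P P] by simp

text \<open>At a singular zero \<open>P\<close> the cubic is of degree one in the coordinate along \<open>P\<close>.\<close>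

lemma singular_line: "singular F P \<Longrightarrow> ev F (b + l *\<^sub>R P) = ev F b + l * gr F b P"
  by (simp add: ev_line singular_zero singularD)

lemma singular_shift: "singular F P \<Longrightarrow> gr F (v + l *\<^sub>R P) P = gr F v P"
  by (simp add: gr_line singularD)

lemma nonneg_add: "\<And>a b l. nonneg a \<Longrightarrow> nonneg b \<Longrightarrow> 0 \<le> l \<Longrightarrow> nonneg (a + l *\<^sub>R b)"
  by (simp add: split_paired_all)

text \<open>Otherwise \<open>F\<close> would become negative far out on the ray from \<open>b\<close> in the direction \<open>P\<close>.\<close>

lemma gr_nonneg:
  assumes "copositive F" "singular F P" "nonneg P" "nonneg b"
  shows "0 \<le> gr F b P"
proof (rule ccontr)
  assume n: "\<not> 0 \<le> gr F b P"
  have "0 \<le> ev F b" using assms unfolding copositive_def by blast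
  define l where "l = (ev F b + 1) / (- gr F b P)"
  have "l \<ge> 0" unfolding l_def using n \<open>0 \<le> ev F b\<close> by (intro divide_nonneg_nonneg) auto
  then have "0 \<le> ev F (b + l *\<^sub>R P)" using assms nonneg_add unfolding copositive_def by blast
  also have "\<dots> = ev F b + l * gr F b P" using singular_line[OF assms(2)] .
  also have "\<dots> = -1" unfolding l_def using n by (simp add: field_simps)
  finally show False by simp
qed

text \<open>Each point of the orthant is \<open>b + l P\<close> with \<open>b\<close> on a face, and both \<open>F\<close> and \<open>C\<close> are
affine in \<open>l\<close>.\<close>

lemma dominated_from_faces:
  assumes F: "copositive F" "singular F P" and P: "nonneg P" "P \<noteq> 0" and C: "singular C P"
    and f: "bdominated (face_x C) (face_x F)" "bdominated (face_y C) (face_y F)" "bdominated (face_z C) (face_z F)"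
    and q: "\<exists>k. \<forall>b. nonneg b \<longrightarrow> \<bar>gr C b P\<bar> \<le> k * gr F b P"
  shows "dominated C F"
proof -
  obtain k1 where k1: "\<And>s t. 0 \<le> s \<Longrightarrow> 0 \<le> t \<Longrightarrow> \<bar>ev C (0,s,t)\<bar> \<le> k1 * ev F (0,s,t)"
    using f(1) unfolding bdominated_def face_simps by blast
  obtain k2 where k2: "\<And>s t. 0 \<le> s \<Longrightarrow> 0 \<le> t \<Longrightarrow> \<bar>ev C (s,0,t)\<bar> \<le> k2 * ev F (s,0,t)"
    using f(2) unfolding bdominated_def face_simps by blast
  obtain k3 where k3: "\<And>s t. 0 \<le> s \<Longrightarrow> 0 \<le> t \<Longrightarrow> \<bar>ev C (s,t,0)\<bar> \<le> k3 * ev F (s,t,0)"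
    using f(3) unfolding bdominated_def face_simps by blast
  obtain k4 where k4: "\<And>b. nonneg b \<Longrightarrow> \<bar>gr C b P\<bar> \<le> k4 * gr F b P" using q by blast
  define k where "k = max (max k1 k2) (max k3 k4)"
  have nnF: "0 \<le> ev F b" if "nonneg b" for b using F(1) that unfolding copositive_def by blast
  show ?thesis unfolding dominated_def
  proof (intro exI allI impI)
    fix v assume v: "nonneg v"
    obtain l b where lb: "0 \<le> l" "nonneg b" "v = b + l *\<^sub>R P"
      "(\<exists>s t. b = (0,s,t)) \<or> (\<exists>s t. b = (s,0,t)) \<or> (\<exists>s t. b = (s,t,0))" using ray_to_face[OF v P] by metis
    have 1: "\<bar>ev C b\<bar> \<le> k * ev F b"
    proof -
      have "\<exists>k'\<le>k. \<bar>ev C b\<bar> \<le> k' * ev F b"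
        using lb(4)
      proof (elim disjE exE)
        fix s t assume "b = (0,s,t)"
        then show ?thesis using k1[of s t] lb(2) by (intro exI[of _ k1]) (auto simp: k_def)
      next
        fix s t assume "b = (s,0,t)"
        then show ?thesis using k2[of s t] lb(2) by (intro exI[of _ k2]) (auto simp: k_def)
      next
        fix s t assume "b = (s,t,0)"
        then show ?thesis using k3[of s t] lb(2) by (intro exI[of _ k3]) (auto simp: k_def)
      qed
      then show ?thesis using nnF[OF lb(2)] by (meson mult_right_mono order_trans)
    qed
    have 2: "\<bar>gr C b P\<bar> \<le> k * gr F b P"
    proof -
      have "k4 * gr F b P \<le> k * gr F b P" using gr_nonneg[OF F P(1) lb(2)] by (intro mult_right_mono) (auto simp: k_def)
      then show ?thesis using k4[OF lb(2)] by linarith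
    qed
    have "\<bar>ev C v\<bar> \<le> \<bar>ev C b\<bar> + l * \<bar>gr C b P\<bar>"
      unfolding lb(3) singular_line[OF C] 
      using lb(1) abs_triangle_ineq[of "ev C b" "l * gr C b P"] by (simp add: abs_mult)
    also have "\<dots> \<le> k * ev F b + l * (k * gr F b P)" using 1 2 lb(1) by (intro add_mono mult_left_mono)
    also have "\<dots> = k * ev F v" unfolding lb(3) singular_line[OF F(2)] by (simp add: algebra_simps)
    finally show "\<bar>ev C v\<bar> \<le> k * ev F v" .
  qed
qed

lemma gr_cont: "continuous_on S (\<lambda>v. gr F v P)"
proof -
  obtain a b c d e f g h i j where F: "F = (a,b,c,d,e,f,g,h,i,j)" by (rule cubic_exhaust)
  obtain u v w where P: "P = (u,v,w)" by (cases P)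
  have "(\<lambda>V. gr F V P) = (\<lambda>V. gr F (fst V, fst (snd V), snd (snd V)) P)" by simp
  then show ?thesis unfolding F P gr.simps by (simp only:) (intro continuous_intros)
qed

text \<open>The form \<open>v \<mapsto> gr F v P\<close> lives on the quotient by \<open>P\<close>.  It is positive on the unit sphere of the
orthogonal complement of \<open>P\<close>, so compactness gives the constant.\<close>

lemma definite_bound:
  assumes "singular F P" "singular C P" "P \<noteq> 0" "\<And>v. 0 \<le> gr F v P" "\<And>v. gr F v P = 0 \<Longrightarrow> \<exists>c. v = c *\<^sub>R P"
  shows "\<exists>k. \<forall>v. \<bar>gr C v P\<bar> \<le> k * gr F v P"
proof -
  let ?K = "sphere 0 1 \<inter> {v. P \<bullet> v = 0}"
  have "\<exists>k. \<forall>v\<in>?K. \<bar>gr C v P\<bar> \<le> k * gr F v P"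
  proof (rule compact_compare)
    show "compact ?K" by (intro compact_Int_closed closed_hyperplane) auto
    fix v assume v: "v \<in> ?K"
    have "gr F v P \<noteq> 0"
    proof
      assume "gr F v P = 0"
      then obtain c where "v = c *\<^sub>R P" using assms(5) by blast
      with v assms(3) show False by auto
    qed
    then show "0 < gr F v P" using assms(4)[of v] by simp
  qed (rule gr_cont)+
  then obtain k where "\<forall>v\<in>?K. \<bar>gr C v P\<bar> \<le> k * gr F v P" by blast
  then have k: "\<And>v. norm v = 1 \<Longrightarrow> P \<bullet> v = 0 \<Longrightarrow> \<bar>gr C v P\<bar> \<le> k * gr F v P" by simp
  show ?thesis
  proof (intro exI allI)
    fix v
    define l where "l = (P \<bullet> v) / (P \<bullet> P)"
    define w where "w = v + (-l) *\<^sub>R P"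
    have 1: "P \<bullet> w = 0" unfolding w_def l_def using assms(3) by (simp add: inner_diff_right)
    have e: "gr D v P = gr D w P" if "singular D P" for D unfolding w_def by (rule singular_shift[OF that, symmetric])
    show "\<bar>gr C v P\<bar> \<le> k * gr F v P"
    proof (cases "w = 0")
      case True
      have z: "gr D 0 P = 0" for D using gr_hom[of D 0 P P] by simp
      show ?thesis unfolding e[OF assms(1)] e[OF assms(2)] True by (simp add: z)
    next
      case False
      define u where "u = (1 / norm w) *\<^sub>R w"
      have w: "w = norm w *\<^sub>R u" using False by (simp add: u_def)
      have "\<bar>gr C u P\<bar> \<le> k * gr F u P" using False 1 by (intro k) (auto simp: u_def)
      then have "(norm w)^2 * \<bar>gr C u P\<bar> \<le> (norm w)^2 * (k * gr F u P)" by (intro mult_left_mono) auto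
      then have "\<bar>gr C w P\<bar> \<le> k * gr F w P"
        by (subst (1 2) w) (simp only: gr_hom abs_mult abs_power2 abs_norm_cancel mult.left_commute)
      then show ?thesis unfolding e[OF assms(1)] e[OF assms(2)] .
    qed
  qed
qed

lemma gr_ext: "\<And>F u x y z. gr F u (x,y,z) = x * gr F u (1,0,0) + y * gr F u (0,1,0) + z * gr F u (0,0,1)"
  by (simp only: poly_eval) algebra

lemma singular_iff: "singular F P \<longleftrightarrow> gr F P (1,0,0) = 0 \<and> gr F P (0,1,0) = 0 \<and> gr F P (0,0,1) = 0"
  unfolding singular_def by (metis gr_ext mult_zero_right add.right_neutral prod.exhaust)

lemma partial_derivs:
  "((\<lambda>x. ev F (x,y,z)) has_real_derivative gr F (x,y,z) (1,0,0)) (at x)"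
  "((\<lambda>y. ev F (x,y,z)) has_real_derivative gr F (x,y,z) (0,1,0)) (at y)"
  "((\<lambda>z. ev F (x,y,z)) has_real_derivative gr F (x,y,z) (0,0,1)) (at z)"
proof -
  obtain a b c d e f g h i j where F: "F = (a,b,c,d,e,f,g,h,i,j)" by (rule cubic_exhaust)
  show "((\<lambda>x. ev F (x,y,z)) has_real_derivative gr F (x,y,z) (1,0,0)) (at x)"
  "((\<lambda>y. ev F (x,y,z)) has_real_derivative gr F (x,y,z) (0,1,0)) (at y)"
  "((\<lambda>z. ev F (x,y,z)) has_real_derivative gr F (x,y,z) (0,0,1)) (at z)"
    unfolding F by (auto intro!: derivative_eq_intros simp: algebra_simps power2_eq_square)
qed

lemma interior_min:
  assumes "copositive F" "positive v" "ev F v = 0"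
  shows "singular F v"
proof -
  obtain x y z where v: "v = (x,y,z)" by (cases v)
  show ?thesis unfolding singular_iff v
  proof (intro conjI)
    show "gr F (x,y,z) (1,0,0) = 0"
      by (rule min_deriv[OF partial_derivs(1)]) (use assms in \<open>auto simp: v copositive_def\<close>)
    show "gr F (x,y,z) (0,1,0) = 0"
      by (rule min_deriv[OF partial_derivs(2)]) (use assms in \<open>auto simp: v copositive_def\<close>)
    show "gr F (x,y,z) (0,0,1) = 0"
      by (rule min_deriv[OF partial_derivs(3)]) (use assms in \<open>auto simp: v copositive_def\<close>)
  qed
qed

fun mulx :: "quadric \<Rightarrow> cubic" where "mulx (a,b,c,d,e,f) = (a,0,0,d,e,b,0,c,0,f)"

fun muly :: "quadric \<Rightarrow> cubic" where "muly (a,b,c,d,e,f) = (0,b,0,a,0,d,f,0,c,e)"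

fun mulz :: "quadric \<Rightarrow> cubic" where "mulz (a,b,c,d,e,f) = (0,0,c,0,a,0,b,e,f,d)"

lemma ev_mul: "\<And>q x y z. ev (mulx q) (x,y,z) = x * qv q (x,y,z)" "\<And>q x y z. ev (muly q) (x,y,z) = y * qv q (x,y,z)"
  "\<And>q x y z. ev (mulz q) (x,y,z) = z * qv q (x,y,z)"
  by (simp_all add: split_paired_all algebra_simps power2_eq_square power3_eq_cube)

lemma face_mul[simp]: "\<And>q. face_x (mulx q) = 0" "\<And>q. face_y (muly q) = 0" "\<And>q. face_z (mulz q) = 0"
  by (simp_all add: split_paired_all zero_prod_def)

lemma ev_inj:
  assumes "\<And>v. ev F v = ev G v" shows "F = G"
proof -
  have z: "D = 0" if D: "\<And>v. ev D v = 0" for D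
  proof -
    obtain a b c d e f g h i j where [simp]: "D = (a,b,c,d,e,f,g,h,i,j)" by (rule cubic_exhaust)
    have "a = 0" "b = 0" "c = 0" using D[of "(1,0,0)"] D[of "(0,1,0)"] D[of "(0,0,1)"] by auto
    moreover have "d + f = 0" "f - d = 0" "e + h = 0" "h - e = 0" "g + i = 0" "i - g = 0"
      using D[of "(1,1,0)"] D[of "(1,-1,0)"] D[of "(1,0,1)"] D[of "(1,0,-1)"] D[of "(0,1,1)"] D[of "(0,1,-1)"] calculation
      by simp_all
    moreover have "a+b+c+d+e+f+g+h+i+j = 0" using D[of "(1,1,1)"] by simp
    ultimately show ?thesis by (simp add: zero_prod_def)
  qed
  have "ev (F - G) v = 0" for v using ev_add[of "F - G" G v] assms by simp
  then have "F - G = 0" by (rule z)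
  then show ?thesis by simp
qed

text \<open>A dominated cubic is a multiple of \<open>F\<close>, and a nonzero multiple of \<open>F\<close> has no variable as a factor.\<close>

lemma dominated_divisible:
  assumes "extremal_cubic F" "no_variable_factor F" "dominated C F" "face_x C = 0 \<or> face_y C = 0 \<or> face_z C = 0"
  shows "C = 0"
proof -
  obtain c where c: "C = c *\<^sub>R F" using assms unfolding extremal_cubic_def by blast
  have "c *\<^sub>R face_x F = 0 \<or> c *\<^sub>R face_y F = 0 \<or> c *\<^sub>R face_z F = 0"
    using assms(4) linear_face c by (metis linear_cmul)
  then show ?thesis using assms(2) c by (auto simp: no_variable_factor_def)
qed

lemma dominated_summand: "copositive C \<Longrightarrow> copositive D \<Longrightarrow> F = C + D \<Longrightarrow> dominated C F"
  unfolding dominated_def copositive_def by (intro exI[of _ 1]) (auto simp: ev_add)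

text \<open>Each of the three monomials of \<open>m\<close> gives a summand of \<open>F\<close> that is copositive and divisible by a variable;
all three vanish.\<close>

lemma linear_times_square:
  fixes m n :: vec
  assumes F: "extremal_cubic F" "no_variable_factor F" and m: "nonneg m" and e: "\<And>v. ev F v = (m \<bullet> v) * (n \<bullet> v)^2"
  shows False
proof -
  obtain m1 m2 m3 where mm: "m = (m1,m2,m3)" by (cases m)
  obtain x y z where nnn: "n = (x,y,z)" by (cases n)
  define q :: quadric where "q = (x^2, y^2, z^2, 2*x*y, 2*x*z, 2*y*z)"
  have q: "qv q v = (n \<bullet> v)^2" for v unfolding q_def nnn
    by (cases v) (simp add: algebra_simps power2_eq_square)
  have s: "F = m1 *\<^sub>R mulx q + (m2 *\<^sub>R muly q + m3 *\<^sub>R mulz q)"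
  proof (rule ev_inj)
    fix v show "ev F v = ev (m1 *\<^sub>R mulx q + (m2 *\<^sub>R muly q + m3 *\<^sub>R mulz q)) v"
      by (cases v) (simp add: ev_add ev_scale ev_mul q e mm algebra_simps)
  qed
  have c: "copositive (m1 *\<^sub>R mulx q)" "copositive (m2 *\<^sub>R muly q)" "copositive (m3 *\<^sub>R mulz q)"
    using m by (auto simp: copositive_def ev_scale ev_mul q mm)
  have add: "copositive (C + D)" if "copositive C" "copositive D" for C D using that by (auto simp: copositive_def ev_add)
  have 1: "m1 *\<^sub>R mulx q = 0"
    by (rule dominated_divisible[OF F dominated_summand[OF c(1) add[OF c(2,3)] s]]) (simp add: linear_cmul[OF linear_face(1)])
  have 2: "m2 *\<^sub>R muly q = 0"
    by (rule dominated_divisible[OF F dominated_summand[OF c(2) add[OF c(1,3)]]]) (use s in \<open>simp_all add: linear_cmul[OF linear_face(2)] algebra_simps\<close>)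
  have 3: "m3 *\<^sub>R mulz q = 0"
    by (rule dominated_divisible[OF F dominated_summand[OF c(3) add[OF c(1,2)]]]) (use s in \<open>simp_all add: linear_cmul[OF linear_face(3)] algebra_simps\<close>)
  from s 1 2 3 have "F = 0" by simp
  then show False using F by (simp add: extremal_cubic_def)
qed

section \<open>Lines in the zero set\<close>

text \<open>Cramer's rule, in a form without division.\<close>

lemma cramer: "\<And>P b e v. det3 P b e *\<^sub>R v = det3 v b e *\<^sub>R P + det3 P v e *\<^sub>R b + det3 P b v *\<^sub>R e"
  by (simp only: poly_eval prod.inject) (intro conjI, algebra+)

lemma cramer': "det3 P b e \<noteq> 0 \<Longrightarrow> v = (det3 v b e / det3 P b e) *\<^sub>R P + (det3 P v e / det3 P b e) *\<^sub>R b + (det3 P b v / det3 P b e) *\<^sub>R e"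
proof -
  assume D: "det3 P b e \<noteq> 0"
  have "(1 / det3 P b e) *\<^sub>R (det3 P b e *\<^sub>R v) = (1 / det3 P b e) *\<^sub>R (det3 v b e *\<^sub>R P + det3 P v e *\<^sub>R b + det3 P b v *\<^sub>R e)"
    by (simp only: cramer[of P b e v])
  then show ?thesis using D by (simp add: scaleR_add_right)
qed

lemma gr_expand: "\<And>F u v e s t. gr F (s *\<^sub>R u + t *\<^sub>R v) e =
   s^2 * gr F u e + s * t * (gr F (u+v) e - gr F u e - gr F v e) + t^2 * gr F v e"
  by (simp only: poly_eval) algebra

lemma gr_lin2: "\<And>F e s u t v. gr F e (s *\<^sub>R u + t *\<^sub>R v) = s * gr F e u + t * gr F e v"
  by (simp only: poly_eval) algebra

lemma det3_as_inner: "\<exists>n. \<forall>v. det3 P b v = n \<bullet> v"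
proof -
  obtain p q r where P: "P = (p,q,r)" by (cases P)
  obtain x y z where b: "b = (x,y,z)" by (cases b)
  show ?thesis by (rule exI[of _ "(q*z - r*y, r*x - p*z, p*y - q*x)"]) (auto simp: P b algebra_simps)
qed

lemma det3_zero:
  assumes "P \<noteq> 0" "\<And>e. e \<in> {(1,0,0),(0,1,0),(0,0,1)} \<Longrightarrow> det3 P b e = 0"
  shows "\<exists>c. b = c *\<^sub>R P"
proof -
  obtain p q r where P: "P = (p,q,r)" by (cases P)
  obtain x y z where b: "b = (x,y,z)" by (cases b)
  have e: "q*z - r*y = 0" "r*x = p*z" "p*y - q*x = 0"
    using assms(2)[of "(1,0,0)"] assms(2)[of "(0,1,0)"] assms(2)[of "(0,0,1)"] by (auto simp: P b)
  consider "p \<noteq> 0" | "q \<noteq> 0" | "r \<noteq> 0" using assms(1) by (auto simp: P zero_prod_def)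
  then show ?thesis
  proof cases
    case 1 then show ?thesis by (intro exI[of _ "x/p"]) (use e in \<open>auto simp: P b field_simps\<close>)
  next
    case 2 then show ?thesis by (intro exI[of _ "y/q"]) (use e in \<open>auto simp: P b field_simps\<close>)
  next
    case 3 then show ?thesis by (intro exI[of _ "z/r"]) (use e in \<open>auto simp: P b field_simps\<close>)
  qed
qed

text \<open>The plane spanned by \<open>P\<close> and \<open>b\<close> lies in the zero set of \<open>F\<close> and meets the interior of the
orthant.  Interior zeros are minima, so \<open>F\<close> is singular along the whole plane, and \<open>F\<close> is a linear form \<open>m\<close>
times the square of the linear form that defines the plane.  Then \<open>m\<close> is nonnegative on the orthant, which is
excluded by \<open>linear_times_square\<close>.\<close>

lemma line_in_zero_set:
  assumes F: "extremal_cubic F" "no_variable_factor F" and P: "nonneg P" "singular F P" "P \<noteq> 0" and b: "nonneg b" "ev F b = 0" "gr F b P = 0"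
    and positive: "positive (P + b)" and ind: "\<And>c. b \<noteq> c *\<^sub>R P"
  shows False
proof -
  have copositive_F: "copositive F" using F by (simp add: extremal_cubic_def)
  obtain e where e: "e \<in> {(1,0,0),(0,1,0),(0,0,1)}" and De: "det3 P b e \<noteq> 0"
    using det3_zero[OF P(3), of b] ind by blast
  have nne: "nonneg e" using e by auto
  let ?D = "det3 P b e"
  have z: "ev F (b + l *\<^sub>R P) = 0" for l using singular_line[OF P(2)] b by simp
  have s1: "singular F (b + l *\<^sub>R P)" if "l > 0" for l
  proof (rule interior_min[OF copositive_F _ z])
    obtain p q r where P': "P = (p,q,r)" by (cases P)
    obtain x y z where b': "b = (x,y,z)" by (cases b)
    show "positive (b + l *\<^sub>R P)" using that positive P(1) b(1)
      by (simp add: P' b') (smt (verit) mult_pos_pos mult_nonneg_nonneg mult_zero_right)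
  qed
  have sb: "gr F b v = 0" for v
  proof -
    have E: "0 = gr F b v + l * (gr F (b+P) v - gr F b v - gr F P v) + l^2 * gr F P v" if "l > 0" for l
      using gr_expand[of F 1 b l P v] singularD[OF s1[OF that], of v] by simp
    show ?thesis using E[of 1] E[of 2] singularD[OF P(2), of v] by simp
  qed
  have sPb: "gr F (s *\<^sub>R P + t *\<^sub>R b) v = 0" for s t v
  proof -
    have "gr F (P + b) v = 0" using singularD[OF s1[of 1], of v] by (simp add: add.commute)
    then show ?thesis using gr_expand[of F s P t b v] sb[of v] singularD[OF P(2), of v] by simp
  qed
  obtain n where n: "\<And>v. det3 P b v = n \<bullet> v" using det3_as_inner by blast
  let ?m = "\<lambda>v. det3 v b e * gr F e P + det3 P v e * gr F e b + det3 P b v * ev F e"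
  have main: "?D^3 * ev F v = (n \<bullet> v)^2 * ?m v" for v
  proof -
    have 0: "ev F (s *\<^sub>R P + t *\<^sub>R b) = 0" for s t using euler[of F "s *\<^sub>R P + t *\<^sub>R b"] sPb by simp
    have "?D^3 * ev F v = ev F (?D *\<^sub>R v)" by (simp only: ev_hom)
    also have "\<dots> = (det3 P b v)^2 * gr F e (det3 v b e *\<^sub>R P + det3 P v e *\<^sub>R b) + (det3 P b v)^3 * ev F e"
      by (simp only: cramer[of P b e v] ev_line[of F "det3 v b e *\<^sub>R P + det3 P v e *\<^sub>R b" "det3 P b v" e] 0 sPb)
    also have "gr F e (det3 v b e *\<^sub>R P + det3 P v e *\<^sub>R b) = det3 v b e * gr F e P + det3 P v e * gr F e b"
      by (rule gr_lin2)
    finally show ?thesis by (simp add: n power2_eq_square power3_eq_cube algebra_simps)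
  qed
  have m_inner: "\<exists>m. \<forall>v. ?m v = m \<bullet> v"
  proof -
    obtain p q r where P': "P = (p,q,r)" by (cases P)
    obtain x y z where b': "b = (x,y,z)" by (cases b)
    obtain i j k where e': "e = (i,j,k)" by (cases e)
    define A B C where ABC: "A = gr F e P" "B = gr F e b" "C = ev F e"
    show ?thesis unfolding ABC[symmetric]
      by (rule exI[of _ "(A * (y*k - z*j) + B * (r*j - q*k) + C * (q*z - r*y),
         A * (z*i - x*k) + B * (p*k - r*i) + C * (r*x - p*z), A * (x*j - y*i) + B * (q*i - p*j) + C * (p*y - q*x))"])
       (auto simp: P' b' e' algebra_simps)
  qed
  then obtain m where m: "\<And>v. ?m v = m \<bullet> v" by blast
  have ev: "ev F v = ((1/?D^3) *\<^sub>R m \<bullet> v) * (n \<bullet> v)^2" for v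
    using main[of v, unfolded m] De by (simp add: field_simps)
  have mpos: "0 \<le> (1/?D^3) *\<^sub>R m \<bullet> v" if "nonneg v" for v
  proof -
    let ?M = "\<lambda>v. (1/?D^3) *\<^sub>R m \<bullet> v"
    have ge: "0 \<le> ?M w" if "nonneg w" "n \<bullet> w \<noteq> 0" for w
    proof -
      have "0 \<le> ev F w" using copositive_F that unfolding copositive_def by blast
      then have "0 \<le> ?M w * (n \<bullet> w)^2" by (simp only: ev)
      moreover have "0 < (n \<bullet> w)^2" using that(2) by simp
      ultimately show ?thesis by (simp only: zero_le_mult_iff) linarith
    qed
    show ?thesis
    proof (cases "n \<bullet> v = 0")
      case True
      \<comment> \<open>the points of the plane itself are reached as limits in the direction \<open>e\<close>, which leaves it\<close>
      have *: "0 \<le> ?M v + l * ?M e" if "l > 0" for l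
      proof -
        have "0 \<le> ?M (v + l *\<^sub>R e)"
          using True De n[of e] that \<open>nonneg v\<close> nne by (intro ge nonneg_add) (auto simp: inner_add_right)
        then show ?thesis by (simp add: inner_add_right algebra_simps)
      qed
      have lim: "((\<lambda>l. ?M v + l * ?M e) \<longlongrightarrow> ?M v + 0 * ?M e) (at_right 0)" by (intro tendsto_intros)
      have "eventually (\<lambda>l. 0 \<le> ?M v + l * ?M e) (at_right (0::real))"
        using * eventually_at_right_less[of "0::real"] by (auto elim: eventually_mono simp del: inner_scaleR_left)
      from tendsto_lowerbound[OF lim this] show ?thesis by simp
    qed (use ge that in blast)
  qed
  have "nonneg ((1/?D^3) *\<^sub>R m)"
    using mpos[of "(1,0,0)"] mpos[of "(0,1,0)"] mpos[of "(0,0,1)"] by (cases "(1/?D^3) *\<^sub>R m") simp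
  then show False using linear_times_square[OF F _ ev] by blast
qed

section \<open>Existence of a singular point that is not a vertex\<close>

text \<open>Points are used as vectors from here on; quantifiers over them should not be split into coordinates.\<close>

declare split_paired_All [simp del] split_paired_Ex [simp del]

abbreviation axes :: "vec set" where "axes \<equiv> {(1,0,0),(0,1,0),(0,0,1)}"

lemma simplex_compact: "compact {v::vec. nonneg v \<and> v \<bullet> (1,1,1) = 1}"
proof -
  have "{v::vec. nonneg v \<and> v \<bullet> (1,1,1) = 1} = {v. 0 \<le> fst v} \<inter> {v. 0 \<le> fst (snd v)} \<inter> {v. 0 \<le> snd (snd v)} \<inter> {v. v \<bullet> (1,1,1) = 1}"
    by auto
  moreover have "closed {v::vec. 0 \<le> fst v}" "closed {v::vec. 0 \<le> fst (snd v)}" "closed {v::vec. 0 \<le> snd (snd v)}"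
     "closed {v::vec. v \<bullet> (1,1,1) = 1}"
    by (intro closed_Collect_le closed_Collect_eq continuous_intros)+
  ultimately have "closed {v::vec. nonneg v \<and> v \<bullet> (1,1,1) = 1}" by (auto intro!: closed_Int)
  moreover have "bounded {v::vec. nonneg v \<and> v \<bullet> (1,1,1) = 1}"
  proof (rule boundedI)
    fix v :: vec assume v: "v \<in> {v. nonneg v \<and> v \<bullet> (1,1,1) = 1}"
    obtain x y z where [simp]: "v = (x,y,z)" by (cases v)
    have "norm v \<le> \<bar>x\<bar> + norm (y,z)" using norm_Pair_le[of x "(y,z)"] by simp
    also have "\<dots> \<le> \<bar>x\<bar> + (\<bar>y\<bar> + \<bar>z\<bar>)" using norm_Pair_le[of y z] by simp
    also have "\<dots> \<le> 1" using v by simp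
    finally show "norm v \<le> 1" .
  qed
  ultimately show ?thesis by (simp add: compact_eq_bounded_closed)
qed

text \<open>Suppose that no positive multiple of \<open>g\<close> is below \<open>f\<close>.  Then \<open>f - \<epsilon> g\<close> has a negative minimum
on the simplex for every \<open>\<epsilon> > 0\<close>.  At the minimum the partial derivatives of \<open>f\<close> in the directions of the positive
coordinates are of order \<open>\<epsilon>\<close>.  A limit point for \<open>\<epsilon> \<rightarrow> 0\<close> is \<open>P\<close>.  A coordinate that is positive wherever
\<open>g\<close> is positive is covered even if it vanishes at \<open>P\<close>.\<close>

lemma singular_limit:
  fixes f g :: "vec \<Rightarrow> real" and f' g' :: "vec \<Rightarrow> vec \<Rightarrow> real"
  assumes hom: "\<And>c v. f (c *\<^sub>R v) = c^d * f v" "\<And>c v. g (c *\<^sub>R v) = c^d * g v"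
    and der: "\<And>v e. ((\<lambda>t. f (v + t *\<^sub>R e)) has_real_derivative f' v e) (at 0)"
      "\<And>v e. ((\<lambda>t. g (v + t *\<^sub>R e)) has_real_derivative g' v e) (at 0)"
    and cont: "continuous_on UNIV f" "continuous_on UNIV g"
      "\<And>e. continuous_on UNIV (\<lambda>v. f' v e)" "\<And>e. continuous_on UNIV (\<lambda>v. g' v e)"
    and nonneg: "\<And>v. nonneg v \<Longrightarrow> 0 \<le> f v"
    and below: "\<And>\<epsilon>. \<epsilon> > 0 \<Longrightarrow> \<exists>v. nonneg v \<and> f v < \<epsilon> * g v"
    and d: "d > 0"
  shows "\<exists>P. nonneg P \<and> P \<noteq> 0 \<and> f P = 0 \<and>
     (\<forall>e\<in>axes. P \<bullet> e > 0 \<or> (\<forall>v. nonneg v \<and> g v > 0 \<longrightarrow> v \<bullet> e > 0) \<longrightarrow> f' P e = 0)"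
proof -
  let ?s = "\<lambda>v::vec. v \<bullet> (1,1,1)"
  let ?K = "{v. nonneg v \<and> ?s v = 1}"
  have cK: "compact ?K" by (rule simplex_compact)
  have bd: "\<exists>B. \<forall>v\<in>?K. \<bar>h v\<bar> \<le> B" if "continuous_on UNIV h" for h :: "vec \<Rightarrow> real"
  proof -
    have "bounded (h ` ?K)" using cK that
      by (intro compact_imp_bounded compact_continuous_image) (auto intro: continuous_on_subset)
    then show ?thesis by (auto simp: bounded_iff)
  qed
  obtain B0 where B0: "\<And>v. v \<in> ?K \<Longrightarrow> \<bar>g v\<bar> \<le> B0" using bd[OF cont(2)] by blast
  have "\<forall>e. \<exists>B. \<forall>v\<in>?K. \<bar>g' v e\<bar> \<le> B" using bd[OF cont(4)] by blast
  from choice[OF this] obtain B1 where "\<forall>e. \<forall>v\<in>?K. \<bar>g' v e\<bar> \<le> B1 e" ..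
  then have B1: "\<And>e v. v \<in> ?K \<Longrightarrow> \<bar>g' v e\<bar> \<le> B1 e" by blast
  have normalise: "\<exists>c>0. \<exists>u\<in>?K. v = c *\<^sub>R u" if "nonneg v" "v \<noteq> 0" for v
  proof -
    obtain x y z where v: "v = (x,y,z)" by (cases v)
    have s: "?s v > 0" using that by (auto simp: v zero_prod_def less_le add_nonneg_eq_0_iff)
    have "(1/?s v) *\<^sub>R v \<in> ?K" using s that(1) by (simp add: v add_divide_distrib[symmetric])
    moreover have "v = ?s v *\<^sub>R ((1/?s v) *\<^sub>R v)" using s by simp
    ultimately show ?thesis using s by blast
  qed
  have step: "\<exists>p\<in>?K. g p > 0 \<and> f p \<le> \<epsilon> * B0 \<and> (\<forall>e\<in>axes. p \<bullet> e > 0 \<longrightarrow> \<bar>f' p e\<bar> \<le> \<epsilon> * (B1 e + d * B0))"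
    if \<epsilon>: "\<epsilon> > 0" for \<epsilon>
  proof -
    let ?H = "\<lambda>v. f v - \<epsilon> * g v"
    obtain v where v: "nonneg v" "?H v < 0" using below[OF \<epsilon>] by (auto simp: algebra_simps)
    have f0: "f 0 = 0" "g 0 = 0" using hom[of 0 0] d by (simp_all add: power_0_left)
    have "v \<noteq> 0" using v f0 by auto
    then obtain c u where u: "c > 0" "u \<in> ?K" "v = c *\<^sub>R u" using normalise v by blast
    have "?H v = c^d * ?H u" by (simp add: u(3) hom algebra_simps)
    then have Hu: "?H u < 0" using v u by (simp add: mult_less_0_iff)
    have "continuous_on ?K ?H"
      by (intro continuous_intros continuous_on_subset[OF cont(1)] continuous_on_subset[OF cont(2)]) auto
    then obtain p where p: "p \<in> ?K" "\<And>w. w \<in> ?K \<Longrightarrow> ?H p \<le> ?H w"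
      using continuous_attains_inf[OF cK, of ?H] u(2) by blast
    define \<mu> where "\<mu> = ?H p"
    have \<mu>: "\<mu> < 0" using p(2)[OF u(2)] Hu by (simp add: \<mu>_def)
    have fp: "0 \<le> f p" using p nonneg by auto
    have gp: "\<epsilon> * g p > 0" using \<mu> fp by (simp add: \<mu>_def)
    have gB: "\<epsilon> * g p \<le> \<epsilon> * B0" using B0[OF p(1)] \<epsilon> by (intro mult_left_mono) auto
    have global: "\<mu> * (?s w)^d \<le> ?H w" if w: "nonneg w" for w
    proof (cases "w = 0")
      case True then show ?thesis using f0 d by (simp add: zero_prod_def power_0_left)
    next
      case False
      then obtain c u where u: "c > 0" "u \<in> ?K" "w = c *\<^sub>R u" using normalise w by blast
      have "?H w = c^d * ?H u" by (simp add: u(3) hom algebra_simps)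
      moreover have "?s w = c" using u by (simp only: inner_scaleR_left) simp
      moreover have "c^d * \<mu> \<le> c^d * ?H u" using p(2)[OF u(2)] u(1) by (intro mult_left_mono) (auto simp: \<mu>_def)
      ultimately show ?thesis by (simp add: mult.commute)
    qed
    have "\<bar>f' p e\<bar> \<le> \<epsilon> * (B1 e + d * B0)" if e: "e \<in> axes" "p \<bullet> e > 0" for e
    proof -
      have se: "?s e = 1" using e by auto
      have sp: "?s p = 1" using p by simp
      \<comment> \<open>Extending the minimum from the simplex to the orthant by homogeneity makes Lagrange multipliers
        superfluous: \<open>f - \<epsilon> g - \<mu> s\<^sup>d\<close> with \<open>s\<close> the sum of the coordinates is nonnegative and vanishes at \<open>p\<close>.\<close>
      let ?h = "\<lambda>t. (f (p + t *\<^sub>R e) - \<epsilon> * g (p + t *\<^sub>R e)) - \<mu> * (?s p + t * ?s e)^d"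
      have D: "(?h has_real_derivative (f' p e - \<epsilon> * g' p e) - \<mu> * (d * (?s p + 0 * ?s e)^(d-1) * ?s e)) (at 0)"
        by (auto intro!: derivative_eq_intros der)
      have "(f' p e - \<epsilon> * g' p e) - \<mu> * (d * (?s p + 0 * ?s e)^(d-1) * ?s e) = 0"
      proof (rule DERIV_local_min[OF D e(2)], intro allI impI)
        fix t assume t: "\<bar>0 - t\<bar> < p \<bullet> e"
        have "nonneg (p + t *\<^sub>R e)" using t e p by (cases p) auto
        from global[OF this] have "?h t \<ge> 0" by (simp add: inner_add_left)
        moreover have "?h 0 = 0" using sp by (simp add: \<mu>_def)
        ultimately show "?h 0 \<le> ?h t" by simp
      qed
      then have "f' p e = \<epsilon> * g' p e + \<mu> * d" using sp se by simp
      then have "\<bar>f' p e\<bar> \<le> \<epsilon> * \<bar>g' p e\<bar> + d * (- \<mu>)"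
        using abs_triangle_ineq[of "\<epsilon> * g' p e" "\<mu> * d"] \<epsilon> \<mu> by (simp add: abs_mult mult.commute)
      also have "- \<mu> \<le> \<epsilon> * B0" using gB fp by (simp add: \<mu>_def)
      then have "\<epsilon> * \<bar>g' p e\<bar> + d * (- \<mu>) \<le> \<epsilon> * B1 e + d * (\<epsilon> * B0)"
        using B1[OF p(1), of e] \<epsilon> by (intro add_mono mult_left_mono) auto
      finally show ?thesis by (simp add: algebra_simps)
    qed
    moreover have "g p > 0" using gp \<epsilon> by (simp add: zero_less_mult_iff)
    moreover have "f p \<le> \<epsilon> * B0" using \<mu> gB by (simp add: \<mu>_def)
    ultimately show ?thesis using p(1) by blast
  qed
  define \<Phi> where "\<Phi> n p \<longleftrightarrow> p \<in> ?K \<and> g p > 0 \<and> f p \<le> inverse (Suc n) * B0 \<and>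
      (\<forall>e\<in>axes. p \<bullet> e > 0 \<longrightarrow> \<bar>f' p e\<bar> \<le> inverse (Suc n) * (B1 e + d * B0))" for n p
  have "\<exists>p. \<Phi> n p" for n
    using step[of "inverse (Suc n)"] unfolding \<Phi>_def by fastforce
  then obtain p where p0: "\<And>n. \<Phi> n (p n)" by metis
  have p1: "p n \<in> ?K" for n using p0[of n] unfolding \<Phi>_def by (elim conjE)
  have p2: "g (p n) > 0" for n using p0[of n] unfolding \<Phi>_def by (elim conjE)
  have p3: "f (p n) \<le> inverse (Suc n) * B0" for n using p0[of n] unfolding \<Phi>_def by (elim conjE)
  have p4: "\<bar>f' (p n) e\<bar> \<le> inverse (Suc n) * (B1 e + d * B0)" if "e \<in> axes" "p n \<bullet> e > 0" for n e
  proof -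
    have "\<forall>e\<in>axes. p n \<bullet> e > 0 \<longrightarrow> \<bar>f' (p n) e\<bar> \<le> inverse (Suc n) * (B1 e + d * B0)"
      using p0[of n] unfolding \<Phi>_def by (elim conjE)
    then show ?thesis using that by (elim ballE impE) auto
  qed
  note p = p1 p2 p3 p4
  obtain P r where P: "P \<in> ?K" "strict_mono (r :: nat \<Rightarrow> nat)" "(p \<circ> r) \<longlonglongrightarrow> P"
    using cK p1 unfolding compact_def by meson
  have lim: "(\<lambda>n. p (r n)) \<longlonglongrightarrow> P" using P(3) by (simp add: o_def)
  have small: "(\<lambda>n. inverse (real (Suc (r n))) * C) \<longlonglongrightarrow> 0" for C
    using LIMSEQ_subseq_LIMSEQ[OF LIMSEQ_inverse_real_of_nat P(2)] tendsto_mult_left_zero[of _ sequentially C] by (auto simp: o_def)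
  have cl: "(\<lambda>n. h (p (r n))) \<longlonglongrightarrow> h P" if "continuous_on UNIV h" for h :: "vec \<Rightarrow> real"
    using continuous_on_tendsto_compose[OF that lim] by auto
  have "f P \<le> 0" by (rule LIMSEQ_le[OF cl[OF cont(1)] small]) (use p3 in blast)
  then have fP: "f P = 0" using nonneg[of P] P by auto
  have "f' P e = 0" if e: "e \<in> axes" "P \<bullet> e > 0 \<or> (\<forall>v. nonneg v \<and> g v > 0 \<longrightarrow> v \<bullet> e > 0)" for e
  proof -
    have "\<forall>\<^sub>F n in sequentially. p (r n) \<bullet> e > 0"
      using e(2)
    proof
      assume "P \<bullet> e > 0"
      moreover have "(\<lambda>n. p (r n) \<bullet> e) \<longlonglongrightarrow> P \<bullet> e" by (intro tendsto_intros lim)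
      ultimately show ?thesis by (rule order_tendstoD(1)[rotated])
    next
      assume "\<forall>v. nonneg v \<and> g v > 0 \<longrightarrow> v \<bullet> e > 0"
      then have "p (r n) \<bullet> e > 0" for n using p1[of "r n"] p2[of "r n"] by blast
      then show ?thesis by (intro always_eventually) blast
    qed
    then have ev: "\<forall>\<^sub>F n in sequentially. \<bar>f' (p (r n)) e\<bar> \<le> inverse (Suc (r n)) * (B1 e + d * B0)"
      by (rule eventually_mono) (rule p4[OF e(1)])
    have "(\<lambda>n. f' (p (r n)) e) \<longlonglongrightarrow> 0"
      by (rule Lim_null_comparison[OF _ small]) (use ev in simp)
    with cl[OF cont(3)] show ?thesis using LIMSEQ_unique by blast
  qed
  moreover have "P \<noteq> 0" using P by (auto simp: zero_prod_def)
  ultimately show ?thesis using P fP by (intro exI[of _ P]) simp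
qed

lemma ev_deriv: "((\<lambda>t. ev F (v + t *\<^sub>R e)) has_real_derivative gr F v e) (at 0)"
  unfolding ev_line by (auto intro!: derivative_eq_intros)

lemma ev_cont: "continuous_on S (ev F)"
proof -
  have "continuous_on S (\<lambda>v. gr F v (1,0,0) * fst v + gr F v (0,1,0) * fst (snd v) + gr F v (0,0,1) * snd (snd v))"
    by (intro continuous_intros gr_cont)
  moreover have "ev F = (\<lambda>v. (gr F v (1,0,0) * fst v + gr F v (0,1,0) * fst (snd v) + gr F v (0,0,1) * snd (snd v)) / 3)"
  proof
    fix v :: vec
    obtain x y z where v: "v = (x,y,z)" by (cases v)
    show "ev F v = (gr F v (1,0,0) * fst v + gr F v (0,1,0) * fst (snd v) + gr F v (0,0,1) * snd (snd v)) / 3"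
      using euler[of F v] gr_ext[of F v x y z] by (simp add: v algebra_simps)
  qed
  ultimately show ?thesis by (metis (no_types, lifting) continuous_on_cong continuous_on_divide continuous_on_const zero_neq_numeral)
qed

text \<open>The cubic \<open>xyz\<close> is not dominated by \<open>F\<close>, and it is positive only at interior points; so all three
partial derivatives vanish in the limit.\<close>

lemma has_singular_point:
  assumes F: "extremal_cubic F" "no_variable_factor F"
  shows "\<exists>P. nonneg P \<and> P \<noteq> 0 \<and> singular F P"
proof -
  define G :: cubic where "G = (0,0,0,0,0,0,0,0,0,1)"
  have G: "ev G (x,y,z) = x*y*z" for x y z by (simp add: G_def)
  have copositive_F: "copositive F" using F by (simp add: extremal_cubic_def)
  have "\<exists>P. nonneg P \<and> P \<noteq> 0 \<and> ev F P = 0 \<and>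
     (\<forall>e\<in>axes. P \<bullet> e > 0 \<or> (\<forall>v. nonneg v \<and> ev G v > 0 \<longrightarrow> v \<bullet> e > 0) \<longrightarrow> gr F P e = 0)"
  proof (rule singular_limit[where d = 3 and g' = "gr G"])
    fix \<epsilon> :: real assume \<epsilon>: "\<epsilon> > 0"
    show "\<exists>v. nonneg v \<and> ev F v < \<epsilon> * ev G v"
    proof (rule ccontr)
      assume "\<not> ?thesis"
      then have *: "\<And>v. nonneg v \<Longrightarrow> \<epsilon> * ev G v \<le> ev F v" by (meson not_le)
      have "dominated G F" unfolding dominated_def
      proof (intro exI allI impI)
        fix v assume v: "nonneg v"
        then have "0 \<le> ev G v" by (cases v) (simp add: G)
        then show "\<bar>ev G v\<bar> \<le> (1/\<epsilon>) * ev F v" using *[OF v] \<epsilon> by (simp add: field_simps)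
      qed
      then have "G = 0" using dominated_divisible[OF F] by (simp add: G_def zero_prod_def)
      then show False by (simp add: G_def zero_prod_def)
    qed
  qed (use copositive_F in \<open>auto simp: ev_hom ev_deriv ev_cont gr_cont copositive_def\<close>)
  then obtain P where P: "nonneg P" "P \<noteq> 0"
    "\<forall>e\<in>axes. P \<bullet> e > 0 \<or> (\<forall>v. nonneg v \<and> ev G v > 0 \<longrightarrow> v \<bullet> e > 0) \<longrightarrow> gr F P e = 0" by blast
  have "\<And>e v. e \<in> axes \<Longrightarrow> nonneg v \<Longrightarrow> ev G v > 0 \<Longrightarrow> v \<bullet> e > 0"
    by (auto simp: G zero_less_mult_iff)
  then have "singular F P" using P(3) unfolding singular_iff by blast
  with P show ?thesis by blast
qed

text \<open>If \<open>(0,0,1)\<close> is singular, then \<open>F = z q(x,y) + C(x,y)\<close>, both summands are copositive, and the first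
one is divisible by \<open>z\<close>.  So \<open>F = C\<close> is binary, and domination by \<open>F\<close> amounts to at most two conditions on
binary cubics.  One of the four dimensions is left after imposing divisibility by \<open>s\<close> as well, which contradicts
\<open>dominated_divisible\<close>.\<close>

lemma vertex3_not_singular:
  assumes F: "extremal_cubic F" "no_variable_factor F" and s: "singular F (0,0,1)"
  shows False
proof -
  have copositive_F: "copositive F" using F by (simp add: extremal_cubic_def)
  obtain a b c d e f g h i j where F0: "F = (a,b,c,d,e,f,g,h,i,j)" by (rule cubic_exhaust)
  have z: "c = 0" "h = 0" "i = 0" using s unfolding singular_iff F0 by auto
  define q :: quadric where "q = (e,g,0,j,0,0)"
  define C :: cubic where "C = (a,b,0,d,0,f,0,0,0,0)"
  have sum: "F = mulz q + C" by (simp add: F0 z q_def C_def)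
  have co1: "copositive (mulz q)" unfolding copositive_def
  proof (intro allI impI)
    fix v assume v: "nonneg v"
    obtain x y z where v': "v = (x,y,z)" by (cases v)
    have "0 \<le> gr F (x,y,0) (0,0,1)" using gr_nonneg[OF copositive_F s, of "(x,y,0)"] v v' by simp
    then have "0 \<le> qv q v" by (simp add: F0 q_def v' z algebra_simps)
    then show "0 \<le> ev (mulz q) v" using v by (simp add: v' ev_mul)
  qed
  have co2: "copositive C" unfolding copositive_def
  proof (intro allI impI)
    fix v assume v: "nonneg v"
    obtain x y z where v': "v = (x,y,z)" by (cases v)
    have "0 \<le> ev F (x,y,0)" using copositive_F v by (simp add: copositive_def v')
    then show "0 \<le> ev C v" by (simp add: F0 C_def v')
  qed
  have "mulz q = 0" by (rule dominated_divisible[OF F dominated_summand[OF co1 co2 sum]]) simp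
  then have FC: "F = C" using sum by simp
  let ?p = "face_z F"
  have L: "\<exists>L :: (binary_cubic \<Rightarrow> real) list. (\<forall>\<phi>\<in>set L. linear \<phi>) \<and> length L \<le> 2 \<and> (\<forall>q. inherits_end_zeros ?p q \<and> (\<forall>\<phi>\<in>set L. \<phi> q = 0) \<longrightarrow> bdominated q ?p)"
  proof -
    have "(\<forall>q. inherits_end_zeros ?p q \<longrightarrow> bdominated q ?p) \<or> (\<exists>\<sigma> \<tau> L. double_zero ?p \<sigma> \<tau> L)"
      using binary_cases[OF copositive_face(3)[OF copositive_F]] F(2) unfolding no_variable_factor_def by blast
    then show ?thesis
    proof (elim disjE exE)
      assume "\<forall>q. inherits_end_zeros ?p q \<longrightarrow> bdominated q ?p" then show ?thesis by (intro exI[of _ "[]"]) simp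
    next
      fix \<sigma> \<tau> L assume "double_zero ?p \<sigma> \<tau> L"
      then show ?thesis unfolding double_zero_def by (intro exI[of _ L]) simp
    qed
  qed
  then obtain L :: "(binary_cubic \<Rightarrow> real) list" where L: "\<And>\<phi>. \<phi> \<in> set L \<Longrightarrow> linear \<phi>" "length L \<le> 2"
    "\<And>q. inherits_end_zeros ?p q \<Longrightarrow> (\<And>\<phi>. \<phi> \<in> set L \<Longrightarrow> \<phi> q = 0) \<Longrightarrow> bdominated q ?p" by blast
  have "\<exists>r. r \<noteq> 0 \<and> (\<forall>\<phi>\<in>set ((\<lambda>q. beval q 0 1) # L). \<phi> r = 0)"
    by (rule kernel) (use L(1,2) in \<open>auto simp: linear_binary\<close>)
  then obtain r where r: "r \<noteq> 0" "beval r 0 1 = 0" "\<And>\<phi>. \<phi> \<in> set L \<Longrightarrow> \<phi> r = 0" by auto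
  have nz: "a \<noteq> 0" "b \<noteq> 0" using F(2) unfolding no_variable_factor_def FC C_def by (auto simp: zero_prod_def)
  have "inherits_end_zeros ?p r" using nz by (simp add: inherits_end_zeros_def F0)
  then have bd: "bdominated r ?p" using L(3) r(3) by blast
  obtain r1 r2 r3 r4 where r': "r = (r1,r2,r3,r4)" by (cases r)
  define R :: cubic where "R = (r1,r4,0,r2,0,r3,0,0,0,0)"
  have "dominated R F" unfolding dominated_def
  proof -
    obtain k where k: "\<And>s t. 0 \<le> s \<Longrightarrow> 0 \<le> t \<Longrightarrow> \<bar>beval r s t\<bar> \<le> k * beval ?p s t" using bd unfolding bdominated_def by blast
    have "\<bar>ev R v\<bar> \<le> k * ev F v" if "nonneg v" for v
    proof -
      obtain x y z where v': "v = (x,y,z)" by (cases v)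
      have "ev R v = beval r x y" by (simp add: R_def r' v')
      moreover have "ev F v = beval ?p x y" unfolding FC C_def by (simp add: v')
      ultimately show ?thesis using k[of x y] that by (simp add: v')
    qed
    then show "\<exists>k. \<forall>v. nonneg v \<longrightarrow> \<bar>ev R v\<bar> \<le> k * ev F v" by blast
  qed
  then have "R = 0" by (rule dominated_divisible[OF F]) (use r(2) in \<open>simp add: R_def r' zero_prod_def\<close>)
  then show False using r(1) by (simp add: R_def r' zero_prod_def)
qed

text \<open>The substitutions \<open>F(y,x,z)\<close> and \<open>F(y,z,x)\<close> on coefficient vectors.\<close>

fun swap_xy :: "cubic \<Rightarrow> cubic" where "swap_xy (a,b,c,d,e,f,g,h,i,j) = (b,a,c,f,g,d,e,i,h,j)"

fun cycle :: "cubic \<Rightarrow> cubic" where "cycle (a,b,c,d,e,f,g,h,i,j) = (c,a,b,h,i,e,d,g,f,j)"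

fun swap_vec :: "vec \<Rightarrow> vec" where "swap_vec (x,y,z) = (y,x,z)"

fun cycle_vec :: "vec \<Rightarrow> vec" where "cycle_vec (x,y,z) = (y,z,x)"

lemma swap_xy_simps: "\<And>F v. ev (swap_xy F) v = ev F (swap_vec v)" "\<And>F. swap_xy (swap_xy F) = F" "\<And>v. nonneg (swap_vec v) = nonneg v" "\<And>v. swap_vec (swap_vec v) = v"
  "\<And>F u v. gr (swap_xy F) u v = gr F (swap_vec u) (swap_vec v)"
  by (auto simp: split_paired_all algebra_simps)

lemma cycle_simps: "\<And>F v. ev (cycle F) v = ev F (cycle_vec v)" "\<And>F. cycle (cycle (cycle F)) = F" "\<And>v. nonneg (cycle_vec v) = nonneg v" "\<And>v. cycle_vec (cycle_vec (cycle_vec v)) = v"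
  "\<And>F u v. gr (cycle F) u v = gr F (cycle_vec u) (cycle_vec v)"
  by (auto simp: split_paired_all algebra_simps)

text \<open>Substitutions that preserve the orthant preserve domination.\<close>

lemma extremal_cubic_perm:
  fixes T T' :: "cubic \<Rightarrow> cubic" and \<tau> \<tau>' :: "vec \<Rightarrow> vec"
  assumes T: "\<And>F v. ev (T F) v = ev F (\<tau> v)" "\<And>F. T (T' F) = F" and n: "\<And>v. nonneg (\<tau> v) = nonneg v" "\<And>v. \<tau> (\<tau>' v) = v"
    and F: "extremal_cubic F"
  shows "extremal_cubic (T F)"
  unfolding extremal_cubic_def
proof (intro conjI allI impI)
  have F': "copositive F" "F \<noteq> 0" "\<And>C. dominated C F \<Longrightarrow> \<exists>c. C = c *\<^sub>R F" using F unfolding extremal_cubic_def by blast+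
  show "copositive (T F)" using F'(1) by (simp add: copositive_def T(1) n(1) del: split_paired_All)
  show "T F \<noteq> 0"
  proof
    assume 0: "T F = 0"
    have "ev F v = ev (T F) (\<tau>' v)" for v by (simp add: T(1) n(2))
    also have "\<dots> v = ev 0 v" for v using ev_scale[of 0 0] by (simp add: 0)
    finally have "F = 0" by (rule ev_inj)
    then show False using F'(2) by simp
  qed
  fix C assume "dominated C (T F)"
  then obtain k where k: "\<And>v. nonneg v \<Longrightarrow> \<bar>ev C v\<bar> \<le> k * ev (T F) v" unfolding dominated_def by blast
  have "dominated (T' C) F" unfolding dominated_def
  proof (intro exI allI impI)
    fix v assume v: "nonneg v"
    have 1: "nonneg (\<tau>' v)" using n(1)[of "\<tau>' v"] n(2)[of v] v by simp
    have "ev (T' C) v = ev C (\<tau>' v)" using T(1)[of "T' C" "\<tau>' v"] by (simp add: T(2) n(2))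
    moreover have "ev F v = ev (T F) (\<tau>' v)" by (simp add: T(1) n(2))
    ultimately show "\<bar>ev (T' C) v\<bar> \<le> k * ev F v" using k[OF 1] by simp
  qed
  then obtain c where c: "T' C = c *\<^sub>R F" using F'(3) by blast
  have "C = c *\<^sub>R T F"
  proof (rule ev_inj)
    fix v
    have "ev C v = ev (T (T' C)) v" by (simp only: T(2))
    also have "\<dots> = ev (c *\<^sub>R F) (\<tau> v)" by (simp only: T(1) c)
    finally show "ev C v = ev (c *\<^sub>R T F) v" by (simp only: ev_scale T(1))
  qed
  then show "\<exists>c. C = c *\<^sub>R T F" by blast
qed

lemma extremal_cubic_swap_xy: "extremal_cubic F \<Longrightarrow> extremal_cubic (swap_xy F)"
  by (rule extremal_cubic_perm[where \<tau> = "swap_vec" and T' = "swap_xy" and \<tau>' = "swap_vec"]) (simp_all add: swap_xy_simps)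

lemma extremal_cubic_cycle: "extremal_cubic F \<Longrightarrow> extremal_cubic (cycle F)"
  by (rule extremal_cubic_perm[where \<tau> = "cycle_vec" and T' = "cycle \<circ> cycle" and \<tau>' = "cycle_vec \<circ> cycle_vec"]) (simp_all add: cycle_simps)

lemma no_variable_factor_perm: "\<And>F. no_variable_factor (swap_xy F) = no_variable_factor F" "\<And>F. no_variable_factor (cycle F) = no_variable_factor F"
  unfolding no_variable_factor_def by (auto simp: split_paired_all zero_prod_def)

lemma vertex_not_singular:
  assumes "extremal_cubic F" "no_variable_factor F" "v \<in> axes" "singular F v" shows False
proof -
  have s: "gr F v w = 0" for w using singularD[OF assms(4)] .
  have "v = (0,0,1) \<or> v = (0,1,0) \<or> v = (1,0,0)" using assms(3) by auto
  then show False
  proof (elim disjE)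
    assume "v = (0,0,1)" then show False using assms vertex3_not_singular by blast
  next
    assume v: "v = (0,1,0)"
    have "singular (cycle F) (0,0,1)" unfolding singular_def cycle_simps(5) using s v by (simp del: split_paired_All)
    then show False using vertex3_not_singular extremal_cubic_cycle no_variable_factor_perm assms by blast
  next
    assume v: "v = (1,0,0)"
    have "singular (cycle (cycle F)) (0,0,1)" unfolding singular_def cycle_simps(5) using s v by (simp del: split_paired_All)
    then show False using vertex3_not_singular extremal_cubic_cycle no_variable_factor_perm assms by blast
  qed
qed

lemma singular_scale: "singular F P \<Longrightarrow> singular F (c *\<^sub>R P)"
  unfolding singular_def gr_hom by (metis mult_zero_right)

section \<open>Zeros of a quadric bounded by an extremal cubic\<close>

lemma cancel_pos: "t * A \<le> t * B \<Longrightarrow> 0 < t \<Longrightarrow> A \<le> B" for t A B :: real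
  by simp

text \<open>The bound on \<open>\<surd>(xy) Q\<close> by a multiple of \<open>F\<close>, squared to keep both sides polynomial.\<close>

definition square_bounded :: "quadric \<Rightarrow> cubic \<Rightarrow> bool" where
  "square_bounded Q F \<longleftrightarrow> (\<exists>k. \<forall>x y z. 0 \<le> x \<longrightarrow> 0 \<le> y \<longrightarrow> 0 \<le> z \<longrightarrow> x * y * (qv Q (x,y,z))^2 \<le> k * (ev F (x,y,z))^2)"

lemma pol_sym: "\<And>Q u v. pol Q u v = pol Q v u" by (simp only: poly_eval) algebra

lemma pol_self: "\<And>Q u. pol Q u u = 2 * qv Q u" by (simp only: poly_eval) algebra

lemma pol_ext: "\<And>Q u x y z. pol Q u (x,y,z) = x * pol Q u (1,0,0) + y * pol Q u (0,1,0) + z * pol Q u (0,0,1)"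
  by (simp only: poly_eval) algebra

lemma qv_lin2: "\<And>Q u v a b. qv Q (a *\<^sub>R u + b *\<^sub>R v) = a^2 * qv Q u + a * b * pol Q u v + b^2 * qv Q v"
  by (simp only: poly_eval) algebra

definition in_radical :: "quadric \<Rightarrow> vec \<Rightarrow> bool" where "in_radical Q P \<longleftrightarrow> (\<forall>v. pol Q P v = 0)"

lemma in_radicalD: "in_radical Q P \<Longrightarrow> pol Q P v = 0" "in_radical Q P \<Longrightarrow> pol Q v P = 0"
  unfolding in_radical_def using pol_sym by metis+

lemma in_radical_iff: "in_radical Q P \<longleftrightarrow> pol Q P (1,0,0) = 0 \<and> pol Q P (0,1,0) = 0 \<and> pol Q P (0,0,1) = 0"
  unfolding in_radical_def by (metis pol_ext mult_zero_right add.right_neutral prod.exhaust)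

lemma in_radical_zero: "in_radical Q P \<Longrightarrow> qv Q P = 0" using pol_self[of Q P] in_radicalD[of Q P P] by simp

lemma quadric_eq_0: 
  assumes "\<And>v. qv Q v = 0" shows "Q = 0"
proof -
  obtain a b c d e f where [simp]: "Q = (a,b,c,d,e,f)" by (metis prod.exhaust)
  have "a = 0" "b = 0" "c = 0" using assms[of "(1,0,0)"] assms[of "(0,1,0)"] assms[of "(0,0,1)"] by auto
  then show ?thesis using assms[of "(1,1,0)"] assms[of "(1,0,1)"] assms[of "(0,1,1)"] by (simp add: zero_prod_def)
qed

lemma ev_from_singular: "singular F P \<Longrightarrow> ev F (P + r *\<^sub>R b) = r^2 * (gr F b P + r * ev F b)"
  by (simp add: ev_line singular_zero singularD power2_eq_square power3_eq_cube algebra_simps)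

text \<open>Along \<open>P + t b\<close> with \<open>b\<close> interior, the right-hand side is of order \<open>t\<^sup>4\<close> and \<open>x y\<close>
is at least of order \<open>t\<close>.\<close>

lemma radical_at_singularity:
  assumes H: "square_bounded Q F" and P: "nonneg P" "singular F P" "fst P > 0 \<or> fst (snd P) > 0"
  shows "in_radical Q P"
proof -
  obtain k where k: "\<And>x y z. 0 \<le> x \<Longrightarrow> 0 \<le> y \<Longrightarrow> 0 \<le> z \<Longrightarrow> x * y * (qv Q (x,y,z))^2 \<le> k * (ev F (x,y,z))^2"
    using H unfolding square_bounded_def by blast
  obtain p q r where P': "P = (p,q,r)" by (cases P)
  have main: "pol Q P b = 0" if b: "positive b" for b
  proof -
    obtain x y z where b': "b = (x,y,z)" by (cases b)
    define c where "c = p * y + q * x"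
    have c: "c > 0" using P b by (auto simp: c_def P' b' add_pos_nonneg add_nonneg_pos)
    have "qv Q P = 0 \<and> pol Q P b = 0"
    proof (rule vanishes_doubly_at_zero[where h = "\<lambda>_. qv Q b" and w = "\<lambda>t. k / c * (gr F b P + t * ev F b)^2"])
      fix t :: real assume t: "0 < t" "t < 1"
      have "t * c * (qv Q (P + t *\<^sub>R b))^2 \<le> (p + t * x) * (q + t * y) * (qv Q (P + t *\<^sub>R b))^2"
        using t b P by (intro mult_right_mono) (auto simp: c_def P' b' algebra_simps)
      also have "\<dots> \<le> k * (ev F (P + t *\<^sub>R b))^2"
        using k[of "p + t * x" "q + t * y" "r + t * z"] t b P by (simp add: P' b')
      also have "\<dots> = t * c * (t^3 * (k / c * (gr F b P + t * ev F b)^2))"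
        unfolding ev_from_singular[OF P(2)] using c by (simp add: field_simps power2_eq_square power3_eq_cube)
      finally have "(qv Q (P + t *\<^sub>R b))^2 \<le> t^3 * (k / c * (gr F b P + t * ev F b)^2)"
        by (rule cancel_pos) (use t c in simp)
      then show "(qv Q P + pol Q P b * t + t\<^sup>2 * qv Q b)\<^sup>2 \<le> t ^ 3 * (k / c * (gr F b P + t * ev F b)\<^sup>2)"
        by (simp add: qv_line mult.commute)
    qed (use c in \<open>auto intro!: continuous_intros\<close>)
    then show ?thesis by simp
  qed
  have "pol Q P (1,1,1) = 0" "pol Q P (2,1,1) = 0" "pol Q P (1,2,1) = 0" "pol Q P (1,1,2) = 0" using main by auto
  then show ?thesis unfolding in_radical_iff
    using pol_ext[of Q P 1 1 1] pol_ext[of Q P 2 1 1] pol_ext[of Q P 1 2 1] pol_ext[of Q P 1 1 2] by auto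
qed

text \<open>Along \<open>(r,s,t)\<close> the factor \<open>x y\<close> is of order \<open>r\<close> and \<open>F\<^sup>2\<close> is of order \<open>r\<^sup>2\<close>.\<close>

lemma zero_on_face1:
  assumes H: "square_bounded Q F" and z: "ev F (0,s,t) = 0" "0 < s" "0 \<le> t"
  shows "qv Q (0,s,t) = 0"
proof -
  obtain k where k: "\<And>x y z. 0 \<le> x \<Longrightarrow> 0 \<le> y \<Longrightarrow> 0 \<le> z \<Longrightarrow> x * y * (qv Q (x,y,z))^2 \<le> k * (ev F (x,y,z))^2"
    using H unfolding square_bounded_def by blast
  let ?d = "(0,s,t)" and ?e = "(1::real,0::real,0::real)"
  let ?g = "\<lambda>r. qv Q ?d + r * pol Q ?d ?e + r^2 * qv Q ?e"
  have "?g 0 = 0"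
  proof (rule vanishes_at_zero[where g = ?g and w = "\<lambda>r. k / s * (gr F ?d ?e + r * gr F ?e ?d + r^2 * ev F ?e)^2"])
    fix r :: real assume r: "0 < r" "r < 1"
    have "r * s * (?g r)^2 \<le> k * (ev F (?d + r *\<^sub>R ?e))^2"
      using k[of r s t] r z qv_line[of Q ?d r ?e] by simp
    also have "\<dots> = r * s * (r * (k / s * (gr F ?d ?e + r * gr F ?e ?d + r^2 * ev F ?e)^2))"
      unfolding ev_line using z by (simp add: field_simps power2_eq_square power3_eq_cube)
    finally show "(?g r)^2 \<le> r * (k / s * (gr F ?d ?e + r * gr F ?e ?d + r^2 * ev F ?e)^2)"
      by (rule cancel_pos) (use r z in simp)
  qed (use z in \<open>auto intro!: continuous_intros\<close>)
  then show ?thesis by simp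
qed

fun swap_quadric :: "quadric \<Rightarrow> quadric" where "swap_quadric (a,b,c,d,e,f) = (b,a,c,d,f,e)"

lemma swap_quadric_simps: "\<And>Q v. qv (swap_quadric Q) v = qv Q (swap_vec v)" "\<And>Q u v. pol (swap_quadric Q) u v = pol Q (swap_vec u) (swap_vec v)" "\<And>Q. swap_quadric (swap_quadric Q) = Q"
  by (auto simp: split_paired_all algebra_simps)

lemma square_bounded_swap: "square_bounded Q F \<Longrightarrow> square_bounded (swap_quadric Q) (swap_xy F)"
  unfolding square_bounded_def swap_quadric_simps swap_xy_simps swap_vec.simps by (metis mult.commute)

lemma zero_on_face2:
  assumes "square_bounded Q F" "ev F (s,0,t) = 0" "0 < s" "0 \<le> t" shows "qv Q (s,0,t) = 0"
  using zero_on_face1[OF square_bounded_swap[OF assms(1)], of s t] assms(2-) by (simp add: swap_quadric_simps swap_xy_simps)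

text \<open>For a zero at the vertex \<open>(0,0,1)\<close>, where \<open>x y\<close> vanishes to order two, the curve \<open>(r\<^sup>2,r,t)\<close>
balances the terms: \<open>F\<^sup>2\<close> is of order \<open>r\<^sup>4\<close> while \<open>x y\<close> is only of order \<open>r\<^sup>3\<close>.\<close>

lemma double_on_face1:
  assumes H: "square_bounded Q F" and z: "bderiv_s (face_x F) s t = 0" "bderiv_t (face_x F) s t = 0" "0 \<le> s" "0 \<le> t" "0 < s + t"
  shows "ev F (0,s,t) = 0" "qv Q (0,s,t) = 0"
proof -
  obtain a b c d e f g h i j where F0: "F = (a,b,c,d,e,f,g,h,i,j)" by (rule cubic_exhaust)
  have "3 * ev F (0,s,t) = s * bderiv_s (face_x F) s t + t * bderiv_t (face_x F) s t"
    by (simp add: F0 algebra_simps power2_eq_square power3_eq_cube)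
  then show e0: "ev F (0,s,t) = 0" using z by simp
  show "qv Q (0,s,t) = 0"
  proof (cases "s > 0")
    case True then show ?thesis using zero_on_face1[OF H e0] z by simp
  next
    case False
    then have s: "s = 0" and t: "t > 0" using z by auto
    then have ci: "c = 0" "i = 0" using z by (auto simp: F0)
    obtain k where k: "\<And>x y z. 0 \<le> x \<Longrightarrow> 0 \<le> y \<Longrightarrow> 0 \<le> z \<Longrightarrow> x * y * (qv Q (x,y,z))^2 \<le> k * (ev F (x,y,z))^2"
      using H unfolding square_bounded_def by blast
    let ?w = "\<lambda>r. k * (a*r^4 + b*r + d*r^3 + e*r^2*t + f*r^2 + g*t + h*t^2 + j*r*t)^2"
    obtain q1 q2 q3 q4 q5 q6 where Q: "Q = (q1,q2,q3,q4,q5,q6)" by (metis prod.exhaust)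
    have "(\<lambda>r. qv Q (r^2,r,t)) 0 = 0"
    proof (rule vanishes_at_zero[where w = ?w and g = "\<lambda>r. qv Q (r^2,r,t)"])
      fix r :: real assume r: "0 < r" "r < 1"
      have "r^3 * (qv Q (r^2,r,t))^2 \<le> k * (ev F (r^2,r,t))^2"
        using k[of "r^2" r t] r t by (simp add: power3_eq_cube power2_eq_square)
      also have "ev F (r^2,r,t) = r^2 * (a*r^4 + b*r + d*r^3 + e*r^2*t + f*r^2 + g*t + h*t^2 + j*r*t)"
        by (simp add: F0 ci eval_nat_numeral algebra_simps)
      also have "k * (r^2 * (a*r^4 + b*r + d*r^3 + e*r^2*t + f*r^2 + g*t + h*t^2 + j*r*t))^2 = r^3 * (r * ?w r)"
        by algebra
      finally show "(qv Q (r^2,r,t))^2 \<le> r * ?w r" by (rule cancel_pos) (use r in simp)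
    qed (auto intro!: continuous_intros simp: Q)
    then show ?thesis by (simp add: s)
  qed
qed

lemma double_on_face2:
  assumes H: "square_bounded Q F" and z: "bderiv_s (face_y F) s t = 0" "bderiv_t (face_y F) s t = 0" "0 \<le> s" "0 \<le> t" "0 < s + t"
  shows "ev F (s,0,t) = 0" "qv Q (s,0,t) = 0"
  using double_on_face1[OF square_bounded_swap[OF H], of s t] z unfolding face_simps swap_xy_simps swap_quadric_simps by simp_all

text \<open>On the face \<open>z = 0\<close> itself \<open>x y\<close> vanishes to order at most one, so \<open>Q\<close> inherits a double zero.\<close>

lemma double_on_face3:
  assumes H: "square_bounded Q F" and z: "bderiv_s (face_z F) s t = 0" "bderiv_t (face_z F) s t = 0" "0 \<le> s" "0 \<le> t" "0 < s + t"
  shows "ev F (s,t,0) = 0" "pol Q (s,t,0) (1,0,0) = 0" "pol Q (s,t,0) (0,1,0) = 0"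
proof -
  let ?d = "(s,t,0::real)"
  have g: "gr F ?d (1,0,0) = 0" "gr F ?d (0,1,0) = 0" using z unfolding face_simps by auto
  have "3 * ev F ?d = s * gr F ?d (1,0,0) + t * gr F ?d (0,1,0)"
    using euler[of F ?d] gr_ext[of F ?d s t 0] by simp
  then show e0: "ev F ?d = 0" using g by (simp del: ev.simps gr.simps)
  obtain k where k: "\<And>x y z. 0 \<le> x \<Longrightarrow> 0 \<le> y \<Longrightarrow> 0 \<le> z \<Longrightarrow> x * y * (qv Q (x,y,z))^2 \<le> k * (ev F (x,y,z))^2"
    using H unfolding square_bounded_def by blast
  have path: "qv Q ?d = 0 \<and> pol Q ?d e = 0" if e: "e = (1,0,0) \<and> t > 0 \<or> e = (0,1,0) \<and> s > 0" for e
  proof (rule vanishes_doubly_at_zero[where h = "\<lambda>_. qv Q e" and w = "\<lambda>r. k / (if e = (1,0,0) then t else s) * (gr F e ?d + r * ev F e)^2"])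
    fix r :: real assume r: "0 < r" "r < 1"
    let ?c = "if e = (1,0,0) then t else s"
    have c: "?c > 0" using e by (elim disjE conjE) simp_all
    have ge: "gr F ?d e = 0" using g e by metis
    have q: "qv Q ?d + pol Q ?d e * r + r^2 * qv Q e = qv Q (?d + r *\<^sub>R e)" by (simp add: qv_line mult.commute)
    have evd: "ev F (?d + r *\<^sub>R e) = r^2 * (gr F e ?d + r * ev F e)"
      unfolding ev_line e0 ge by (simp add: power2_eq_square power3_eq_cube algebra_simps)
    have "r * ?c * (qv Q (?d + r *\<^sub>R e))^2 \<le> k * (ev F (?d + r *\<^sub>R e))^2"
      using e
    proof
      assume e: "e = (1,0,0) \<and> t > 0"
      have "r * t * (qv Q (s+r,t,0))^2 \<le> (s + r) * t * (qv Q (s+r,t,0))^2"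
        using z e by (intro mult_right_mono) auto
      also have "\<dots> \<le> k * (ev F (s+r,t,0))^2" by (rule k) (use r z in auto)
      finally show ?thesis using e by simp
    next
      assume e: "e = (0,1,0) \<and> s > 0"
      have "r * s * (qv Q (s,t+r,0))^2 \<le> s * (t + r) * (qv Q (s,t+r,0))^2"
        using z e by (intro mult_right_mono) auto
      also have "\<dots> \<le> k * (ev F (s,t+r,0))^2" by (rule k) (use r z in auto)
      finally show ?thesis using e by simp
    qed
    also have "\<dots> = r * ?c * (r^3 * (k / ?c * (gr F e ?d + r * ev F e)^2))"
      unfolding evd using c by (simp add: field_simps power2_eq_square power3_eq_cube)
    finally have "(qv Q (?d + r *\<^sub>R e))^2 \<le> r^3 * (k / ?c * (gr F e ?d + r * ev F e)^2)"
      by (rule cancel_pos) (use r c in simp)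
    then show "(qv Q ?d + pol Q ?d e * r + r^2 * qv Q e)^2 \<le> r^3 * (k / ?c * (gr F e ?d + r * ev F e)^2)"
      by (simp only: q)
  next
    have "(if e = (1,0,0) then t else s) \<noteq> 0" using that by (elim disjE conjE) simp_all
    then show "isCont (\<lambda>r. k / (if e = (1,0,0) then t else s) * (gr F e ?d + r * ev F e)^2) 0"
      by (intro continuous_intros)
  qed simp
  have "t > 0 \<or> s > 0" using z by linarith
  then have q0: "qv Q ?d = 0" using path[of "(1,0,0)"] path[of "(0,1,0)"] by auto
  have e: "s * pol Q ?d (1,0,0) + t * pol Q ?d (0,1,0) = 0"
    using pol_self[of Q ?d] pol_ext[of Q ?d s t 0] q0 by simp
  show "pol Q ?d (1,0,0) = 0"
  proof (cases "t > 0")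
    case False
    then have "t = 0" "s > 0" using z by auto
    then show ?thesis using e by (simp del: pol.simps)
  qed (use path in blast)
  show "pol Q ?d (0,1,0) = 0"
  proof (cases "s > 0")
    case False
    then have "s = 0" "t > 0" using z by auto
    then show ?thesis using e by (simp del: pol.simps)
  qed (use path in blast)
qed

text \<open>The curve \<open>(1,r\<^sup>3,r)\<close> is adapted to a triple zero: \<open>F\<close> is of order \<open>r\<^sup>3\<close> on it, hence \<open>Q\<close>
is of order at least \<open>3/2\<close>.\<close>

lemma triple_on_face2:
  assumes H: "square_bounded Q F" and z: "ev F (1,0,0) = 0" "bderiv_t (face_y F) 1 0 = 0" "bderiv_s (face_y F) 0 1 = 0"
  shows "pol Q (1,0,0) (0,0,1) = 0"
proof -
  obtain a b c d e f g h i j where F0: "F = (a,b,c,d,e,f,g,h,i,j)" by (rule cubic_exhaust)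
  obtain q1 q2 q3 q4 q5 q6 where Q: "Q = (q1,q2,q3,q4,q5,q6)" by (metis prod.exhaust)
  have ci: "a = 0" "e = 0" "h = 0" using z by (auto simp: F0)
  obtain k where k: "\<And>x y z. 0 \<le> x \<Longrightarrow> 0 \<le> y \<Longrightarrow> 0 \<le> z \<Longrightarrow> x * y * (qv Q (x,y,z))^2 \<le> k * (ev F (x,y,z))^2"
    using H unfolding square_bounded_def by blast
  let ?w = "\<lambda>r. k * (b*r^6 + c + d + f * r^3 + g * r^4 + i * r^2 + j * r)^2"
  have "q1 = 0 \<and> q5 = 0"
  proof (rule vanishes_doubly_at_zero[where w = ?w and h = "\<lambda>r. q2 * r^4 + q3 + q4 * r + q6 * r^2"])
    fix r :: real assume r: "0 < r" "r < 1"
    have "r^3 * (qv Q (1,r^3,r))^2 \<le> k * (ev F (1,r^3,r))^2"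
      using k[of 1 "r^3" r] r by simp
    also have "ev F (1,r^3,r) = r^3 * (b*r^6 + c + d + f * r^3 + g * r^4 + i * r^2 + j * r)"
      by (simp add: F0 ci eval_nat_numeral algebra_simps)
    also have "k * (r^3 * (b*r^6 + c + d + f * r^3 + g * r^4 + i * r^2 + j * r))^2 = r^3 * (r^3 * ?w r)"
      by algebra
    finally have "(qv Q (1,r^3,r))^2 \<le> r^3 * ?w r" by (rule cancel_pos) (use r in simp)
    also have "qv Q (1,r^3,r) = q1 + q5 * r + r^2 * (q2 * r^4 + q3 + q4 * r + q6 * r^2)"
      by (simp add: Q eval_nat_numeral algebra_simps)
    finally show "(q1 + q5 * r + r^2 * (q2 * r^4 + q3 + q4 * r + q6 * r^2))^2 \<le> r^3 * ?w r" .
  qed (auto intro!: continuous_intros)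
  then show ?thesis by (simp add: Q)
qed

lemma triple_on_face1:
  assumes H: "square_bounded Q F" and z: "ev F (0,1,0) = 0" "bderiv_t (face_x F) 1 0 = 0" "bderiv_s (face_x F) 0 1 = 0"
  shows "pol Q (0,1,0) (0,0,1) = 0"
  using triple_on_face2[OF square_bounded_swap[OF H]] z unfolding face_simps swap_xy_simps swap_quadric_simps by simp

text \<open>In the direction \<open>v\<close> the cubic has a triple zero at \<open>P\<close>, so \<open>F\<^sup>2\<close> is of order six, against order one
for \<open>x y\<close> and order four for the square of \<open>Q(P + t v)\<close>.\<close>

lemma degenerate_on_face1:
  assumes H: "square_bounded Q F" and P: "nonneg P" "singular F P" "fst (snd P) > 0" and v: "nonneg v" "fst v > 0" "gr F v P = 0"
  shows "qv Q v = 0"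
proof -
  obtain k where k: "\<And>x y z. 0 \<le> x \<Longrightarrow> 0 \<le> y \<Longrightarrow> 0 \<le> z \<Longrightarrow> x * y * (qv Q (x,y,z))^2 \<le> k * (ev F (x,y,z))^2"
    using H unfolding square_bounded_def by blast
  obtain p q r where P': "P = (p,q,r)" by (cases P)
  obtain x y z where v': "v = (x,y,z)" by (cases v)
  have rad: "in_radical Q P" by (rule radical_at_singularity[OF H P(1,2)]) (use P in simp)
  have c: "x * q > 0" using P v by (simp add: P' v')
  have "(\<lambda>_. qv Q v) 0 = 0"
  proof (rule vanishes_at_zero[where g = "\<lambda>_. qv Q v" and w = "\<lambda>_. k / (x * q) * (ev F v)^2"])
    fix t :: real assume t: "0 < t" "t < 1"
    have "t * (x * q) * (qv Q (P + t *\<^sub>R v))^2 \<le> (p + t * x) * (q + t * y) * (qv Q (P + t *\<^sub>R v))^2"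
      using t v P by (intro mult_right_mono) (auto simp: P' v' algebra_simps)
    also have "\<dots> \<le> k * (ev F (P + t *\<^sub>R v))^2"
      using k[of "p + t * x" "q + t * y" "r + t * z"] t v P by (simp add: P' v')
    also have "ev F (P + t *\<^sub>R v) = t^3 * ev F v"
      unfolding ev_from_singular[OF P(2)] v(3) by (simp add: power2_eq_square power3_eq_cube)
    also have "qv Q (P + t *\<^sub>R v) = t^2 * qv Q v"
      by (simp add: qv_line in_radical_zero[OF rad] in_radicalD[OF rad])
    also have "k * (t^3 * ev F v)^2 = t^5 * (k * (t * (ev F v)^2))" by algebra
    also have "t * (x * q) * (t^2 * qv Q v)^2 = t^5 * ((x*q) * (qv Q v)^2)" by algebra
    finally have "(x*q) * (qv Q v)^2 \<le> k * (t * (ev F v)^2)" by (rule cancel_pos) (use t in simp)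
    then show "(qv Q v)^2 \<le> t * (k / (x * q) * (ev F v)^2)" using c by (simp add: field_simps)
  qed (use c in auto)
  then show ?thesis by simp
qed

lemma nonneg_parabola:
  fixes B E :: real
  assumes "\<And>t. 0 \<le> t * B + t^2 * E" shows "B = 0"
proof (rule ccontr)
  assume B: "B \<noteq> 0"
  have E: "0 \<le> E" using assms[of 1] assms[of "-1"] by simp
  \<comment> \<open>of the shape of the minimiser \<open>- B / (2 E)\<close>, but meaningful for \<open>E = 0\<close> as well\<close>
  define t where "t = - B / (E + 1)"
  have t: "t * (E + 1) = - B" using E by (simp add: t_def)
  have "(E+1)^2 * (t * B + t^2 * E) = - (B^2)" using t by algebra
  moreover have "0 \<le> (E+1)^2 * (t * B + t^2 * E)" using assms by (intro mult_nonneg_nonneg) auto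
  ultimately show False using B by simp
qed

text \<open>Here \<open>x y\<close> is positive at \<open>P\<close>, and the lowest order terms at \<open>P\<close> give \<open>Q(b)\<^sup>2 \<le> K q(b)\<^sup>2\<close> with
\<open>q(b) = gr F b P\<close>.  Since \<open>q\<close> vanishes to order two at \<open>v\<close>, so does \<open>Q\<close>.\<close>

lemma degenerate_radical:
  assumes H: "square_bounded Q F" and P: "nonneg P" "singular F P" "fst P > 0" "fst (snd P) > 0" and v: "nonneg v" "gr F v P = 0"
    and psd: "\<And>w. 0 \<le> gr F w P"
  shows "in_radical Q v"
proof -
  obtain k where k: "\<And>x y z. 0 \<le> x \<Longrightarrow> 0 \<le> y \<Longrightarrow> 0 \<le> z \<Longrightarrow> x * y * (qv Q (x,y,z))^2 \<le> k * (ev F (x,y,z))^2"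
    using H unfolding square_bounded_def by blast
  obtain p q r where P': "P = (p,q,r)" by (cases P)
  have rad: "in_radical Q P" by (rule radical_at_singularity[OF H P(1,2)]) (use P in simp)
  have c: "p * q > 0" using P by (simp add: P')
  have bound: "(p*q) * (qv Q b)^2 \<le> k * (gr F b P)^2" if b: "nonneg b" for b
  proof -
    obtain x y z where b': "b = (x,y,z)" by (cases b)
    have *: "(p*q) * (qv Q b)^2 \<le> k * (gr F b P + t * ev F b)^2" if t: "0 < t" for t
    proof -
      have "(p * q) * (qv Q (P + t *\<^sub>R b))^2 \<le> (p + t * x) * (q + t * y) * (qv Q (P + t *\<^sub>R b))^2"
        using t b P by (intro mult_right_mono mult_mono) (auto simp: P' b')
      also have "\<dots> \<le> k * (ev F (P + t *\<^sub>R b))^2"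
        using k[of "p + t * x" "q + t * y" "r + t * z"] t b P by (simp add: P' b')
      also have "ev F (P + t *\<^sub>R b) = t^2 * (gr F b P + t * ev F b)" by (rule ev_from_singular[OF P(2)])
      also have "qv Q (P + t *\<^sub>R b) = t^2 * qv Q b"
        by (simp add: qv_line in_radical_zero[OF rad] in_radicalD[OF rad])
      also have "k * (t^2 * (gr F b P + t * ev F b))^2 = t^4 * (k * (gr F b P + t * ev F b)^2)" by algebra
      also have "(p * q) * (t^2 * qv Q b)^2 = t^4 * ((p*q) * (qv Q b)^2)" by algebra
      finally show ?thesis by (rule cancel_pos) (use t in simp)
    qed
    have lim: "((\<lambda>t. k * (gr F b P + t * ev F b)^2) \<longlongrightarrow> k * (gr F b P + 0 * ev F b)^2) (at_right 0)" by (intro tendsto_intros)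
    have "eventually (\<lambda>t. (p*q) * (qv Q b)^2 \<le> k * (gr F b P + t * ev F b)^2) (at_right (0::real))"
      using * eventually_at_right_less[of "0::real"] by (auto elim: eventually_mono)
    from tendsto_lowerbound[OF lim this] show ?thesis by simp
  qed
  have ex: "gr F (v + t *\<^sub>R e) P = t * (gr F (v+e) P - gr F v P - gr F e P) + t^2 * gr F e P" for t e
    using gr_expand[of F 1 v t e P] v(2) by simp
  have cross: "gr F (v+e) P - gr F v P - gr F e P = 0" (is "?B e = 0") for e
    by (rule nonneg_parabola[where E = "gr F e P"]) (simp only: ex[symmetric] psd)
  have "pol Q v e = 0" if e: "e \<in> axes" for e
  proof -
    have ne: "nonneg e" using e by auto
    have "qv Q v = 0 \<and> pol Q v e = 0"
    proof (rule vanishes_doubly_at_zero[where h = "\<lambda>_. qv Q e" and w = "\<lambda>t. t * (k / (p*q) * (gr F e P)^2)"])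
      fix t :: real assume t: "0 < t" "t < 1"
      have "(p*q) * (qv Q (v + t *\<^sub>R e))^2 \<le> k * (gr F (v + t *\<^sub>R e) P)^2"
        by (rule bound) (use v ne t nonneg_add in auto)
      also have "gr F (v + t *\<^sub>R e) P = t^2 * gr F e P" unfolding ex cross by simp
      finally have "(qv Q (v + t *\<^sub>R e))^2 \<le> t^3 * (t * (k / (p*q) * (gr F e P)^2))"
        using c by (simp add: field_simps power2_eq_square power3_eq_cube)
      then show "(qv Q v + pol Q v e * t + t^2 * qv Q e)^2 \<le> t^3 * (t * (k / (p*q) * (gr F e P)^2))"
        by (simp add: qv_line mult.commute)
    qed (use c in \<open>auto intro!: continuous_intros\<close>)
    then show ?thesis by simp
  qed
  then show ?thesis unfolding in_radical_iff by auto
qed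

section \<open>Counting conditions at a singular point\<close>

text \<open>Modulo its radical \<open>Q\<close> is a binary quadratic form, and it vanishes in three different directions.\<close>

lemma quadric_three_zeros:
  assumes "in_radical Q P" "qv Q u = 0" "qv Q v = 0" "qv Q w = 0"
    "det3 P u v \<noteq> 0" "det3 P u w \<noteq> 0" "det3 P v w \<noteq> 0"
  shows "Q = 0"
proof -
  have ex: "qv Q x = (det3 P x v / det3 P u v) * (det3 P u x / det3 P u v) * pol Q u v" for x
  proof -
    let ?a = "det3 x u v / det3 P u v" and ?b = "det3 P x v / det3 P u v" and ?c = "det3 P u x / det3 P u v"
    have x: "x = (?b *\<^sub>R u + ?c *\<^sub>R v) + ?a *\<^sub>R P" using cramer'[OF assms(5), of x] by (simp add: algebra_simps)
    have "qv Q x = qv Q ((?b *\<^sub>R u + ?c *\<^sub>R v) + ?a *\<^sub>R P)" by (subst x) (rule refl)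
    also have "\<dots> = qv Q (?b *\<^sub>R u + ?c *\<^sub>R v)"
      by (simp only: qv_line[of Q "?b *\<^sub>R u + ?c *\<^sub>R v"] in_radicalD[OF assms(1)] in_radical_zero[OF assms(1)] mult_zero_right add.right_neutral)
    also have "\<dots> = ?b * ?c * pol Q u v" by (simp add: qv_lin2 assms)
    finally show ?thesis .
  qed
  have "det3 P w v = - det3 P v w" 
  proof -
    have "\<And>P v w. det3 P w v = - det3 P v w" by (simp only: poly_eval) algebra
    then show ?thesis .
  qed
  then have "pol Q u v = 0" using ex[of w] assms by simp
  then show ?thesis using ex by (intro quadric_eq_0) simp
qed

text \<open>Modulo \<open>P\<close> the form is a multiple of the square of the linear form that vanishes at \<open>u\<close>.\<close>

lemma quadric_double_line:
  assumes "in_radical Q P" "in_radical Q u" "qv Q w = 0" "det3 P u w \<noteq> 0"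
  shows "Q = 0"
proof (rule quadric_eq_0)
  fix x
  let ?a = "det3 x u w / det3 P u w" and ?b = "det3 P x w / det3 P u w" and ?c = "det3 P u x / det3 P u w"
  have x: "x = ?c *\<^sub>R w + ?b *\<^sub>R u + ?a *\<^sub>R P" using cramer'[OF assms(4), of x] by (simp add: algebra_simps)
  have "qv Q x = qv Q (?c *\<^sub>R w + ?b *\<^sub>R u + ?a *\<^sub>R P)" by (subst x) (rule refl)
  also have "\<dots> = qv Q (?c *\<^sub>R w)"
    by (simp only: qv_line[of Q _ ?a P] qv_line[of Q _ ?b u] in_radicalD[OF assms(1)] in_radical_zero[OF assms(1)] in_radicalD[OF assms(2)] in_radical_zero[OF assms(2)] mult_zero_right add.right_neutral)
  also have "\<dots> = 0" using qv_lin2[of Q ?c w 0 0] assms by simp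
  finally show "qv Q x = 0" .
qed

lemma det3_dependent:
  assumes "det3 P u v = 0" "u \<noteq> 0" "\<And>c. P \<noteq> c *\<^sub>R u"
  shows "\<exists>a b. v = a *\<^sub>R P + b *\<^sub>R u"
proof -
  obtain e where e: "e \<in> axes" "det3 u P e \<noteq> 0" using det3_zero[OF assms(2), of P] assms(3) by blast
  have s: "\<And>P u e. det3 P u e = - det3 u P e" by (simp only: poly_eval) algebra
  have "det3 P u e \<noteq> 0" using e s[of P u e] by simp
  from cramer'[OF this, of v] have "v = (det3 v u e / det3 P u e) *\<^sub>R P + (det3 P v e / det3 P u e) *\<^sub>R u"
    using assms(1) by simp
  then show ?thesis by blast
qed

text \<open>The situation that is to be refuted: \<open>F\<close> without variable factors, \<open>Q \<noteq> 0\<close>, and a singular point.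
Every case below shows that domination by \<open>F\<close> follows from at most eight linear conditions.\<close>

locale extremal_case =
  fixes F :: cubic and Q :: quadric and p q r :: real
  assumes F: "extremal_cubic F" "no_variable_factor F" and H: "square_bounded Q F" and Q0: "Q \<noteq> 0"
    and P0: "0 \<le> p" "0 \<le> q" "0 \<le> r" and singular: "singular F (p,q,r)" and ns: "(p,q,r) \<noteq> 0"
begin

abbreviation P where "P \<equiv> (p,q,r)"
abbreviation e1 where "e1 \<equiv> (1::real,0::real,0::real)"
abbreviation e2 where "e2 \<equiv> (0::real,1::real,0::real)"
abbreviation e3 where "e3 \<equiv> (0::real,0::real,1::real)"

lemma copositive_F: "copositive F" using F by (simp add: extremal_cubic_def)

lemma faces_nonzero: "face_x F \<noteq> 0" "face_y F \<noteq> 0" "face_z F \<noteq> 0" using F by (auto simp: no_variable_factor_def)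

lemma vertex_nonsingular: "\<not> singular F e1" "\<not> singular F e2" "\<not> singular F e3"
  using vertex_not_singular[OF F] by auto

lemma two_pos: "\<not> (p = 0 \<and> q = 0)" "\<not> (p = 0 \<and> r = 0)" "\<not> (q = 0 \<and> r = 0)"
proof -
  have s: "singular F ((1/c) *\<^sub>R P)" for c using singular by (rule singular_scale)
  show "\<not> (p = 0 \<and> q = 0)" using s[of r] vertex_nonsingular ns by (auto simp: zero_prod_def)
  show "\<not> (p = 0 \<and> r = 0)" using s[of q] vertex_nonsingular ns by (auto simp: zero_prod_def)
  show "\<not> (q = 0 \<and> r = 0)" using s[of p] vertex_nonsingular ns by (auto simp: zero_prod_def)
qed

lemma nonneg_P: "nonneg P" using P0 by simp

lemma rad: "in_radical Q P"
  by (rule radical_at_singularity[OF H nonneg_P singular]) (use two_pos P0 in auto)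

text \<open>Modulo \<open>P\<close>, which has at least two positive coordinates, \<open>v\<close> or \<open>-v\<close> lies in the orthant.\<close>

lemma psd: "0 \<le> gr F v P"
proof -
  obtain x y z where v: "v = (x,y,z)" by (cases v)
  define l where "l = \<bar>x\<bar>/p + \<bar>y\<bar>/q + \<bar>z\<bar>/r"
  have bound: "\<bar>a\<bar> \<le> l * b" if "l = \<bar>a\<bar>/b + u" "0 < b" "0 \<le> u" for a b u
    using that by (simp add: distrib_right)
  have S1: "\<bar>x\<bar> \<le> l * p" if "p \<noteq> 0"
    using bound[of x p "\<bar>y\<bar>/q + \<bar>z\<bar>/r"] P0 that by (simp add: l_def)
  have S2: "\<bar>y\<bar> \<le> l * q" if "q \<noteq> 0"
    using bound[of y q "\<bar>x\<bar>/p + \<bar>z\<bar>/r"] P0 that by (simp add: l_def)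
  have S3: "\<bar>z\<bar> \<le> l * r" if "r \<noteq> 0"
    using bound[of z r "\<bar>x\<bar>/p + \<bar>y\<bar>/q"] P0 that by (simp add: l_def)
  have N: "0 \<le> a + b" "0 \<le> b - a" if "\<bar>a\<bar> \<le> b" for a b :: real using that by auto
  \<comment> \<open>a coordinate where \<open>P\<close> vanishes contributes 0 to \<open>l\<close>; at most one does, and it fixes the sign\<close>
  have "nonneg (v + l *\<^sub>R P) \<or> nonneg ((-1) *\<^sub>R v + l *\<^sub>R P)"
  proof -
    consider "p = 0" "q \<noteq> 0" "r \<noteq> 0" | "q = 0" "p \<noteq> 0" "r \<noteq> 0" | "r = 0" "p \<noteq> 0" "q \<noteq> 0" | "p \<noteq> 0" "q \<noteq> 0" "r \<noteq> 0"
      using two_pos by blast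
    then show ?thesis
    proof cases
      case 1 then show ?thesis using N[OF S2[OF 1(2)]] N[OF S3[OF 1(3)]] by (simp add: v) linarith
    next
      case 2 then show ?thesis using N[OF S1[OF 2(2)]] N[OF S3[OF 2(3)]] by (simp add: v) linarith
    next
      case 3 then show ?thesis using N[OF S1[OF 3(2)]] N[OF S2[OF 3(3)]] by (simp add: v) linarith
    next
      case 4 then show ?thesis using N[OF S1[OF 4(1)]] N[OF S2[OF 4(2)]] N[OF S3[OF 4(3)]] by (simp add: v)
    qed
  qed
  then have "nonneg (1 *\<^sub>R v + l *\<^sub>R P) \<or> nonneg ((-1) *\<^sub>R v + l *\<^sub>R P)" by (simp only: scaleR_one)
  then obtain s where s: "s = 1 \<or> s = -1" "nonneg (s *\<^sub>R v + l *\<^sub>R P)" by blast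
  have "0 \<le> gr F (s *\<^sub>R v + l *\<^sub>R P) P" by (rule gr_nonneg[OF copositive_F singular nonneg_P s(2)])
  also have "\<dots> = s^2 * gr F v P" by (simp only: singular_shift[OF singular] gr_hom)
  finally show ?thesis using s by auto
qed

definition vertex_conditions :: "(cubic \<Rightarrow> real) list" where
  "vertex_conditions = map (\<lambda>v C. ev C v) (filter (\<lambda>v. ev F v = 0) [e1,e2,e3])"

lemma linear_vertex_conditions: "f \<in> set vertex_conditions \<Longrightarrow> linear f"
  by (auto simp: vertex_conditions_def linear_ev)

lemma vertex_conditions_end_zeros:
  assumes "\<And>f. f \<in> set vertex_conditions \<Longrightarrow> f C = 0"
  shows "inherits_end_zeros (face_x F) (face_x C) \<and> inherits_end_zeros (face_y F) (face_y C) \<and> inherits_end_zeros (face_z F) (face_z C)"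
proof -
  have "ev C v = 0" if "v \<in> axes" "ev F v = 0" for v
    by (rule assms[of "\<lambda>C. ev C v"]) (use that in \<open>auto simp: vertex_conditions_def\<close>)
  then show ?thesis unfolding inherits_end_zeros_def face_simps by blast
qed

text \<open>Conditions that settle one face for cubics singular at \<open>P\<close>.  For a face through \<open>P\<close> the
singularity contributes conditions of its own.\<close>

definition face_conditions :: "(cubic \<Rightarrow> binary_cubic) \<Rightarrow> (cubic \<Rightarrow> real) list \<Rightarrow> bool" where
  "face_conditions \<rho> L \<longleftrightarrow> (\<forall>f\<in>set L. linear f) \<and>
     (\<forall>C. singular C P \<and> inherits_end_zeros (\<rho> F) (\<rho> C) \<and> (\<forall>f\<in>set L. f C = 0) \<longrightarrow> bdominated (\<rho> C) (\<rho> F))"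

lemma face_none: "(\<forall>q. inherits_end_zeros (\<rho> F) q \<longrightarrow> bdominated q (\<rho> F)) \<Longrightarrow> face_conditions \<rho> []"
  by (auto simp: face_conditions_def)

lemma face_double: "linear \<rho> \<Longrightarrow> double_zero (\<rho> F) s t L \<Longrightarrow> face_conditions \<rho> (map (\<lambda>f. f \<circ> \<rho>) L)"
  unfolding face_conditions_def double_zero_def by (auto intro!: linear_compose)

text \<open>Three of the eight conditions make \<open>C\<close> singular at \<open>P\<close>; the list \<open>D\<close> takes care of the quadratic form
at \<open>P\<close>.\<close>

lemma too_few_conditions_at_P:
  fixes D :: "(cubic \<Rightarrow> real) list"
  assumes "face_conditions face_x L1" "face_conditions face_y L2" "face_conditions face_z L3" "\<And>f. f \<in> set D \<Longrightarrow> linear f"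
    and D: "\<And>C. singular C P \<Longrightarrow> (\<And>f. f \<in> set D \<Longrightarrow> f C = 0) \<Longrightarrow> \<exists>k. \<forall>b. nonneg b \<longrightarrow> \<bar>gr C b P\<bar> \<le> k * gr F b P"
    and len: "length vertex_conditions + length L1 + length L2 + length L3 + length D \<le> 5"
  shows False
proof (rule too_few_conditions[OF F(1), where fs = "[\<lambda>C. gr C P e1, \<lambda>C. gr C P e2, \<lambda>C. gr C P e3] @ vertex_conditions @ L1 @ L2 @ L3 @ D"])
  fix C assume C: "\<And>f. f \<in> set ([\<lambda>C. gr C P e1, \<lambda>C. gr C P e2, \<lambda>C. gr C P e3] @ vertex_conditions @ L1 @ L2 @ L3 @ D) \<Longrightarrow> f C = 0"
  have s: "singular C P" unfolding singular_iff
    using C[of "\<lambda>C. gr C P e1"] C[of "\<lambda>C. gr C P e2"] C[of "\<lambda>C. gr C P e3"] by simp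
  have v: "inherits_end_zeros (face_x F) (face_x C) \<and> inherits_end_zeros (face_y F) (face_y C) \<and> inherits_end_zeros (face_z F) (face_z C)" by (rule vertex_conditions_end_zeros) (use C in simp)
  show "dominated C F"
  proof (rule dominated_from_faces[OF copositive_F singular nonneg_P ns s])
    show "bdominated (face_x C) (face_x F)" using assms(1) s v C unfolding face_conditions_def by simp
    show "bdominated (face_y C) (face_y F)" using assms(2) s v C unfolding face_conditions_def by simp
    show "bdominated (face_z C) (face_z F)" using assms(3) s v C unfolding face_conditions_def by simp
    show "\<exists>k. \<forall>b. nonneg b \<longrightarrow> \<bar>gr C b P\<bar> \<le> k * gr F b P" by (rule D[OF s]) (use C in simp)
  qed
qed (use assms(1-4) len linear_vertex_conditions in \<open>auto simp: face_conditions_def linear_gr\<close>)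

lemma too_few_conditions_definite:
  assumes "face_conditions face_x L1" "face_conditions face_y L2" "face_conditions face_z L3"
    and "\<And>v. gr F v P = 0 \<Longrightarrow> \<exists>c. v = c *\<^sub>R P"
    and "length vertex_conditions + length L1 + length L2 + length L3 \<le> 5"
  shows False
proof (rule too_few_conditions_at_P[where D = "[]", OF assms(1-3)])
  fix C assume "singular C P"
  from definite_bound[OF singular this ns psd assms(4)]
  show "\<exists>k. \<forall>b. nonneg b \<longrightarrow> \<bar>gr C b P\<bar> \<le> k * gr F b P" by blast
qed (use assms(5) in simp_all)

text \<open>A second zero on the line through \<open>P\<close> and \<open>b\<close> forces \<open>F\<close> to vanish on the whole line, because \<open>P\<close> is
already a double zero.\<close>

lemma collinear_zeros:
  assumes b: "nonneg b" "ev F b = 0" "positive (P + b)" "\<And>c. b \<noteq> c *\<^sub>R P" and b': "ev F b' = 0" "b' = x *\<^sub>R P + y *\<^sub>R b" "x \<noteq> 0" "y \<noteq> 0"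
  shows False
proof -
  have "ev F b' = y^2 * (x * gr F b P + y * ev F b)"
  proof -
    have "ev F b' = ev F (y *\<^sub>R b + x *\<^sub>R P)" by (simp only: b' add.commute)
    also have "\<dots> = y^3 * ev F b + x * (y^2 * gr F b P)" by (simp only: singular_line[OF singular] ev_hom gr_hom)
    finally show ?thesis by (simp add: algebra_simps power2_eq_square power3_eq_cube)
  qed
  then have g: "gr F b P = 0" using b b' by simp
  show False using line_in_zero_set[OF F nonneg_P singular ns b(1,2) g b(3)] b(4) by blast
qed

text \<open>The direction from \<open>P\<close> to \<open>u\<close> is the degenerate one, so \<open>F\<close> restricted to the line is a cube, which
vanishes at \<open>u\<close>.\<close>

lemma degenerate_line:
  assumes v: "nonneg v" "gr F v P = 0" "positive (P + v)" "\<And>c. v \<noteq> c *\<^sub>R P" and u: "ev F u = 0" "v = a *\<^sub>R P + b *\<^sub>R u" "b \<noteq> 0"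
  shows False
proof -
  have v': "v = b *\<^sub>R u + a *\<^sub>R P" by (simp only: u add.commute)
  have g: "gr F u P = 0"
    using v(2) u(3) unfolding v' by (simp only: singular_shift[OF singular] gr_hom) simp
  have "ev F v = 0" unfolding v' by (simp only: singular_line[OF singular] ev_hom gr_hom g u(1) mult_zero_right add.right_neutral)
  then show False using line_in_zero_set[OF F nonneg_P singular ns v(1) _ v(2,3)] v(4) by blast
qed

text \<open>In a nonnegative quadratic form, an isotropic vector lies in the radical.\<close>

lemma cross_zero:
  assumes "gr F v P = 0" shows "gr F (v+w) P - gr F v P - gr F w P = 0"
proof (rule nonneg_parabola[where E = "gr F w P"])
  fix t
  have "gr F (v + t *\<^sub>R w) P = t * (gr F (v+w) P - gr F v P - gr F w P) + t^2 * gr F w P"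
    using gr_expand[of F 1 v t w P] assms by simp
  then show "0 \<le> t * (gr F (v+w) P - gr F v P - gr F w P) + t^2 * gr F w P"
    using psd[of "v + t *\<^sub>R w"] by simp
qed

text \<open>When the form at \<open>P\<close> is the square of a linear form vanishing at \<open>v\<close>, two conditions make the
form of \<open>C\<close> at \<open>P\<close> a multiple of it.\<close>

lemma too_few_conditions_degenerate:
  assumes L: "face_conditions face_x L1" "face_conditions face_y L2" "face_conditions face_z L3"
    and v: "gr F v P = 0" "det3 P v w \<noteq> 0" "gr F w P > 0"
    and len: "length vertex_conditions + length L1 + length L2 + length L3 \<le> 3"
  shows False
proof (rule too_few_conditions_at_P[where D = "[\<lambda>C. gr C v P, \<lambda>C. gr C (v+w) P - gr C w P]", OF L])
  fix f assume "f \<in> set [\<lambda>C. gr C v P, \<lambda>C. gr C (v+w) P - gr C w P]"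
  then show "linear f" by (auto intro!: linear_gr linear_compose_sub)
next
  fix C assume C: "singular C P" "\<And>f. f \<in> set [\<lambda>C. gr C v P, \<lambda>C. gr C (v+w) P - gr C w P] \<Longrightarrow> f C = 0"
  have C': "gr C v P = 0" "gr C (v+w) P - gr C v P - gr C w P = 0"
    using C(2)[of "\<lambda>C. gr C v P"] C(2)[of "\<lambda>C. gr C (v+w) P - gr C w P"] by auto
  have ex: "gr D b P = (det3 P v b / det3 P v w)^2 * gr D w P"
    if D: "singular D P" "gr D v P = 0" "gr D (v+w) P - gr D v P - gr D w P = 0" for D b
  proof -
    let ?a = "det3 b v w / det3 P v w" and ?b = "det3 P b w / det3 P v w" and ?c = "det3 P v b / det3 P v w"
    have x: "b = (?b *\<^sub>R v + ?c *\<^sub>R w) + ?a *\<^sub>R P" using cramer'[OF v(2), of b] by (simp add: algebra_simps)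
    have "gr D b P = gr D ((?b *\<^sub>R v + ?c *\<^sub>R w) + ?a *\<^sub>R P) P" by (subst x) (rule refl)
    also have "\<dots> = ?c^2 * gr D w P" using D(2,3) by (simp only: singular_shift[OF D(1)] gr_expand[of D ?b v ?c w P])
    finally show ?thesis .
  qed
  show "\<exists>k. \<forall>b. nonneg b \<longrightarrow> \<bar>gr C b P\<bar> \<le> k * gr F b P"
  proof (intro exI allI impI)
    fix b
    show "\<bar>gr C b P\<bar> \<le> (\<bar>gr C w P\<bar> / gr F w P) * gr F b P"
      using v(3) unfolding ex[OF C(1) C', of b] ex[OF singular v(1) cross_zero[OF v(1)], of b]
      by (simp add: abs_mult)
  qed
qed (use len in simp)

lemma face_alternatives:
  "face_conditions face_x [] \<or> (\<exists>s t L. double_zero (face_x F) s t L)"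
  "face_conditions face_y [] \<or> (\<exists>s t L. double_zero (face_y F) s t L)"
  "face_conditions face_z [] \<or> (\<exists>s t L. double_zero (face_z F) s t L)"
  using binary_cases[OF copositive_face(1)[OF copositive_F]] binary_cases[OF copositive_face(2)[OF copositive_F]] binary_cases[OF copositive_face(3)[OF copositive_F]] faces_nonzero face_none by blast+

lemma double_zeroD:
  assumes "double_zero pp s t L"
  shows "0 \<le> s" "0 \<le> t" "0 < s + t" "bderiv_s pp s t = 0" "bderiv_t pp s t = 0" "length L \<le> 2"
  using assms unfolding double_zero_def by auto

lemma double1:
  assumes "double_zero (face_x F) s t L"
  shows "ev F (0,s,t) = 0" "qv Q (0,s,t) = 0" "gr F (0,s,t) e2 = 0" "gr F (0,s,t) e3 = 0"
  using double_on_face1[OF H] double_zeroD[OF assms] unfolding face_simps by auto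

lemma double2:
  assumes "double_zero (face_y F) s t L"
  shows "ev F (s,0,t) = 0" "qv Q (s,0,t) = 0" "gr F (s,0,t) e1 = 0" "gr F (s,0,t) e3 = 0"
  using double_on_face2[OF H] double_zeroD[OF assms] unfolding face_simps by auto

lemma double3:
  assumes "double_zero (face_z F) s t L"
  shows "ev F (s,t,0) = 0" "gr F (s,t,0) e1 = 0" "gr F (s,t,0) e2 = 0"
    "pol Q (s,t,0) e1 = 0" "pol Q (s,t,0) e2 = 0"
  using double_on_face3[OF H] double_zeroD[OF assms] unfolding face_simps by auto

text \<open>Three vertices and one double zero cost at most five conditions in addition to the singularity.\<close>

lemma definite_two_doubles:
  assumes "\<And>v. gr F v P = 0 \<Longrightarrow> \<exists>c. v = c *\<^sub>R P"
  shows "\<not> (face_conditions face_x [] \<and> face_conditions face_y [])" "\<not> (face_conditions face_x [] \<and> face_conditions face_z [])" "\<not> (face_conditions face_y [] \<and> face_conditions face_z [])"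
proof -
  have L: "\<exists>L. length L \<le> 2 \<and> face_conditions \<rho> L"
    if "face_conditions \<rho> [] \<or> (\<exists>s t L. double_zero (\<rho> F) s t L)" "linear \<rho>" for \<rho>
    using that
  proof (elim disjE exE)
    fix s t L assume d: "double_zero (\<rho> F) s t L"
    then show ?thesis using face_double[OF that(2) d] double_zeroD(6)[OF d] by (intro exI[of _ "map (\<lambda>f. f \<circ> \<rho>) L"]) simp
  qed (intro exI[of _ "[]"], simp)
  have v: "length vertex_conditions \<le> 3" by (simp add: vertex_conditions_def)
  note cnt = too_few_conditions_definite[OF _ _ _ assms]
  show "\<not> (face_conditions face_x [] \<and> face_conditions face_y [])"
    using L[OF face_alternatives(3) linear_face(3)] cnt[of "[]" "[]"] v by fastforce
  show "\<not> (face_conditions face_x [] \<and> face_conditions face_z [])"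
    using L[OF face_alternatives(2) linear_face(2)] cnt[of "[]" _ "[]"] v by fastforce
  show "\<not> (face_conditions face_y [] \<and> face_conditions face_z [])"
    using L[OF face_alternatives(1) linear_face(1)] cnt[of _ "[]" "[]"] v by fastforce
qed

lemma gr_axis: "c \<noteq> 0 \<Longrightarrow> gr F (c *\<^sub>R v) w = 0 \<Longrightarrow> gr F v w = 0"
  by (simp add: gr_hom)

text \<open>Double zeros of two faces cannot meet at a common vertex, since that vertex would be singular.\<close>

lemma no_shared12: "double_zero (face_x F) s t L \<Longrightarrow> double_zero (face_y F) s' t' L' \<Longrightarrow> \<not> (s = 0 \<and> s' = 0)"
proof
  assume d: "double_zero (face_x F) s t L" "double_zero (face_y F) s' t' L'" and 0: "s = 0 \<and> s' = 0"
  have "singular F e3" unfolding singular_iff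
    using gr_axis[of t e3] gr_axis[of t' e3] double1[OF d(1)] double2[OF d(2)] double_zeroD[OF d(1)] double_zeroD[OF d(2)] 0 by auto
  then show False using vertex_nonsingular by blast
qed

lemma no_shared13: "double_zero (face_x F) s t L \<Longrightarrow> double_zero (face_z F) s' t' L' \<Longrightarrow> \<not> (t = 0 \<and> s' = 0)"
proof
  assume d: "double_zero (face_x F) s t L" "double_zero (face_z F) s' t' L'" and 0: "t = 0 \<and> s' = 0"
  have "singular F e2" unfolding singular_iff
    using gr_axis[of s e2] gr_axis[of t' e2] double1[OF d(1)] double3[OF d(2)] double_zeroD[OF d(1)] double_zeroD[OF d(2)] 0 by auto
  then show False using vertex_nonsingular by blast
qed

lemma no_shared23: "double_zero (face_y F) s t L \<Longrightarrow> double_zero (face_z F) s' t' L' \<Longrightarrow> \<not> (t = 0 \<and> t' = 0)"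
proof
  assume d: "double_zero (face_y F) s t L" "double_zero (face_z F) s' t' L'" and 0: "t = 0 \<and> t' = 0"
  have "singular F e1" unfolding singular_iff
    using gr_axis[of s e1] gr_axis[of s' e1] double2[OF d(1)] double3[OF d(2)] double_zeroD[OF d(1)] double_zeroD[OF d(2)] 0 by auto
  then show False using vertex_nonsingular by blast
qed

lemma radical_double3:
  assumes d: "double_zero (face_z F) s t L" and r: "r > 0"
  shows "in_radical Q (s,t,0)"
proof -
  have "pol Q (s,t,0) P = 0" using in_radicalD(2)[OF rad] .
  then have "r * pol Q (s,t,0) e3 = 0" using pol_ext[of Q "(s,t,0)" p q r] double3[OF d] by simp
  then show ?thesis unfolding in_radical_iff using double3[OF d] r by simp
qed

lemma length_vertex_conditions: "length vertex_conditions = (if ev F e1 = 0 then 1 else 0) + (if ev F e2 = 0 then 1 else 0) + (if ev F e3 = 0 then 1 else 0)"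
  by (simp add: vertex_conditions_def)

lemma zero_e1: "ev F e1 = 0 \<Longrightarrow> qv Q e1 = 0" using zero_on_face2[OF H, of 1 0] by simp

lemma zero_e2: "ev F e2 = 0 \<Longrightarrow> qv Q e2 = 0" using zero_on_face1[OF H, of 1 0] by simp

end

section \<open>Singular point in the interior\<close>

text \<open>Four zeros with multiplicity are too many for a nonzero binary cubic.\<close>

lemma double_zero_and_ends:
  assumes "bderiv_s p s t = 0" "bderiv_t p s t = 0" "s \<noteq> 0" "t \<noteq> 0" "beval p 1 0 = 0" "beval p 0 1 = 0"
  shows "p = 0"
proof -
  obtain a b c d where p: "p = (a,b,c,d)" by (cases p)
  have ad: "a = 0" "d = 0" using assms(5,6) by (simp_all add: p)
  have "s * t * b = 0" "s * t * c = 0" using assms(1,2) unfolding p bderiv_s.simps bderiv_t.simps ad by algebra+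
  then show ?thesis using assms(3,4) ad by (simp add: p zero_prod_def)
qed

context extremal_case begin

text \<open>A double zero on \<open>z = 0\<close> makes \<open>Q\<close> the square of a linear form, and then \<open>x = 0\<close> and \<open>y = 0\<close> carry no double
zero, for it would be collinear with \<open>P\<close> and the first one.  So both \<open>x = 0\<close> and \<open>y = 0\<close> have double
zeros \<open>w\<^sub>1\<close>, \<open>w\<^sub>2\<close>, and \<open>Q\<close> is the product of the lines that join them to \<open>P\<close>.  A zero at
\<open>(1,0,0)\<close> or \<open>(0,1,0)\<close> lies on one of these lines, so it is \<open>w\<^sub>2\<close> or \<open>w\<^sub>1\<close> itself, and it
is not a triple zero.  Each of these two faces, together with this vertex, then costs at most two conditions.\<close>

lemma interior_case:
  assumes positive: "p > 0" "q > 0" "r > 0" shows False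
proof -
  have def: "\<exists>c. v = c *\<^sub>R P" if g: "gr F v P = 0" for v
  proof (rule ccontr)
    assume n: "\<not> ?thesis"
    obtain x y z where v: "v = (x,y,z)" by (cases v)
    define l where "l = \<bar>x\<bar>/p + \<bar>y\<bar>/q + \<bar>z\<bar>/r"
    have l: "\<bar>x\<bar> \<le> l * p" "\<bar>y\<bar> \<le> l * q" "\<bar>z\<bar> \<le> l * r"
      using positive by (simp_all add: l_def distrib_right add_nonneg_nonneg)
    let ?b = "v + l *\<^sub>R P" and ?b' = "(-1) *\<^sub>R v + l *\<^sub>R P"
    have nb: "nonneg ?b" "nonneg ?b'" "positive (P + ?b)" using l positive by (auto simp: v)
    have "ev F ?b = ev F v" "ev F ?b' = - ev F v"
      unfolding singular_line[OF singular] ev_hom gr_hom g by simp_all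
    moreover have "0 \<le> ev F ?b" "0 \<le> ev F ?b'" using copositive_F nb unfolding copositive_def by blast+
    ultimately have "ev F ?b = 0" by simp
    moreover have "gr F ?b P = 0" using g by (simp only: singular_shift[OF singular])
    moreover have "?b \<noteq> c *\<^sub>R P" for c
    proof
      assume "?b = c *\<^sub>R P"
      then have "v = (c - l) *\<^sub>R P" by (auto simp: v algebra_simps)
      then show False using n by blast
    qed
    ultimately show False using line_in_zero_set[OF F nonneg_P singular ns nb(1) _ _ nb(3)] by blast
  qed
  note cnt = too_few_conditions_definite[OF _ _ _ def]
  have nP: "(0,s,t) \<noteq> c *\<^sub>R P" "(s,0,t) \<noteq> c *\<^sub>R P" "(s,t,0) \<noteq> c *\<^sub>R P" if "0 \<le> s" "0 \<le> t" "0 < s + t" for s t c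
    using that positive by auto
  have nP': "P \<noteq> c *\<^sub>R (0,s,t)" "P \<noteq> c *\<^sub>R (s,0,t)" "P \<noteq> c *\<^sub>R (s,t,0)" for s t c
    using positive by auto
  have col: False if "nonneg b" "ev F b = 0" "\<And>c. b \<noteq> c *\<^sub>R P" "ev F b' = 0" "b' = x *\<^sub>R P + y *\<^sub>R b" "x \<noteq> 0" "y \<noteq> 0" for b b' x y
  proof (rule collinear_zeros[OF that(1,2) _ that(3-)])
    show "positive (P + b)" using that(1) positive by (cases b) auto
  qed
  show False
  proof (cases "\<exists>s t L. double_zero (face_z F) s t L")
    case True
    then obtain s t L3 where d3: "double_zero (face_z F) s t L3" by blast
    note D3 = double_zeroD[OF d3]
    let ?d = "(s,t,0)"
    have rd: "in_radical Q ?d" using radical_double3[OF d3 positive(3)] .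
    have nd: "?d \<noteq> 0" using D3 by (auto simp: zero_prod_def)
    have dep: "\<exists>a b. w = a *\<^sub>R P + b *\<^sub>R ?d" if "qv Q w = 0" for w
      by (rule det3_dependent[OF _ nd nP'(3)]) (use quadric_double_line[OF rad rd that] Q0 in blast)
    have no1: "\<not> double_zero (face_x F) s' t' L'" for s' t' L'
    proof
      assume d1: "double_zero (face_x F) s' t' L'"
      obtain a b where ab: "(0,s',t') = a *\<^sub>R P + b *\<^sub>R ?d" using dep double1[OF d1] by blast
      have "a \<noteq> 0"
      proof
        assume "a = 0"
        then have "t' = 0" "s = 0" using ab double_zeroD[OF d1] D3 by auto
        then show False using no_shared13[OF d1 d3] by blast
      qed
      moreover have "b \<noteq> 0" using ab nP(1)[of s' t' a] double_zeroD[OF d1] by auto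
      ultimately show False using col[OF _ _ _ double1(1)[OF d1] ab] double3[OF d3] nP(3) D3 by auto
    qed
    have no2: "\<not> double_zero (face_y F) s' t' L'" for s' t' L'
    proof
      assume d2: "double_zero (face_y F) s' t' L'"
      obtain a b where ab: "(s',0,t') = a *\<^sub>R P + b *\<^sub>R ?d" using dep double2[OF d2] by blast
      have "a \<noteq> 0"
      proof
        assume "a = 0"
        then have "t' = 0" "t = 0" using ab double_zeroD[OF d2] D3 by auto
        then show False using no_shared23[OF d2 d3] by blast
      qed
      moreover have "b \<noteq> 0" using ab nP(2)[of s' t' a] double_zeroD[OF d2] by auto
      ultimately show False using col[OF _ _ _ double2(1)[OF d2] ab] double3[OF d3] nP(3) D3 by auto
    qed
    show False using face_alternatives no1 no2 definite_two_doubles(1)[OF def] by blast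
  next
    case False
    then have f3: "face_conditions face_z []" using face_alternatives by blast
    then obtain s t L1 s' t' L2 where d1: "double_zero (face_x F) s t L1" and d2: "double_zero (face_y F) s' t' L2"
      using face_alternatives definite_two_doubles[OF def] by blast
    let ?w1 = "(0,s,t)" and ?w2 = "(s',0,t')"
    note D1 = double_zeroD[OF d1] double1[OF d1] and D2 = double_zeroD[OF d2] double2[OF d2]
    have w1: "?w1 \<noteq> 0" using D1 by (auto simp: zero_prod_def)
    have det12: "det3 P ?w1 ?w2 \<noteq> 0"
    proof
      assume "det3 P ?w1 ?w2 = 0"
      then obtain a b where ab: "?w2 = a *\<^sub>R P + b *\<^sub>R ?w1" using det3_dependent[OF _ w1 nP'(1)] by blast
      have "a \<noteq> 0"
      proof
        assume "a = 0"
        then have "s' = 0" "s = 0" using ab D1 D2 by auto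
        then show False using no_shared12[OF d1 d2] by blast
      qed
      moreover have "b \<noteq> 0" using ab nP(2)[of s' t' a] D2 by auto
      ultimately show False using col[OF _ D1(7) nP(1)[OF D1(1-3)] D2(7) ab] D1 by auto
    qed
    have A: "t' = 0" if z: "ev F e1 = 0"
    proof (rule ccontr)
      assume t': "t' \<noteq> 0"
      have det1: "det3 P ?w1 e1 \<noteq> 0"
      proof
        assume "det3 P ?w1 e1 = 0"
        then obtain a b where ab: "e1 = a *\<^sub>R P + b *\<^sub>R ?w1" using det3_dependent[OF _ w1 nP'(1)] by blast
        then have "a \<noteq> 0" "b \<noteq> 0" using positive by auto
        then show False using col[OF _ D1(7) nP(1)[OF D1(1-3)] z ab] D1 by auto
      qed
      show False
        using quadric_three_zeros[OF rad D1(8) D2(8) zero_e1[OF z] det12 det1] t' positive Q0 by auto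
    qed
    have B: "t = 0" if z: "ev F e2 = 0"
    proof (rule ccontr)
      assume t: "t \<noteq> 0"
      have w2: "?w2 \<noteq> 0" using D2 by (auto simp: zero_prod_def)
      have det2: "det3 P ?w2 e2 \<noteq> 0"
      proof
        assume "det3 P ?w2 e2 = 0"
        then obtain a b where ab: "e2 = a *\<^sub>R P + b *\<^sub>R ?w2" using det3_dependent[OF _ w2 nP'(2)] by blast
        then have "a \<noteq> 0" "b \<noteq> 0" using positive by auto
        then show False using col[OF _ D2(7) nP(2)[OF D2(1-3)] z ab] D2 by auto
      qed
      show False
        using quadric_three_zeros[OF rad D1(8) D2(8) zero_e2[OF z] det12 _ det2] t positive Q0 by auto
    qed
    have C1: "(if ev F e2 = 0 then 1 else 0) + length L1 \<le> 2"
    proof (cases "t = 0")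
      case True
      have z: "ev F e2 = 0" using D1 True ev_hom[of F s e2] by auto
      have "\<not> bderiv_s (face_x F) 0 1 = 0"
      proof
        assume b: "bderiv_s (face_x F) 0 1 = 0"
        have "bderiv_t (face_x F) 1 0 = 0" using D1(10) gr_axis[of s e2 e3] True D1 unfolding face_simps by auto
        then have 1: "pol Q e2 e3 = 0" using triple_on_face1[OF H z _ b] by blast
        have 2: "pol Q e2 e2 = 0" using pol_self[of Q e2] zero_e2[OF z] by simp
        have "p * pol Q e2 e1 = 0" using in_radicalD(2)[OF rad, of e2] pol_ext[of Q e2 p q r] 1 2 by simp
        then have "in_radical Q e2" unfolding in_radical_iff using 1 2 positive by simp
        moreover have "det3 P e2 ?w2 \<noteq> 0" using det12 True by auto
        ultimately show False using quadric_double_line[OF rad _ D2(8)] Q0 by blast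
      qed
      then have "length L1 \<le> 1" using d1 True unfolding double_zero_def by auto
      then show ?thesis by simp
    qed (use B D1 in auto)
    have C2: "(if ev F e1 = 0 then 1 else 0) + length L2 \<le> 2"
    proof (cases "t' = 0")
      case True
      have z: "ev F e1 = 0" using D2 True ev_hom[of F s' e1] by auto
      have "\<not> bderiv_s (face_y F) 0 1 = 0"
      proof
        assume b: "bderiv_s (face_y F) 0 1 = 0"
        have "bderiv_t (face_y F) 1 0 = 0" using D2(10) gr_axis[of s' e1 e3] True D2 unfolding face_simps by auto
        then have 1: "pol Q e1 e3 = 0" using triple_on_face2[OF H z _ b] by blast
        have 2: "pol Q e1 e1 = 0" using pol_self[of Q e1] zero_e1[OF z] by simp
        have "q * pol Q e1 e2 = 0" using in_radicalD(2)[OF rad, of e1] pol_ext[of Q e1 p q r] 1 2 by simp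
        then have "in_radical Q e1" unfolding in_radical_iff using 1 2 positive by simp
        moreover have "det3 P e1 ?w1 \<noteq> 0" using det12 True by auto
        ultimately show False using quadric_double_line[OF rad _ D1(8)] Q0 by blast
      qed
      then have "length L2 \<le> 1" using d2 True unfolding double_zero_def by auto
      then show ?thesis by simp
    qed (use A D2 in auto)
    show False
      by (rule cnt[OF face_double[OF linear_face(1) d1] face_double[OF linear_face(2) d2] f3])
        (use C1 C2 in \<open>auto simp: length_vertex_conditions\<close>)
  qed
qed

end

section \<open>Singular point on an edge\<close>

text \<open>Up to positive factors, this is the value at \<open>(s,t)\<close> of the linear factor that is left after the square has been
split off.\<close>

lemma bin_face_positive:
  assumes z: "bderiv_s p s t = 0" "bderiv_t p s t = 0" and st: "0 < s" "0 < t" and nonneg: "bnonneg p" "p \<noteq> 0"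
  shows "0 < s * bderiv_s p 1 0 + t * bderiv_t p 1 0"
proof -
  obtain a b c d where p: "p = (a,b,c,d)" by (cases p)
  have a: "0 \<le> a" using nonneg(1)[unfolded bnonneg_def, rule_format, of 1 0] p by simp
  have d: "0 \<le> d" using nonneg(1)[unfolded bnonneg_def, rule_format, of 0 1] p by simp
  have "\<not> (a = 0 \<and> d = 0)"
    using double_zero_and_ends[OF z] st nonneg(2) by (auto simp: p)
  then have "a > 0 \<or> d > 0" using a d by linarith
  then have positive: "0 < a * s^3 + d * t^3"
    using a d st by (auto intro: add_pos_nonneg add_nonneg_pos)
  have "s^2 * (s * (3 * a) + t * b) = a * s^3 + d * t^3"
    using z unfolding p bderiv_s.simps bderiv_t.simps by algebra
  then have "s^2 * (s * bderiv_s p 1 0 + t * bderiv_t p 1 0) = a * s^3 + d * t^3" by (simp add: p)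
  then show ?thesis using positive st by (metis zero_less_mult_pos zero_less_power)
qed

context extremal_case begin

text \<open>On a face through \<open>P\<close>, the double zero at \<open>P\<close> is shared by all cubics that are singular at \<open>P\<close>, and no
further condition is required.\<close>

lemma face_through_P:
  assumes \<rho>: "\<rho> = face_z \<and> r = 0 \<and> s = p \<and> t = q \<or> \<rho> = face_x \<and> p = 0 \<and> s = q \<and> t = r" and st: "0 < s" "0 < t"
  shows "face_conditions \<rho> []" "bderiv_s (\<rho> F) s t = 0" "bderiv_t (\<rho> F) s t = 0"
proof -
  have z: "bderiv_s (\<rho> C) s t = 0" "bderiv_t (\<rho> C) s t = 0" if "singular C P" for C
    using \<rho> singularD[OF that, of e1] singularD[OF that, of e2] singularD[OF that, of e3] by (auto simp: face_simps)
  from z[OF singular] show zF: "bderiv_s (\<rho> F) s t = 0" "bderiv_t (\<rho> F) s t = 0" .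
  obtain a b c d where p: "\<rho> F = (a,b,c,d)" by (cases "\<rho> F")
  have bn: "bnonneg (\<rho> F)" using \<rho> copositive_face[OF copositive_F] by auto
  have a: "0 \<le> a" using bn[unfolded bnonneg_def, rule_format, of 1 0] p by simp
  have d: "0 \<le> d" using bn[unfolded bnonneg_def, rule_format, of 0 1] p by simp
  show "face_conditions \<rho> []" unfolding face_conditions_def
  proof (intro conjI allI impI ballI)
    fix C assume C: "singular C P \<and> inherits_end_zeros (\<rho> F) (\<rho> C) \<and> (\<forall>f\<in>set []. f C = 0)"
    obtain a' b' c' d' where q: "\<rho> C = (a',b',c',d')" by (cases "\<rho> C")
    have sC: "singular C P" and v: "inherits_end_zeros (\<rho> F) (\<rho> C)" using C by blast+
    have "a = 0 \<Longrightarrow> a' = 0" "d = 0 \<Longrightarrow> d' = 0" using v unfolding inherits_end_zeros_def p q by simp_all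
    then show "bdominated (\<rho> C) (\<rho> F)" by (rule bdominated_interior_double[OF p a d st zF q z[OF sC]])
  qed simp
qed

text \<open>If the form at \<open>P\<close> is degenerate, then \<open>Q\<close> is a multiple of the square of the same linear form; double zeros on
\<open>x = 0\<close> or \<open>y = 0\<close> would lie on its line, which already has a triple zero of \<open>F\<close> at \<open>P\<close>.  If the form is
definite, both of these faces have double zeros; they are not on one line through \<open>P\<close>, as such a line leaves the
orthant only once, and \<open>Q\<close> is again the product of the two lines that join them to \<open>P\<close>.\<close>

lemma edge3_case:
  assumes r: "r = 0" shows False
proof -
  have positive: "p > 0" "q > 0" using two_pos P0 r by (auto simp: less_le)
  note ft = face_through_P[of face_z p q]
  have f3: "face_conditions face_z []" and z3: "bderiv_s (face_z F) p q = 0" "bderiv_t (face_z F) p q = 0" using ft r positive by auto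
  have notboth: "\<not> (ev F e1 = 0 \<and> ev F e2 = 0)"
    using double_zero_and_ends[OF z3] positive faces_nonzero(3) by (auto simp: face_simps)
  then have v2: "length vertex_conditions \<le> 2" by (auto simp: length_vertex_conditions)
  have g1: "gr F e1 P > 0"
    using bin_face_positive[OF z3 positive copositive_face(3)[OF copositive_F] faces_nonzero(3)] gr_ext[of F e1 p q r] r
    by (simp add: face_simps)
  show False
  proof (cases "\<exists>v. gr F v P = 0 \<and> (\<forall>c. v \<noteq> c *\<^sub>R P)")
    case True
    then obtain v0 where v0: "gr F v0 P = 0" "\<And>c. v0 \<noteq> c *\<^sub>R P" by blast
    obtain x0 y0 z0 where v0': "v0 = (x0,y0,z0)" by (cases v0)
    have z0: "z0 \<noteq> 0"
    proof
      assume "z0 = 0"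
      then have e: "v0 = (x0 - y0 * p / q) *\<^sub>R e1 + (y0 / q) *\<^sub>R P" using positive r by (simp add: v0')
      have "(x0 - y0 * p / q)^2 * gr F e1 P = 0"
        using v0(1) unfolding e by (simp only: singular_shift[OF singular] gr_hom)
      then have "x0 - y0 * p / q = 0" using g1 by simp
      then have "v0 = (y0 / q) *\<^sub>R P" using e by simp
      then show False using v0(2) by blast
    qed
    define l where "l = \<bar>x0\<bar>/p + \<bar>y0\<bar>/q"
    define v where "v = sgn z0 *\<^sub>R v0 + l *\<^sub>R P"
    have l: "\<bar>x0\<bar> \<le> l * p" "\<bar>y0\<bar> \<le> l * q" using positive by (simp_all add: l_def distrib_right)
    have nnv: "nonneg v" using l z0 r by (auto simp: v_def v0' sgn_if)
    have posv: "positive (P + v)" using l z0 r positive by (auto simp: v_def v0' sgn_if)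
    have gv: "gr F v P = 0" unfolding v_def by (simp only: singular_shift[OF singular] gr_hom v0 mult_zero_right)
    have snz: "snd (snd v) \<noteq> 0" using z0 r by (simp add: v_def v0' sgn_if)
    have vertex_nonsingular: "v \<noteq> c *\<^sub>R P" for c using snz r by auto
    have v0n: "v \<noteq> 0" using snz by auto
    have rv: "in_radical Q v" using degenerate_radical[OF H nonneg_P singular _ _ nnv gv psd] positive by simp
    have dep: "\<exists>a b. w = a *\<^sub>R P + b *\<^sub>R v" if "qv Q w = 0" for w
    proof -
      have "det3 P v w = 0" using quadric_double_line[OF rad rv that] Q0 by blast
      moreover have "P \<noteq> c *\<^sub>R v" for c using snz r positive by (cases v) auto
      ultimately show ?thesis using det3_dependent[OF _ v0n] by blast
    qed
    have no: False if w: "qv Q w = 0" "ev F w = 0" "\<And>c. w \<noteq> c *\<^sub>R P" for w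
    proof -
      obtain a b where ab: "w = a *\<^sub>R P + b *\<^sub>R v" using dep w by blast
      have b: "b \<noteq> 0" using ab w(3)[of a] by auto
      have v_eq: "v = (-a/b) *\<^sub>R P + (1/b) *\<^sub>R w"
      proof -
        have "(1/b) *\<^sub>R w = (a/b) *\<^sub>R P + v" unfolding ab using b by (simp add: scaleR_add_right del: scaleR_Pair)
        then show ?thesis by (simp add: algebra_simps del: scaleR_Pair)
      qed
      show False by (rule degenerate_line[OF nnv gv posv vertex_nonsingular w(2) v_eq]) (use b in simp)
    qed
    have no1: "\<not> double_zero (face_x F) s t L" for s t L
    proof
      assume d: "double_zero (face_x F) s t L"
      show False by (rule no[of "(0,s,t)"]) (use double1[OF d] double_zeroD[OF d] positive r in auto)
    qed
    have no2: "\<not> double_zero (face_y F) s t L" for s t L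
    proof
      assume d: "double_zero (face_y F) s t L"
      show False by (rule no[of "(s,0,t)"]) (use double2[OF d] double_zeroD[OF d] positive r in auto)
    qed
    have "det3 P v e1 \<noteq> 0" using snz positive r by (cases v) auto
    from too_few_conditions_degenerate[OF _ _ f3 gv this g1, of "[]" "[]"] no1 no2 face_alternatives v2 show False by auto
  next
    case False
    then have def: "\<And>v. gr F v P = 0 \<Longrightarrow> \<exists>c. v = c *\<^sub>R P" by blast
    note cnt = too_few_conditions_definite[OF _ _ _ def]
    then obtain s t L1 s' t' L2 where d1: "double_zero (face_x F) s t L1" and d2: "double_zero (face_y F) s' t' L2"
      using face_alternatives definite_two_doubles[OF def] f3 by blast
    let ?w1 = "(0,s,t)" and ?w2 = "(s',0,t')"
    note D1 = double_zeroD[OF d1] double1[OF d1] and D2 = double_zeroD[OF d2] double2[OF d2]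
    have e1z: "t' = 0 \<Longrightarrow> ev F e1 = 0" using D2 ev_hom[of F s' e1] by auto
    have e2z: "t = 0 \<Longrightarrow> ev F e2 = 0" using D1 ev_hom[of F s e2] by auto
    have det12: "det3 P ?w1 ?w2 \<noteq> 0"
    proof
      assume "det3 P ?w1 ?w2 = 0"
      then have e: "p * s * t' + q * s' * t = 0" using r by (simp add: algebra_simps)
      have nn0: "0 \<le> p * s * t'" "0 \<le> q * s' * t" using positive D1 D2 by (intro mult_nonneg_nonneg; simp)+
      have "p * s * t' = 0" "q * s' * t = 0" using e nn0 by linarith+
      then have "s = 0 \<or> t' = 0" "s' = 0 \<or> t = 0" using positive by auto
      then show False using no_shared12[OF d1 d2] notboth e1z e2z D1 D2 by auto
    qed
    have A: "t' = 0" if z: "ev F e1 = 0"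
    proof (rule ccontr)
      assume t': "t' \<noteq> 0"
      have "t \<noteq> 0" using e2z notboth z by blast
      then show False
        using quadric_three_zeros[OF rad D1(8) D2(8) zero_e1[OF z] det12] t' positive Q0 r by auto
    qed
    have B: "t = 0" if z: "ev F e2 = 0"
    proof (rule ccontr)
      assume t: "t \<noteq> 0"
      have "t' \<noteq> 0" using e1z notboth z by blast
      then show False
        using quadric_three_zeros[OF rad D1(8) D2(8) zero_e2[OF z] det12] t positive Q0 r by auto
    qed
    have C1: "length L1 + (if ev F e3 = 0 then 1 else 0) \<le> 2" if "t = 0"
    proof -
      have "length L1 \<le> 1 \<or> bderiv_s (face_x F) 0 1 = 0" using d1 that unfolding double_zero_def by auto
      moreover have "ev F e3 \<noteq> 0" if b: "bderiv_s (face_x F) 0 1 = 0"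
      proof
        assume "ev F e3 = 0"
        moreover obtain a b c d where "face_x F = (a,b,c,d)" by (cases "face_x F")
        moreover have "beval (face_x F) 0 1 = ev F e3" by (simp add: face_simps)
        ultimately have "face_x F = 0" using b D1(4,5) D1(1-3) \<open>t = 0\<close> by (auto simp: zero_prod_def)
        then show False using faces_nonzero by blast
      qed
      ultimately show ?thesis using D1(6) by auto
    qed
    have C2: "length L2 + (if ev F e3 = 0 then 1 else 0) \<le> 2" if "t' = 0"
    proof -
      have "length L2 \<le> 1 \<or> bderiv_s (face_y F) 0 1 = 0" using d2 that unfolding double_zero_def by auto
      moreover have "ev F e3 \<noteq> 0" if b: "bderiv_s (face_y F) 0 1 = 0"
      proof
        assume "ev F e3 = 0"
        moreover obtain a b c d where "face_y F = (a,b,c,d)" by (cases "face_y F")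
        moreover have "beval (face_y F) 0 1 = ev F e3" by (simp add: face_simps)
        ultimately have "face_y F = 0" using b D2(4,5) D2(1-3) \<open>t' = 0\<close> by (auto simp: zero_prod_def)
        then show False using faces_nonzero by blast
      qed
      ultimately show ?thesis using D2(6) by auto
    qed
    show False
      by (rule cnt[OF face_double[OF linear_face(1) d1] face_double[OF linear_face(2) d2] f3])
        (use A B C1 C2 D1(6) D2(6) notboth in \<open>auto simp: length_vertex_conditions split: if_splits\<close>)
  qed
qed

text \<open>If the form at \<open>P\<close> is degenerate, then there is no double zero on \<open>z = 0\<close>: it would make \<open>Q\<close> a multiple of
the square of a linear form, whose line through \<open>P\<close> would also contain the degenerate direction and thus too many
zeros of \<open>F\<close>.  The double zero that may exist on \<open>y = 0\<close> is compensated by the lack of zeros at vertices.  A definite form requires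
double zeros on \<open>y = 0\<close> and \<open>z = 0\<close>, and \<open>Q\<close> puts them on one line through \<open>P\<close>; such a line leaves the
orthant only once.\<close>

lemma edge1_case:
  assumes p: "p = 0" shows False
proof -
  have positive: "q > 0" "r > 0" using two_pos P0 p by (auto simp: less_le)
  note ft = face_through_P[of face_x q r]
  have f1: "face_conditions face_x []" and z1: "bderiv_s (face_x F) q r = 0" "bderiv_t (face_x F) q r = 0" using ft p positive by auto
  have notboth: "\<not> (ev F e2 = 0 \<and> ev F e3 = 0)"
    using double_zero_and_ends[OF z1] positive faces_nonzero(1) by (auto simp: face_simps)
  then have v2: "length vertex_conditions \<le> 2" by (auto simp: length_vertex_conditions)
  have g2: "gr F e2 P > 0"
    using bin_face_positive[OF z1 positive copositive_face(1)[OF copositive_F] faces_nonzero(1)] gr_ext[of F e2 p q r] p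
    by (simp add: face_simps)
  show False
  proof (cases "\<exists>v. gr F v P = 0 \<and> (\<forall>c. v \<noteq> c *\<^sub>R P)")
    case True
    then obtain v0 where v0: "gr F v0 P = 0" "\<And>c. v0 \<noteq> c *\<^sub>R P" by blast
    obtain x0 y0 z0 where v0': "v0 = (x0,y0,z0)" by (cases v0)
    have x0: "x0 \<noteq> 0"
    proof
      assume "x0 = 0"
      then have e: "v0 = (y0 - z0 * q / r) *\<^sub>R e2 + (z0 / r) *\<^sub>R P" using positive p by (simp add: v0')
      have "(y0 - z0 * q / r)^2 * gr F e2 P = 0"
        using v0(1) unfolding e by (simp only: singular_shift[OF singular] gr_hom)
      then have "y0 - z0 * q / r = 0" using g2 by simp
      then have "v0 = (z0 / r) *\<^sub>R P" using e by simp
      then show False using v0(2) by blast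
    qed
    define l where "l = \<bar>y0\<bar>/q + \<bar>z0\<bar>/r"
    define v where "v = sgn x0 *\<^sub>R v0 + l *\<^sub>R P"
    have l: "\<bar>y0\<bar> \<le> l * q" "\<bar>z0\<bar> \<le> l * r" using positive by (simp_all add: l_def distrib_right)
    have nnv: "nonneg v" using l x0 p by (auto simp: v_def v0' sgn_if)
    have posv: "positive (P + v)" using l x0 p positive by (auto simp: v_def v0' sgn_if)
    have gv: "gr F v P = 0" unfolding v_def by (simp only: singular_shift[OF singular] gr_hom v0 mult_zero_right)
    have snz: "fst v > 0" using x0 p by (simp add: v_def v0' sgn_if)
    have vertex_nonsingular: "v \<noteq> c *\<^sub>R P" for c using snz p by auto
    have Qv: "qv Q v = 0" using degenerate_on_face1[OF H nonneg_P singular _ nnv snz gv] positive by simp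
    have no3: "\<not> double_zero (face_z F) s t L" for s t L
    proof
      assume d: "double_zero (face_z F) s t L"
      have nd: "(s,t,0) \<noteq> 0" using double_zeroD[OF d] by (auto simp: zero_prod_def)
      have "det3 P (s,t,0) v = 0" using quadric_double_line[OF rad radical_double3[OF d positive(2)] Qv] Q0 by blast
      then obtain a b where ab: "v = a *\<^sub>R P + b *\<^sub>R (s,t,0)" using det3_dependent[OF _ nd] positive by fastforce
      have "b \<noteq> 0" using ab vertex_nonsingular[of a] by auto
      then show False using degenerate_line[OF nnv gv posv vertex_nonsingular double3(1)[OF d] ab] by blast
    qed
    then have f3: "face_conditions face_z []" using face_alternatives by blast
    have dv: "det3 P v e2 \<noteq> 0" using snz positive p by (cases v) auto
    note cnt = too_few_conditions_degenerate[OF f1 _ f3 gv dv g2]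
    from face_alternatives(2) show False
    proof
      assume "face_conditions face_y []" from cnt[OF this] v2 show False by simp
    next
      assume "\<exists>s t L. double_zero (face_y F) s t L"
      then obtain s t L where d: "double_zero (face_y F) s t L" by blast
      note D = double_zeroD[OF d]
      \<comment> \<open>zeros at \<open>e1\<close>, \<open>e2\<close> and the degenerate direction would be three zeros of \<open>Q\<close> modulo \<open>P\<close>\<close>
      have not12: "\<not> (ev F e1 = 0 \<and> ev F e2 = 0)"
      proof
        assume z: "ev F e1 = 0 \<and> ev F e2 = 0"
        have "det3 P e1 e2 \<noteq> 0" "det3 P e2 v \<noteq> 0" using positive snz p by (cases v; auto)+
        moreover have "det3 P e1 v \<noteq> 0"
        proof
          assume "det3 P e1 v = 0"
          then obtain a b where ab: "v = a *\<^sub>R P + b *\<^sub>R e1" using det3_dependent[of P e1 v] positive by (fastforce simp: zero_prod_def)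
          have "b \<noteq> 0" using ab vertex_nonsingular[of a] by auto
          then show False using degenerate_line[OF nnv gv posv vertex_nonsingular _ ab] z by blast
        qed
        ultimately show False using quadric_three_zeros[OF rad zero_e1 zero_e2 Qv] z Q0 by blast
      qed
      have not13: "length L \<le> 1" if z: "ev F e1 = 0" "ev F e3 = 0"
      proof -
        obtain a b c dd where R: "face_y F = (a,b,c,dd)" by (cases "face_y F")
        have bc0: "beval (face_y F) 1 0 = 0" "beval (face_y F) 0 1 = 0" using z by (simp_all add: face_simps)
        then have "\<not> (0 < s \<and> 0 < t)" using d unfolding double_zero_def by blast
        then consider "t = 0" "s > 0" | "s = 0" "t > 0" using D by linarith
        then show ?thesis
        proof cases
          case 1
          have "\<not> bderiv_s (face_y F) 0 1 = 0"
            using D(4,5) 1 bc0 R faces_nonzero(2) by (auto simp: zero_prod_def)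
          then show ?thesis using d 1 unfolding double_zero_def by auto
        next
          case 2
          have "\<not> bderiv_t (face_y F) 1 0 = 0"
            using D(4,5) 2 bc0 R faces_nonzero(2) by (auto simp: zero_prod_def)
          then show ?thesis using d 2 unfolding double_zero_def by auto
        qed
      qed
      show False
        by (rule cnt[OF face_double[OF linear_face(2) d]])
          (use not12 not13 notboth D(6) in \<open>auto simp: length_vertex_conditions split: if_splits\<close>)
    qed
  next
    case False
    then have def: "\<And>v. gr F v P = 0 \<Longrightarrow> \<exists>c. v = c *\<^sub>R P" by blast
    then obtain s' t' L2 s t L3 where d2: "double_zero (face_y F) s' t' L2" and d3: "double_zero (face_z F) s t L3"
      using face_alternatives definite_two_doubles[OF def] f1 by blast
    note D2 = double_zeroD[OF d2] double2[OF d2] and D3 = double_zeroD[OF d3] double3[OF d3]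
    have "det3 P (s,t,0) (s',0,t') = 0"
      using quadric_double_line[OF rad radical_double3[OF d3 positive(2)] D2(8)] Q0 by blast
    then have e: "q * s * t' + r * t * s' = 0" using p by (simp add: algebra_simps)
    have nn0: "0 \<le> q * s * t'" "0 \<le> r * t * s'" using positive D2 D3 by (intro mult_nonneg_nonneg; simp)+
    have "q * s * t' = 0" "r * t * s' = 0" using e nn0 by linarith+
    then have *: "s = 0 \<or> t' = 0" "t = 0 \<or> s' = 0" using positive by auto
    have "s = 0 \<and> s' = 0" using * no_shared23[OF d2 d3] D2 D3 by auto
    then have "ev F e2 = 0" "ev F e3 = 0"
      using D2 D3 ev_hom[of F t e2] ev_hom[of F t' e3] by auto
    then show False using notboth by blast
  qed
qed

end

text \<open>The bound is symmetric in \<open>x\<close> and \<open>y\<close>, so the edge \<open>y = 0\<close> reduces to \<open>x = 0\<close>.\<close>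

lemma main_no_variable_factor:
  assumes F: "extremal_cubic F" "no_variable_factor F" and H: "square_bounded Q F"
  shows "Q = 0"
proof (rule ccontr)
  assume Q0: "Q \<noteq> 0"
  obtain P where P: "nonneg P" "P \<noteq> 0" "singular F P" using has_singular_point[OF F] by blast
  obtain p q r where P': "P = (p,q,r)" by (cases P)
  interpret extremal_case F Q p q r
    by unfold_locales (use F H Q0 P P' in auto)
  consider "p > 0" "q > 0" "r > 0" | "r = 0" | "p = 0" | "q = 0" using P0 by linarith
  then show False
  proof cases
    case 1 then show False by (rule interior_case)
  next
    case 2 then show False by (rule edge3_case)
  next
    case 3 then show False by (rule edge1_case)
  next
    case 4
    have "singular (swap_xy F) (q,p,r)" using singular unfolding singular_def swap_xy_simps by simp
    then interpret sw: extremal_case "swap_xy F" "swap_quadric Q" q p r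
      by unfold_locales (use extremal_cubic_swap_xy[OF F(1)] F(2) no_variable_factor_perm square_bounded_swap[OF H] Q0 swap_quadric_simps(3)[of Q] P0 ns in \<open>auto simp: zero_prod_def\<close>)
    from 4 show False by (rule sw.edge1_case)
  qed
qed

section \<open>Cubics with a variable as a factor\<close>

text \<open>The analogues for quadratic forms, where \<open>Q\<close> is replaced by a linear form \<open>M\<close>.\<close>

definition qdominated :: "quadric \<Rightarrow> quadric \<Rightarrow> bool" where
  "qdominated C G \<longleftrightarrow> (\<exists>k. \<forall>v. nonneg v \<longrightarrow> \<bar>qv C v\<bar> \<le> k * qv G v)"

definition extremal_quadric :: "quadric \<Rightarrow> bool" where
  "extremal_quadric G \<longleftrightarrow> (\<forall>v. nonneg v \<longrightarrow> 0 \<le> qv G v) \<and> (\<forall>C. qdominated C G \<longrightarrow> (\<exists>c. C = c *\<^sub>R G))"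

definition lin_square_bounded :: "vec \<Rightarrow> quadric \<Rightarrow> bool" where
  "lin_square_bounded M G \<longleftrightarrow> (\<exists>k. \<forall>x y z. 0 \<le> x \<longrightarrow> 0 \<le> y \<longrightarrow> 0 \<le> z \<longrightarrow> x * y * (M \<bullet> (x,y,z))^2 \<le> k * (qv G (x,y,z))^2)"

lemma qv_hom: "\<And>c G v. qv G (c *\<^sub>R v) = c^2 * qv G v"
  by (simp only: poly_eval) algebra

lemma pol_scale1: "\<And>Q u v a. pol Q (a *\<^sub>R u) v = a * pol Q u v"
  by (simp only: poly_eval) algebra

lemma qv_deriv: "((\<lambda>t. qv G (v + t *\<^sub>R e)) has_real_derivative pol G v e) (at 0)"
  unfolding qv_line by (auto intro!: derivative_eq_intros)

lemma pol_cont: "continuous_on S (\<lambda>v. pol G v e)"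
proof -
  obtain a b c d f g where G: "G = (a,b,c,d,f,g)" by (metis prod.exhaust)
  obtain u v w where e: "e = (u,v,w)" by (cases e)
  have "(\<lambda>V. pol G V e) = (\<lambda>V. pol G (fst V, fst (snd V), snd (snd V)) e)" by simp
  then show ?thesis unfolding G e pol.simps by (simp only:) (intro continuous_intros)
qed

lemma qv_cont: "continuous_on S (qv G)"
proof -
  obtain a b c d f g where G: "G = (a,b,c,d,f,g)" by (metis prod.exhaust)
  have "qv G = (\<lambda>V. qv G (fst V, fst (snd V), snd (snd V)))" by simp
  then show ?thesis unfolding G qv.simps by (simp only:) (intro continuous_intros)
qed

text \<open>By extremality \<open>C\<close> is not dominated by \<open>G\<close>, so \<open>singular_limit\<close> applies.\<close>

lemma quad_limit:
  assumes G: "extremal_quadric G" and C: "\<And>v. nonneg v \<Longrightarrow> 0 \<le> qv C v" and nC: "\<And>c. C \<noteq> c *\<^sub>R G"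
  shows "\<exists>P. nonneg P \<and> P \<noteq> 0 \<and> qv G P = 0 \<and>
     (\<forall>e\<in>axes. P \<bullet> e > 0 \<or> (\<forall>v. nonneg v \<and> qv C v > 0 \<longrightarrow> v \<bullet> e > 0) \<longrightarrow> pol G P e = 0)"
proof (rule singular_limit[where d = 2 and g' = "pol C"])
  fix \<epsilon> :: real assume \<epsilon>: "\<epsilon> > 0"
  show "\<exists>v. nonneg v \<and> qv G v < \<epsilon> * qv C v"
  proof (rule ccontr)
    assume "\<not> ?thesis"
    then have *: "\<And>v. nonneg v \<Longrightarrow> \<epsilon> * qv C v \<le> qv G v" by (meson not_le)
    have "qdominated C G" unfolding qdominated_def
    proof (intro exI allI impI)
      fix v assume v: "nonneg v"
      then show "\<bar>qv C v\<bar> \<le> (1/\<epsilon>) * qv G v" using *[OF v] C[OF v] \<epsilon> by (simp add: field_simps)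
    qed
    then show False using G nC unfolding extremal_quadric_def by blast
  qed
qed (use G in \<open>auto simp: qv_hom qv_deriv qv_cont pol_cont extremal_quadric_def\<close>)

lemma lin_zero:
  fixes M :: vec
  assumes "\<And>b. positive b \<Longrightarrow> M \<bullet> b = 0" shows "M = 0"
proof -
  obtain m1 m2 m3 where M: "M = (m1,m2,m3)" by (cases M)
  show ?thesis using assms[of "(1,1,1)"] assms[of "(2,1,1)"] assms[of "(1,2,1)"] assms[of "(1,1,2)"]
    by (auto simp: M zero_prod_def)
qed

text \<open>Along \<open>P + t b\<close> the square of \<open>G\<close> is of order \<open>t\<^sup>4\<close>, while \<open>x y\<close> is at least of order \<open>t\<close>.\<close>

lemma lin_singular:
  assumes H: "lin_square_bounded M G" and P: "nonneg P" "in_radical G P" "fst P > 0 \<or> fst (snd P) > 0"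
  shows "M = 0"
proof (rule lin_zero)
  fix b assume b: "positive b"
  obtain k where k: "\<And>x y z. 0 \<le> x \<Longrightarrow> 0 \<le> y \<Longrightarrow> 0 \<le> z \<Longrightarrow> x * y * (M \<bullet> (x,y,z))^2 \<le> k * (qv G (x,y,z))^2"
    using H unfolding lin_square_bounded_def by blast
  obtain p q r where P': "P = (p,q,r)" by (cases P)
  obtain x y z where b': "b = (x,y,z)" by (cases b)
  define c where "c = p * y + q * x"
  have c: "c > 0" using P b by (auto simp: c_def P' b' add_pos_nonneg add_nonneg_pos)
  have "M \<bullet> P = 0 \<and> M \<bullet> b = 0"
  proof (rule vanishes_doubly_at_zero[where h = "\<lambda>_. 0" and w = "\<lambda>t. k / c * (qv G b)^2"])
    fix t :: real assume t: "0 < t" "t < 1"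
    have "t * c * (M \<bullet> (P + t *\<^sub>R b))^2 \<le> (p + t * x) * (q + t * y) * (M \<bullet> (P + t *\<^sub>R b))^2"
      using t b P by (intro mult_right_mono) (auto simp: c_def P' b' algebra_simps)
    also have "\<dots> \<le> k * (qv G (P + t *\<^sub>R b))^2"
      using k[of "p + t * x" "q + t * y" "r + t * z"] t b P by (simp add: P' b')
    also have "qv G (P + t *\<^sub>R b) = t^2 * qv G b"
      by (simp add: qv_line in_radical_zero[OF P(2)] in_radicalD[OF P(2)])
    also have "k * (t^2 * qv G b)^2 = t * c * (t^3 * (k / c * (qv G b)^2))"
      using c by (simp add: field_simps power2_eq_square power3_eq_cube)
    finally have "(M \<bullet> (P + t *\<^sub>R b))^2 \<le> t^3 * (k / c * (qv G b)^2)"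
      by (rule cancel_pos) (use t c in simp)
    then show "(M \<bullet> P + (M \<bullet> b) * t + t^2 * 0)^2 \<le> t^3 * (k / c * (qv G b)^2)"
      by (simp add: inner_add_right mult.commute)
  qed (use c in \<open>auto intro!: continuous_intros\<close>)
  then show "M \<bullet> b = 0" by simp
qed

lemma lin_square_boundedE:
  assumes "lin_square_bounded M G"
  obtains k where "0 \<le> k" "\<And>x y z. 0 \<le> x \<Longrightarrow> 0 \<le> y \<Longrightarrow> 0 \<le> z \<Longrightarrow> x * y * (M \<bullet> (x,y,z))^2 \<le> k * (qv G (x,y,z))^2"
proof -
  obtain k where k: "\<And>x y z. 0 \<le> x \<Longrightarrow> 0 \<le> y \<Longrightarrow> 0 \<le> z \<Longrightarrow> x * y * (M \<bullet> (x,y,z))^2 \<le> k * (qv G (x,y,z))^2"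
    using assms unfolding lin_square_bounded_def by blast
  have "x * y * (M \<bullet> (x,y,z))^2 \<le> max k 0 * (qv G (x,y,z))^2" if "0 \<le> x" "0 \<le> y" "0 \<le> z" for x y z
    by (rule order_trans[OF k[OF that]]) (intro mult_right_mono, auto)
  then show ?thesis using that[of "max k 0"] by simp
qed

lemma lin_xy:
  assumes H: "lin_square_bounded M G" and G: "G = c *\<^sub>R (0,0,0,1,0,0)" shows "M = 0"
proof -
  obtain m1 m2 m3 where M: "M = (m1,m2,m3)" by (cases M)
  obtain k where k: "0 \<le> k" "\<And>x y z. 0 \<le> x \<Longrightarrow> 0 \<le> y \<Longrightarrow> 0 \<le> z \<Longrightarrow> x * y * (m1*x + m2*y + m3*z)^2 \<le> k * (c*x*y)^2"
    using lin_square_boundedE[OF H] unfolding G M by (auto simp: mult.assoc add.assoc)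
  have k': "(m1*x + m2*y + m3*z)^2 \<le> x * y * (k * c^2)" if "0 < x" "0 < y" "0 \<le> z" for x y z
  proof -
    have "x * y * (m1*x + m2*y + m3*z)^2 \<le> x * y * (x * y * (k * c^2))"
      using k(2)[of x y z] that by (simp add: power2_eq_square algebra_simps)
    then show ?thesis by (rule cancel_pos) (use that in simp)
  qed
  have "m1 * 0 + m2 * 1 + m3 * z = 0" if "0 \<le> z" for z
    by (rule vanishes_at_zero[where g = "\<lambda>r. m1 * r + m2 * 1 + m3 * z" and w = "\<lambda>_. k * c^2"])
      (use k'[of _ 1 z] that in auto)
  from this[of 0] this[of 1] have m: "m2 = 0" "m3 = 0" by auto
  have "m1 * 1 + m2 * 0 + m3 * 0 = 0"
    by (rule vanishes_at_zero[where g = "\<lambda>r. m1 * 1 + m2 * r + m3 * 0" and w = "\<lambda>_. k * c^2"])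
      (use k'[of 1 _ 0] in auto)
  then show ?thesis using m by (simp add: M zero_prod_def)
qed

lemma lin_xz:
  assumes H: "lin_square_bounded M G" and G: "G = c *\<^sub>R (0,0,0,0,1,0)" shows "M = 0"
proof -
  obtain m1 m2 m3 where M: "M = (m1,m2,m3)" by (cases M)
  obtain k where k: "0 \<le> k" "\<And>x y z. 0 \<le> x \<Longrightarrow> 0 \<le> y \<Longrightarrow> 0 \<le> z \<Longrightarrow> x * y * (m1*x + m2*y + m3*z)^2 \<le> k * (c*x*z)^2"
    using lin_square_boundedE[OF H] unfolding G M by (auto simp: mult.assoc add.assoc)
  have "m1 + m2 * y + m3 * 0 = 0" if y: "0 < y" for y
  proof (rule vanishes_at_zero[where g = "\<lambda>r. m1 + m2 * y + m3 * r" and w = "\<lambda>r. r * (k * c^2 / y)"])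
    fix r :: real assume r: "0 < r" "r < 1"
    have "y * (m1 + m2*y + m3*r)^2 \<le> y * (r * (r * (k * c^2 / y)))"
      using k(2)[of 1 y r] r y by (simp add: power2_eq_square algebra_simps)
    then show "(m1 + m2 * y + m3 * r)^2 \<le> r * (r * (k * c^2 / y))" by (rule cancel_pos) (use y in simp)
  qed (use y in \<open>auto intro!: continuous_intros\<close>)
  from this[of 1] this[of 2] have m: "m1 = 0" "m2 = 0" by auto
  have "m3 = 0"
  proof (rule vanishes_at_zero[where g = "\<lambda>r. m3" and w = "\<lambda>r. k * c^2"])
    fix r :: real assume r: "0 < r" "r < 1"
    show "m3^2 \<le> r * (k * c^2)" using k(2)[of 1 "1/r" 1] r m by (simp add: field_simps)
  qed auto
  then show ?thesis using m by (simp add: M zero_prod_def)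
qed

lemma quad_exhaust:
  fixes G :: quadric obtains a b c d e f where "G = (a,b,c,d,e,f)"
  by (metis prod.exhaust)

text \<open>Sending \<open>z\<close> to infinity removes \<open>z\<close> from \<open>M\<close>, so that only two variables are left.  An extremal binary form is
a multiple of \<open>x\<^sup>2\<close>, \<open>y\<^sup>2\<close>, \<open>xy\<close>, or has an interior double zero.\<close>

lemma lin_vertex:
  assumes G: "extremal_quadric G" and H: "lin_square_bounded M G" and s: "in_radical G (0,0,1)" shows "M = 0"
proof -
  obtain m1 m2 m3 where M: "M = (m1,m2,m3)" by (cases M)
  obtain a b c d e f where G0: "G = (a,b,c,d,e,f)" by (rule quad_exhaust)
  have z: "c = 0" "e = 0" "f = 0" using s unfolding in_radical_iff G0 by auto
  obtain k where k: "0 \<le> k" "\<And>x y z. 0 \<le> x \<Longrightarrow> 0 \<le> y \<Longrightarrow> 0 \<le> z \<Longrightarrow> x * y * (m1*x + m2*y + m3*z)^2 \<le> k * (a*x^2 + b*y^2 + d*x*y)^2"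
    using lin_square_boundedE[OF H] unfolding G0 M z by (auto simp: add.assoc)
  have "m1 * 0 + m2 * 0 + m3 = 0"
  proof (rule vanishes_at_zero[where g = "\<lambda>r. m1 * r + m2 * r + m3" and w = "\<lambda>r. r * (k * (a + b + d)^2)"])
    fix r :: real assume r: "0 < r" "r < 1"
    have "(m1 + m2 + m3 / r)^2 \<le> k * (a + b + d)^2" using k(2)[of 1 1 "1/r"] r by simp
    then have "r^2 * (m1 + m2 + m3 / r)^2 \<le> r^2 * (k * (a + b + d)^2)" by (intro mult_left_mono) auto
    also have "r^2 * (m1 + m2 + m3 / r)^2 = (m1 * r + m2 * r + m3)^2"
      unfolding power_mult_distrib[symmetric] using r by (simp add: algebra_simps)
    finally show "(m1 * r + m2 * r + m3)^2 \<le> r * (r * (k * (a + b + d)^2))" by (simp add: power2_eq_square mult.assoc)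
  qed (auto intro!: continuous_intros)
  then have m3: "m3 = 0" by simp
  have nng: "0 \<le> a*x^2 + b*y^2 + d*x*y" if "0 \<le> x" "0 \<le> y" for x y
  proof -
    have "0 \<le> qv G (x,y,0)" using G that unfolding extremal_quadric_def by (simp del: qv.simps)
    then show ?thesis by (simp add: G0)
  qed
  have ab: "0 \<le> a" "0 \<le> b" using nng[of 1 0] nng[of 0 1] by auto
  show ?thesis
  proof (cases "a > 0 \<and> b > 0")
    case False
    then have ab0: "a = 0 \<or> b = 0" using ab by auto
    have d: "0 \<le> d"
    proof -
      have lim: "((\<lambda>r. (a + b) * r + d) \<longlongrightarrow> (a + b) * 0 + d) (at_right 0)" by (intro tendsto_intros)
      have "0 \<le> (a + b) * r + d" if "0 < r" for r
      proof -
        have "0 \<le> r * ((a + b) * r + d)" using ab0 nng[of r 1] nng[of 1 r] that by (auto simp: power2_eq_square algebra_simps)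
        then show ?thesis using that by (simp add: zero_le_mult_iff)
      qed
      then have "eventually (\<lambda>r. 0 \<le> (a + b) * r + d) (at_right (0::real))"
        using eventually_at_right_less[of "0::real"] by (auto elim: eventually_mono)
      from tendsto_lowerbound[OF lim this] show ?thesis by simp
    qed
    show ?thesis
    proof (cases "d > 0")
      case True
      have "qdominated (0,0,0,1,0,0) G" unfolding qdominated_def
      proof (intro exI allI impI)
        fix v assume v: "nonneg v"
        obtain x y t where v': "v = (x,y,t)" by (cases v)
        have "0 \<le> a * x^2" "0 \<le> b * y^2" using ab by auto
        then show "\<bar>qv (0,0,0,1,0,0) v\<bar> \<le> (1/d) * qv G v" using v True by (simp add: v' G0 z field_simps)
      qed
      then obtain c' where c': "(0,0,0,1,0,0) = c' *\<^sub>R G" using G unfolding extremal_quadric_def by blast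
      then have "c' \<noteq> 0" by (auto simp: G0)
      then have "G = (1/c') *\<^sub>R (0,0,0,1,0,0)" by (simp only: c' scaleR_scaleR) simp
      then show ?thesis by (rule lin_xy[OF H])
    next
      case False
      then have d0: "d = 0" using d by simp
      from ab0 have "m1 = 0 \<and> m2 = 0"
      proof
        assume a0: "a = 0"
        show ?thesis
        proof (rule vanishes_doubly_at_zero[where h = "\<lambda>_. 0" and w = "\<lambda>r. k * b^2"])
          fix r :: real assume r: "0 < r" "r < 1"
          have "r * (m1 + m2*r + r^2 * 0)^2 \<le> r * (r^3 * (k * b^2))"
            using k(2)[of 1 r 0] r a0 d0 by (simp add: eval_nat_numeral algebra_simps)
          then show "(m1 + m2*r + r^2 * 0)^2 \<le> r^3 * (k * b^2)" by (rule cancel_pos) (use r in simp)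
        qed auto
      next
        assume b0: "b = 0"
        have "m2 = 0 \<and> m1 = 0"
        proof (rule vanishes_doubly_at_zero[where h = "\<lambda>_. 0" and w = "\<lambda>r. k * a^2"])
          fix r :: real assume r: "0 < r" "r < 1"
          have "r * (m2 + m1*r + r^2 * 0)^2 \<le> r * (r^3 * (k * a^2))"
            using k(2)[of r 1 0] r b0 d0 by (simp add: eval_nat_numeral algebra_simps)
          then show "(m2 + m1*r + r^2 * 0)^2 \<le> r^3 * (k * a^2)" by (rule cancel_pos) (use r in simp)
        qed auto
        then show ?thesis by simp
      qed
      then show ?thesis using m3 by (simp add: M zero_prod_def)
    qed
  next
    case True
    show ?thesis
    proof (cases "\<exists>s t. 0 < s \<and> 0 < t \<and> a * s^2 + b*t^2 + d * s*t = 0")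
      case True
      then obtain s t where st: "0 < s" "0 < t" "a * s^2 + b*t^2 + d * s*t = 0" by blast
      have z1: "2*a * s + d*t = 0"
        by (rule min_deriv[of "\<lambda>s. a * s^2 + b*t^2 + d * s*t" _ s])
          (use st nng in \<open>auto intro!: derivative_eq_intros\<close>)
      have "m1 * s + m2 * t = 0 \<and> m1 = 0"
      proof (rule vanishes_doubly_at_zero[where h = "\<lambda>_. 0" and w = "\<lambda>r. k * a^2 / (s * t) * r"])
        fix r :: real assume r: "0 < r" "r < 1"
        have e: "a*(s+r)^2 + b*t^2 + d*(s+r)*t = a * r^2" using st(3) z1 by algebra
        have "s * t * (m1 * s + m2*t + m1*r + r^2*0)^2 \<le> (s+r) * t * (m1*(s+r) + m2*t + m3*0)^2"
          using st r by (auto simp: algebra_simps intro!: mult_right_mono)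
        also have "\<dots> \<le> k * (a * r^2)^2" unfolding e[symmetric] by (rule k(2)) (use st r in auto)
        also have "\<dots> = s * t * (r^3 * (k * a^2 / (s * t) * r))" using st by (simp add: eval_nat_numeral)
        finally show "(m1 * s + m2*t + m1*r + r^2*0)^2 \<le> r^3 * (k * a^2 / (s * t) * r)" by (rule cancel_pos) (use st in simp)
      qed (use st in \<open>auto intro!: continuous_intros\<close>)
      then show ?thesis using m3 st by (auto simp: M zero_prod_def)
    next
      case False
      have "\<exists>k. \<forall>s\<ge>0. \<forall>t\<ge>0. \<bar>s^2\<bar> \<le> k * (a * s^2 + b*t^2 + d * s*t)"
      proof (rule quadrant_compare[where n = 2])
        fix s t :: real assume st: "0 \<le> s" "0 \<le> t" "0 < s + t"
        have "a * s^2 + b*t^2 + d * s*t \<noteq> 0" using False True st by (cases "s = 0"; cases "t = 0") auto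
        then show "0 < a * s^2 + b*t^2 + d * s*t" using nng[OF st(1,2)] by simp
      qed (auto simp: algebra_simps power2_eq_square intro!: continuous_intros)
      then have "qdominated (1,0,0,0,0,0) G" unfolding qdominated_def G0 z by (auto simp: split_paired_All)
      then obtain c' where c': "(1,0,0,0,0,0) = c' *\<^sub>R G" using G unfolding extremal_quadric_def by blast
      then show ?thesis using True by (auto simp: G0)
    qed
  qed
qed

lemma lin_radical:
  assumes G: "extremal_quadric G" and H: "lin_square_bounded M G" and P: "nonneg P" "P \<noteq> 0" "in_radical G P" shows "M = 0"
proof (cases "fst P > 0 \<or> fst (snd P) > 0")
  case True then show ?thesis using lin_singular[OF H P(1,3)] by blast
next
  case False
  obtain p q r where P': "P = (p,q,r)" by (cases P)
  have "p = 0" "q = 0" "r \<noteq> 0" using False P by (auto simp: P' zero_prod_def)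
  then have "in_radical G (0,0,1)" using P(3) pol_scale1[of G r "(0,0,1)"] unfolding in_radical_iff P' by simp
  then show ?thesis by (rule lin_vertex[OF G H])
qed

text \<open>Comparison with \<open>xy\<close> yields a point \<open>P\<close> on \<open>z = 0\<close> at which \<open>G\<close> restricted to this face has a
double zero; it forces \<open>M = m\<^sub>3 z\<close>.  Comparison with \<open>xz\<close> yields a point \<open>R\<close> on \<open>y = 0\<close>, where \<open>M\<close> has to
vanish too; in the remaining case \<open>R = (1,0,0)\<close> this vertex would be singular, which \<open>lin_radical\<close> excludes.
Multiples of \<open>xy\<close> and \<open>xz\<close>, where no such points exist, are the lemmas \<open>lin_xy\<close> and \<open>lin_xz\<close>.\<close>

lemma extremal_quadric_main:
  assumes G: "extremal_quadric G" and H: "lin_square_bounded M G" shows "M = 0"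
proof (rule ccontr)
  assume M0: "M \<noteq> 0"
  obtain m1 m2 m3 where M: "M = (m1,m2,m3)" by (cases M)
  obtain a b c d e f where G0: "G = (a,b,c,d,e,f)" by (rule quad_exhaust)
  obtain k where k: "0 \<le> k" "\<And>x y z. 0 \<le> x \<Longrightarrow> 0 \<le> y \<Longrightarrow> 0 \<le> z \<Longrightarrow> x * y * (m1*x + m2*y + m3*z)^2 \<le> k * (qv G (x,y,z))^2"
    using lin_square_boundedE[OF H] unfolding M by (auto simp: add.assoc)
  have nrad: "\<not> in_radical G P" if "nonneg P" "P \<noteq> 0" for P using lin_radical[OF G H that] M0 by blast
  have mult_inv: "G = (1/c') *\<^sub>R C" if "C = c' *\<^sub>R G" "C \<noteq> 0" for c' C using that by auto
  have nxy: "(0,0,0,1,0,0) \<noteq> c' *\<^sub>R G" for c'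
  proof
    assume "(0,0,0,1,0,0) = c' *\<^sub>R G"
    then have "G = (1/c') *\<^sub>R (0,0,0,1,0,0)" by (rule mult_inv) (simp add: zero_prod_def)
    then show False using lin_xy[OF H] M0 by blast
  qed
  have nxz: "(0,0,0,0,1,0) \<noteq> c' *\<^sub>R G" for c'
  proof
    assume "(0,0,0,0,1,0) = c' *\<^sub>R G"
    then have "G = (1/c') *\<^sub>R (0,0,0,0,1,0)" by (rule mult_inv) (simp add: zero_prod_def)
    then show False using lin_xz[OF H] M0 by blast
  qed
  have Cxy: "0 \<le> qv (0,0,0,1,0,0) v" if "nonneg v" for v using that by (cases v) simp
  have Cxz: "0 \<le> qv (0,0,0,0,1,0) v" if "nonneg v" for v using that by (cases v) simp
  have sxy: "\<forall>v. nonneg v \<and> qv (0,0,0,1,0,0) v > 0 \<longrightarrow> v \<bullet> e > 0" if "e = (1,0,0) \<or> e = (0,1,0)" for e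
    using that by (auto simp: split_paired_All zero_less_mult_iff)
  have sxz: "\<forall>v. nonneg v \<and> qv (0,0,0,0,1,0) v > 0 \<longrightarrow> v \<bullet> e > 0" if "e = (1,0,0) \<or> e = (0,0,1)" for e
    using that by (auto simp: split_paired_All zero_less_mult_iff)
  obtain P where P: "nonneg P" "P \<noteq> 0" "qv G P = 0"
    "\<forall>e\<in>axes. P \<bullet> e > 0 \<or> (\<forall>v. nonneg v \<and> qv (0,0,0,1,0,0) v > 0 \<longrightarrow> v \<bullet> e > 0) \<longrightarrow> pol G P e = 0"
    using quad_limit[OF G Cxy nxy] by blast
  obtain s t u where P': "P = (s,t,u)" by (cases P)
  have P12: "pol G P (1,0,0) = 0" "pol G P (0,1,0) = 0"
    using P(4) sxy by blast+
  have u0: "u = 0"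
  proof (rule ccontr)
    assume "u \<noteq> 0"
    then have "pol G P (0,0,1) = 0" using P(1,4) by (auto simp: P' simp del: pol.simps)
    then show False using nrad[OF P(1,2)] P12 unfolding in_radical_iff by blast
  qed
  have st: "0 \<le> s" "0 \<le> t" "0 < s + t" using P(1,2) u0 by (auto simp: P' zero_prod_def)
  have p1: "2*a * s + d*t = 0" "2*b*t + d * s = 0" using P12 by (auto simp: P' u0 G0)
  have p0: "a * s^2 + b*t^2 + d * s*t = 0" using P(3) by (simp add: P' u0 G0)
  have A: "m1 * s + m2 * t = 0 \<and> m1 = 0" if "t > 0"
  proof (rule vanishes_doubly_at_zero[where h = "\<lambda>_. 0" and w = "\<lambda>r. k * a^2 / t"])
    fix r :: real assume r: "0 < r" "r < 1"
    have "a * (s+r)^2 + b*t^2 + d * (s+r) * t = a * r^2" using p0 p1 by algebra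
    then have e: "qv G (s+r,t,0) = a * r^2" by (simp add: G0)
    have "r * t * (m1 * s + m2*t + m1*r + r^2*0)^2 \<le> (s+r) * t * (m1*(s+r) + m2*t + m3*0)^2"
      using st r by (auto simp: algebra_simps intro!: mult_right_mono)
    also have "\<dots> \<le> k * (a * r^2)^2" unfolding e[symmetric] by (rule k(2)) (use st r in auto)
    also have "\<dots> = r * t * (r^3 * (k * a^2 / t))" using that by (simp add: eval_nat_numeral)
    finally show "(m1 * s + m2*t + m1*r + r^2*0)^2 \<le> r^3 * (k * a^2 / t)" by (rule cancel_pos) (use that r in simp)
  qed (use that in auto)
  have B: "m1 * s + m2 * t = 0 \<and> m2 = 0" if "s > 0"
  proof (rule vanishes_doubly_at_zero[where h = "\<lambda>_. 0" and w = "\<lambda>r. k * b^2 / s"])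
    fix r :: real assume r: "0 < r" "r < 1"
    have "a * s^2 + b * (t+r)^2 + d * s * (t+r) = b * r^2" using p0 p1 by algebra
    then have e: "qv G (s,t+r,0) = b * r^2" by (simp add: G0)
    have "r * s * (m1 * s + m2*t + m2*r + r^2*0)^2 \<le> s * (t+r) * (m1 * s + m2*(t+r) + m3*0)^2"
      using st r by (auto simp: algebra_simps intro!: mult_right_mono)
    also have "\<dots> \<le> k * (b * r^2)^2" unfolding e[symmetric] by (rule k(2)) (use st r in auto)
    also have "\<dots> = r * s * (r^3 * (k * b^2 / s))" using that by (simp add: eval_nat_numeral)
    finally show "(m1 * s + m2*t + m2*r + r^2*0)^2 \<le> r^3 * (k * b^2 / s)" by (rule cancel_pos) (use that r in simp)
  qed (use that in auto)
  have m12: "m1 = 0" "m2 = 0" using A B st by (cases "s = 0"; cases "t = 0"; auto)+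
  obtain R where R: "nonneg R" "R \<noteq> 0" "qv G R = 0"
    "\<forall>e\<in>axes. R \<bullet> e > 0 \<or> (\<forall>v. nonneg v \<and> qv (0,0,0,0,1,0) v > 0 \<longrightarrow> v \<bullet> e > 0) \<longrightarrow> pol G R e = 0"
    using quad_limit[OF G Cxz nxz] by blast
  obtain x y z where R': "R = (x,y,z)" by (cases R)
  have R13: "pol G R (1,0,0) = 0" "pol G R (0,0,1) = 0"
    using R(4) sxz by blast+
  have y0: "y = 0"
  proof (rule ccontr)
    assume "y \<noteq> 0"
    then have "pol G R (0,1,0) = 0" using R(1,4) by (auto simp: R' simp del: pol.simps)
    then show False using nrad[OF R(1,2)] R13 unfolding in_radical_iff by blast
  qed
  have xz: "0 \<le> x" "0 \<le> z" "0 < x + z" using R(1,2) y0 by (auto simp: R' zero_prod_def)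
  have r1: "2*a*x + e*z = 0" "2*c*z + e*x = 0" using R13 by (auto simp: R' y0 G0)
  have r0: "qv G (x,0,z) = 0" using R(3) by (simp add: R' y0 del: qv.simps)
  consider "x > 0" "z > 0" | "z = 0" "x > 0" | "x = 0" "z > 0" using xz by linarith
  then have "m3 = 0"
  proof cases
    case 1
    let ?d = "(x,0,z)" and ?e = "(0::real,1::real,0::real)"
    have "m3 * z = 0"
    proof (rule vanishes_at_zero[where g = "\<lambda>r. m3 * z" and w = "\<lambda>r. k / x * (pol G ?d ?e + r * qv G ?e)^2"])
      fix r :: real assume r: "0 < r" "r < 1"
      have e: "qv G (x,r,z) = r * (pol G ?d ?e + r * qv G ?e)"
        using qv_line[of G ?d r ?e] r0 by (simp add: power2_eq_square algebra_simps)
      have "x * r * (m3 * z)^2 \<le> k * (qv G (x,r,z))^2" using k(2)[of x r z] r xz m12 by simp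
      also have "\<dots> = x * r * (r * (k / x * (pol G ?d ?e + r * qv G ?e)^2))" unfolding e using 1 by (simp add: power2_eq_square)
      finally show "(m3 * z)^2 \<le> r * (k / x * (pol G ?d ?e + r * qv G ?e)^2)" by (rule cancel_pos) (use 1 r in simp)
    qed (use 1 in \<open>auto intro!: continuous_intros\<close>)
    then show ?thesis using 1 by simp
  next
    case 2
    then have ae: "a = 0" "e = 0" using r1 by auto
    have "d = 0"
    proof (cases "t = 0")
      case True then show ?thesis using p1 st by auto
    next
      case False then show ?thesis using p1 ae by auto
    qed
    then have "in_radical G (1,0,0)" unfolding in_radical_iff G0 using ae by simp
    then show ?thesis using nrad[of "(1,0,0)"] by (simp add: zero_prod_def)
  next
    case 3
    then have ce: "c = 0" "e = 0" using r1 by auto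
    show ?thesis
    proof (rule vanishes_at_zero[where g = "\<lambda>r. m3" and w = "\<lambda>r. k * (a + b*r^2 + d*r + f)^2"])
      fix r :: real assume r: "0 < r" "r < 1"
      have "r^3 * m3^2 \<le> k * (qv G (r,r^2,1))^2" using k(2)[of r "r^2" 1] r m12 by (simp add: power2_eq_square power3_eq_cube)
      also have "qv G (r,r^2,1) = r^2 * (a + b*r^2 + d*r + f)" by (simp add: G0 ce eval_nat_numeral algebra_simps)
      also have "k * (r^2 * (a + b*r^2 + d*r + f))^2 = r^3 * (r * (k * (a + b*r^2 + d*r + f)^2))" by algebra
      finally show "m3^2 \<le> r * (k * (a + b*r^2 + d*r + f)^2)" by (rule cancel_pos) (use r in simp)
    qed (auto intro!: continuous_intros)
  qed
  then show False using M0 m12 by (simp add: M zero_prod_def)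
qed

text \<open>Multiplication by a variable embeds the quadratic problem into the cubic one.\<close>

lemma extremal_quadric_from_cubic:
  fixes T :: "quadric \<Rightarrow> cubic" and e :: vec
  assumes F: "extremal_cubic (T G)" and T: "\<And>C v. ev (T C) v = (v \<bullet> e) * qv C v" "\<And>c C. T (c *\<^sub>R C) = c *\<^sub>R T C" "inj T" and e: "e \<in> axes"
  shows "extremal_quadric G"
  unfolding extremal_quadric_def
proof (intro conjI allI impI)
  have nne: "nonneg e" using e by auto
  fix v assume v: "nonneg v"
  have positive: "0 < (v + t *\<^sub>R e) \<bullet> e" if "t > 0" for t using e v that by (cases v) auto
  have ge: "0 \<le> qv G (v + t *\<^sub>R e)" if t: "t > 0" for t
  proof -
    have "nonneg (v + t *\<^sub>R e)" using v nne t by (intro nonneg_add) auto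
    then have "0 \<le> ev (T G) (v + t *\<^sub>R e)" using F unfolding extremal_cubic_def copositive_def by blast
    then show ?thesis using positive[OF t] unfolding T(1) by (simp add: zero_le_mult_iff)
  qed
  have lim: "((\<lambda>t. qv G v + t * pol G v e + t^2 * qv G e) \<longlongrightarrow> qv G v + 0 * pol G v e + 0^2 * qv G e) (at_right 0)" by (intro tendsto_intros)
  have "eventually (\<lambda>t. 0 \<le> qv G v + t * pol G v e + t^2 * qv G e) (at_right (0::real))"
    using ge eventually_at_right_less[of "0::real"] unfolding qv_line by (auto elim: eventually_mono)
  from tendsto_lowerbound[OF lim this] show "0 \<le> qv G v" by simp
next
  fix C assume "qdominated C G"
  then obtain k where k: "\<And>v. nonneg v \<Longrightarrow> \<bar>qv C v\<bar> \<le> k * qv G v" unfolding qdominated_def by blast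
  have "dominated (T C) (T G)" unfolding dominated_def
  proof (intro exI allI impI)
    fix v assume v: "nonneg v"
    have "0 \<le> v \<bullet> e" using v e by (cases v) auto
    then show "\<bar>ev (T C) v\<bar> \<le> k * ev (T G) v"
      using mult_left_mono[OF k[OF v], of "v \<bullet> e"] unfolding T(1) by (simp add: abs_mult algebra_simps)
  qed
  then obtain c where "T C = c *\<^sub>R T G" using F unfolding extremal_cubic_def by blast
  then have "T C = T (c *\<^sub>R G)" by (simp only: T(2))
  then show "\<exists>c. C = c *\<^sub>R G" using T(3) by (auto dest: injD)
qed

lemma mul_props:
  "\<And>c C. mulx (c *\<^sub>R C) = c *\<^sub>R mulx C" "\<And>c C. mulz (c *\<^sub>R C) = c *\<^sub>R mulz C" "inj mulx" "inj mulz"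
  "\<And>C v. ev (mulx C) v = (v \<bullet> (1,0,0)) * qv C v" "\<And>C v. ev (mulz C) v = (v \<bullet> (0,0,1)) * qv C v"
  by (simp_all add: split_paired_all ev_mul inj_def split_paired_All del: qv.simps)

lemma square_boundedE:
  assumes "square_bounded M G"
  obtains k where "0 \<le> k" "\<And>x y z. 0 \<le> x \<Longrightarrow> 0 \<le> y \<Longrightarrow> 0 \<le> z \<Longrightarrow> x * y * (qv M (x,y,z))^2 \<le> k * (ev G (x,y,z))^2"
proof -
  obtain k where k: "\<And>x y z. 0 \<le> x \<Longrightarrow> 0 \<le> y \<Longrightarrow> 0 \<le> z \<Longrightarrow> x * y * (qv M (x,y,z))^2 \<le> k * (ev G (x,y,z))^2"
    using assms unfolding square_bounded_def by blast
  have "x * y * (qv M (x,y,z))^2 \<le> max k 0 * (ev G (x,y,z))^2" if "0 \<le> x" "0 \<le> y" "0 \<le> z" for x y z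
    by (rule order_trans[OF k[OF that]]) (intro mult_right_mono, auto)
  then show ?thesis using that[of "max k 0"] by simp
qed

text \<open>On \<open>x = 0\<close> the bound shows that \<open>Q\<close> vanishes, so \<open>Q = x M\<close>, and \<open>x\<^sup>2\<close> cancels.\<close>

lemma divisible_x:
  assumes F: "extremal_cubic F" and d: "face_x F = 0" and H: "square_bounded Q F" shows "Q = 0"
proof -
  obtain a b c d e f g h i j where F0: "F = (a,b,c,d,e,f,g,h,i,j)" by (rule cubic_exhaust)
  define G :: quadric where "G = (a,f,h,d,e,j)"
  have FG: "F = mulx G" using d by (simp add: F0 G_def zero_prod_def)
  obtain q1 q2 q3 q4 q5 q6 where Q: "Q = (q1,q2,q3,q4,q5,q6)" by (rule quad_exhaust)
  obtain k where k: "0 \<le> k" "\<And>x y z. 0 \<le> x \<Longrightarrow> 0 \<le> y \<Longrightarrow> 0 \<le> z \<Longrightarrow> x * y * (qv Q (x,y,z))^2 \<le> k * (x * qv G (x,y,z))^2"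
    using square_boundedE[OF H] unfolding FG ev_mul by blast
  have z: "qv Q (0,y,z) = 0" if yz: "0 < y" "0 \<le> z" for y z
  proof (rule vanishes_at_zero[where g = "\<lambda>r. qv Q (r,y,z)" and w = "\<lambda>r. k / y * (qv G (r,y,z))^2"])
    fix r :: real assume r: "0 < r" "r < 1"
    have "r * y * (qv Q (r,y,z))^2 \<le> r * y * (r * (k / y * (qv G (r,y,z))^2))"
      using k(2)[of r y z] r yz by (simp add: power2_eq_square algebra_simps del: qv.simps)
    then show "(qv Q (r,y,z))^2 \<le> r * (k / y * (qv G (r,y,z))^2)" by (rule cancel_pos) (use r yz in simp)
  qed (use yz in \<open>auto simp: Q G_def intro!: continuous_intros\<close>)
  have q: "q2 = 0" "q3 = 0" "q6 = 0" using z[of 1 0] z[of 1 1] z[of 1 2] by (auto simp: Q)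
  define M where "M = (q1,q4,q5)"
  have QM: "qv Q (x,y,z) = x * (M \<bullet> (x,y,z))" for x y z by (simp add: Q q M_def power2_eq_square algebra_simps)
  have "lin_square_bounded M G" unfolding lin_square_bounded_def
  proof (intro exI allI impI)
    fix x y z :: real assume xyz: "0 \<le> x" "0 \<le> y" "0 \<le> z"
    show "x * y * (M \<bullet> (x,y,z))^2 \<le> k * (qv G (x,y,z))^2"
    proof (cases "x = 0")
      case False
      have "x^2 * (x * y * (M \<bullet> (x,y,z))^2) \<le> x^2 * (k * (qv G (x,y,z))^2)"
        using k(2)[OF xyz] unfolding QM by (simp add: power_mult_distrib algebra_simps del: qv.simps inner_Pair)
      then show ?thesis by (rule cancel_pos) (use False in simp)
    qed (use k in simp)
  qed
  moreover have "extremal_quadric G"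
    by (rule extremal_quadric_from_cubic[where T = mulx and e = "(1,0,0)"]) (use F in \<open>auto simp: FG mul_props\<close>)
  ultimately have "M = 0" by (intro extremal_quadric_main)
  then show ?thesis by (simp add: M_def Q q zero_prod_def)
qed

text \<open>The bound at \<open>z = 0\<close> shows \<open>Q = z M\<close>; after cancelling \<open>z\<^sup>2\<close> the face \<open>z = 0\<close> is recovered by continuity.\<close>

lemma divisible_z:
  assumes F: "extremal_cubic F" and d: "face_z F = 0" and H: "square_bounded Q F" shows "Q = 0"
proof -
  obtain a b c d e f g h i j where F0: "F = (a,b,c,d,e,f,g,h,i,j)" by (rule cubic_exhaust)
  define G :: quadric where "G = (e,g,c,j,h,i)"
  have FG: "F = mulz G" using d by (simp add: F0 G_def zero_prod_def)
  obtain q1 q2 q3 q4 q5 q6 where Q: "Q = (q1,q2,q3,q4,q5,q6)" by (rule quad_exhaust)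
  obtain k where k: "0 \<le> k" "\<And>x y z. 0 \<le> x \<Longrightarrow> 0 \<le> y \<Longrightarrow> 0 \<le> z \<Longrightarrow> x * y * (qv Q (x,y,z))^2 \<le> k * (z * qv G (x,y,z))^2"
    using square_boundedE[OF H] unfolding FG ev_mul by blast
  have z: "qv Q (x,y,0) = 0" if xy: "0 < x" "0 < y" for x y
  proof -
    have "x * y * (qv Q (x,y,0))^2 \<le> 0" using k(2)[of x y 0] xy by simp
    moreover have "0 \<le> (qv Q (x,y,0))^2" by simp
    ultimately have "(qv Q (x,y,0))^2 = 0" using xy
      by (metis antisym_conv mult_eq_0_iff mult_nonneg_nonneg less_imp_le less_irrefl)
    then show ?thesis by simp
  qed
  have q: "q1 = 0" "q2 = 0" "q4 = 0" using z[of 1 1] z[of 1 2] z[of 2 1] by (auto simp: Q)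
  define M where "M = (q5,q6,q3)"
  have QM: "qv Q (x,y,z) = z * (M \<bullet> (x,y,z))" for x y z by (simp add: Q q M_def power2_eq_square algebra_simps)
  have "lin_square_bounded M G" unfolding lin_square_bounded_def
  proof (intro exI allI impI)
    fix x y z :: real assume xyz: "0 \<le> x" "0 \<le> y" "0 \<le> z"
    have positive: "x * y * (M \<bullet> (x,y,z))^2 \<le> k * (qv G (x,y,z))^2" if "0 < z" for z
    proof -
      have "z^2 * (x * y * (M \<bullet> (x,y,z))^2) \<le> z^2 * (k * (qv G (x,y,z))^2)"
        using k(2)[OF xyz(1,2), of z] that unfolding QM by (simp add: power_mult_distrib algebra_simps del: qv.simps inner_Pair)
      then show ?thesis by (rule cancel_pos) (use that in simp)
    qed
    show "x * y * (M \<bullet> (x,y,z))^2 \<le> k * (qv G (x,y,z))^2"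
    proof (cases "z = 0")
      case True
      have l1: "((\<lambda>z. x * y * (M \<bullet> (x,y,z))^2) \<longlongrightarrow> x * y * (M \<bullet> (x,y,0))^2) (at_right 0)" by (intro tendsto_intros)
      have l2: "((\<lambda>z. k * (qv G (x,y,z))^2) \<longlongrightarrow> k * (qv G (x,y,0))^2) (at_right 0)"
        unfolding G_def qv.simps by (intro tendsto_intros)
      have "eventually (\<lambda>z. x * y * (M \<bullet> (x,y,z))^2 \<le> k * (qv G (x,y,z))^2) (at_right 0)"
        using positive eventually_at_right_less[of "0::real"] by (auto elim: eventually_mono simp del: inner_Pair)
      from tendsto_le[OF _ l2 l1 this] show ?thesis using True by simp
    qed (use positive xyz in auto)
  qed
  moreover have "extremal_quadric G"
    by (rule extremal_quadric_from_cubic[where T = mulz and e = "(0,0,1)"]) (use F in \<open>auto simp: FG mul_props\<close>)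
  ultimately have "M = 0" by (intro extremal_quadric_main)
  then show ?thesis by (simp add: M_def Q q zero_prod_def)
qed

theorem extremal_cubic_main:
  assumes F: "extremal_cubic F" and H: "square_bounded Q F" shows "Q = 0"
proof -
  consider "no_variable_factor F" | "face_x F = 0" | "face_y F = 0" | "face_z F = 0" unfolding no_variable_factor_def by blast
  then show ?thesis
  proof cases
    case 1 then show ?thesis using main_no_variable_factor F H by blast
  next
    case 2 then show ?thesis using divisible_x F H by blast
  next
    case 3
    have "face_x (swap_xy F) = face_y F" by (cases F rule: cubic_exhaust) simp
    then have "swap_quadric Q = 0" using divisible_x[OF extremal_cubic_swap_xy[OF F] _ square_bounded_swap[OF H]] 3 by simp
    then have "swap_quadric (swap_quadric Q) = swap_quadric 0" by simp
    then show ?thesis by (simp add: swap_quadric_simps(3)) (simp add: zero_prod_def)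
  next
    case 4 then show ?thesis using divisible_z F H by blast
  qed
qed

section \<open>Even sextics\<close>

text \<open>The parts of a sextic under sign changes: the even part, and the parts \<open>xy Q(x\<^sup>2,y\<^sup>2,z\<^sup>2)\<close>,
\<open>zx Q(z\<^sup>2,x\<^sup>2,y\<^sup>2)\<close>, \<open>yz Q(y\<^sup>2,z\<^sup>2,x\<^sup>2)\<close>.  The arguments of \<open>Q\<close> are permuted so that the two
distinguished variables come first.\<close>

definition even_coeffs :: "poly3 \<Rightarrow> cubic" where
  "even_coeffs f = (let l = Poly_Mapping.lookup f in (l (6,0,0), l (0,6,0), l (0,0,6), l (4,2,0), l (4,0,2), l (2,4,0), l (0,4,2), l (2,0,4), l (0,2,4), l (2,2,2)))"

definition xy_coeffs :: "poly3 \<Rightarrow> quadric" where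
  "xy_coeffs f = (let l = Poly_Mapping.lookup f in (l (5,1,0), l (1,5,0), l (1,1,4), l (3,3,0), l (3,1,2), l (1,3,2)))"

definition zx_coeffs :: "poly3 \<Rightarrow> quadric" where
  "zx_coeffs f = (let l = Poly_Mapping.lookup f in (l (1,0,5), l (5,0,1), l (1,4,1), l (3,0,3), l (1,2,3), l (3,2,1)))"

definition yz_coeffs :: "poly3 \<Rightarrow> quadric" where
  "yz_coeffs f = (let l = Poly_Mapping.lookup f in (l (0,5,1), l (0,1,5), l (4,1,1), l (0,3,3), l (2,3,1), l (2,1,3)))"

lemmas parity_parts = even_coeffs_def[unfolded Let_def] xy_coeffs_def[unfolded Let_def] zx_coeffs_def[unfolded Let_def] yz_coeffs_def[unfolded Let_def]

lemma atMost_explicit: "{..6::nat} = {0,1,2,3,4,5,6}" "{..5::nat} = {0,1,2,3,4,5}" "{..4::nat} = {0,1,2,3,4}" "{..3::nat} = {0,1,2,3}"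
  "{..2::nat} = {0,1,2}" "{..1::nat} = {0,1}" "{..Suc 0} = {0,1}"
  by auto

lemma lookup_homogeneous: "homogeneous d f \<Longrightarrow> i + j + k \<noteq> d \<Longrightarrow> Poly_Mapping.lookup f (i,j,k) = 0"
  unfolding homogeneous_def using Poly_Mapping.in_keys_iff[of "(i,j,k)" f] by fastforce

lemma eval_sextic_sum:
  assumes "homogeneous 6 f"
  shows "eval3 (\<lambda>c. c) f x y z =
    (\<Sum>i\<le>6. \<Sum>j\<le>6-i. Poly_Mapping.lookup f (i,j,6-i-j) * x^i * y^j * z^(6-i-j))"
proof -
  let ?S = "Sigma {..6::nat} (\<lambda>i. {..6-i})"
  let ?h = "\<lambda>(i,j). (i,j,6-i-j)"
  have "Poly_Mapping.keys f \<subseteq> ?h ` ?S"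
  proof
    fix v assume v: "v \<in> Poly_Mapping.keys f"
    obtain i j k where v': "v = (i,j,k)" by (cases v)
    have "i + j + k = 6" using assms v unfolding homogeneous_def v' by auto
    then show "v \<in> ?h ` ?S" by (intro image_eqI[of _ _ "(i,j)"]) (auto simp: v')
  qed
  then have "eval3 (\<lambda>c. c) f x y z = (\<Sum>(i,j,k)\<in>?h ` ?S. Poly_Mapping.lookup f (i,j,k) * x^i * y^j * z^k)"
    unfolding eval3_def by (intro sum.mono_neutral_left) (auto simp: Poly_Mapping.in_keys_iff)
  also have "\<dots> = (\<Sum>(i,j)\<in>?S. Poly_Mapping.lookup f (i,j,6-i-j) * x^i * y^j * z^(6-i-j))"
    by (subst sum.reindex) (auto simp: inj_on_def split_beta intro!: sum.cong)
  also have "\<dots> = (\<Sum>i\<le>6. \<Sum>j\<le>6-i. Poly_Mapping.lookup f (i,j,6-i-j) * x^i * y^j * z^(6-i-j))"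
    by (subst sum.Sigma) auto
  finally show ?thesis .
qed

lemma eval_sextic:
  assumes "homogeneous 6 f"
  shows "eval3 (\<lambda>c. c) f x y z = ev (even_coeffs f) (x^2,y^2,z^2) + x*y * qv (xy_coeffs f) (x^2,y^2,z^2)
     + z*x * qv (zx_coeffs f) (z^2,x^2,y^2) + y*z * qv (yz_coeffs f) (y^2,z^2,x^2)"
  unfolding eval_sextic_sum[OF assms] atMost_explicit parity_parts ev.simps qv.simps
  by (simp add: atMost_explicit) algebra

text \<open>Each part is bounded by the even part: add the values at two sign changes of \<open>(x,y,z)\<close> at which the two
other parts cancel.\<close>

lemma psd_parts:
  assumes g: "g \<in> psd_forms 6"
  shows "copositive (even_coeffs g)" "square_bounded (xy_coeffs g) (even_coeffs g)" "square_bounded (zx_coeffs g) (cycle (even_coeffs g))" "square_bounded (yz_coeffs g) (cycle (cycle (even_coeffs g)))"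
proof -
  have h: "homogeneous 6 g" and p: "\<And>x y z. 0 \<le> eval3 (\<lambda>c. c) g x y z" using g by (auto simp: psd_forms_def)
  have main: "0 \<le> ev (even_coeffs g) (x,y,z) \<and> x * y * (qv (xy_coeffs g) (x,y,z))^2 \<le> (ev (even_coeffs g) (x,y,z))^2
    \<and> z * x * (qv (zx_coeffs g) (z,x,y))^2 \<le> (ev (even_coeffs g) (x,y,z))^2 \<and> y * z * (qv (yz_coeffs g) (y,z,x))^2 \<le> (ev (even_coeffs g) (x,y,z))^2"
    if "0 \<le> x" "0 \<le> y" "0 \<le> z" for x y z
  proof -
    define a b c where "a = sqrt x" "b = sqrt y" "c = sqrt z"
    have sq: "x = a^2" "y = b^2" "z = c^2" using that by (auto simp: a_b_c_def)
    define E A B C where "E = ev (even_coeffs g) (x,y,z)" "A = a*b * qv (xy_coeffs g) (x,y,z)" "B = c*a * qv (zx_coeffs g) (z,x,y)" "C = b*c * qv (yz_coeffs g) (y,z,x)"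
    have e: "0 \<le> E + A + B + C" "0 \<le> E - A - B + C" "0 \<le> E - A + B - C" "0 \<le> E + A - B - C"
      using p[of a b c] p[of "-a" b c] p[of a "-b" c] p[of a b "-c"]
      unfolding eval_sextic[OF h] E_A_B_C_def sq by simp_all
    have "\<bar>A\<bar> \<le> E" "\<bar>B\<bar> \<le> E" "\<bar>C\<bar> \<le> E" using e by linarith+
    then have "A^2 \<le> E^2" "B^2 \<le> E^2" "C^2 \<le> E^2" "0 \<le> E" by (auto intro: abs_le_square_iff[THEN iffD1] simp: power2_le_iff_abs_le)
    then show ?thesis unfolding E_A_B_C_def by (simp add: sq power_mult_distrib)
  qed
  show "copositive (even_coeffs g)" unfolding copositive_def using main by (auto simp: split_paired_All)
  show "square_bounded (xy_coeffs g) (even_coeffs g)" unfolding square_bounded_def using main by (intro exI[of _ 1]) auto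
  show "square_bounded (zx_coeffs g) (cycle (even_coeffs g))" unfolding square_bounded_def cycle_simps cycle_vec.simps using main by (intro exI[of _ 1]) auto
  show "square_bounded (yz_coeffs g) (cycle (cycle (even_coeffs g)))" unfolding square_bounded_def cycle_simps cycle_vec.simps using main by (intro exI[of _ 1]) auto
qed

lemma sextic_eqI:
  assumes "homogeneous 6 f" "homogeneous 6 g" "even_coeffs f = even_coeffs g" "xy_coeffs f = xy_coeffs g" "zx_coeffs f = zx_coeffs g" "yz_coeffs f = yz_coeffs g"
  shows "f = g"
proof (rule poly_mapping_eqI)
  fix v :: "nat \<times> nat \<times> nat"
  obtain i j k where v: "v = (i,j,k)" by (cases v)
  show "Poly_Mapping.lookup f v = Poly_Mapping.lookup g v"
  proof (cases "i + j + k = 6")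
    case True
    then have k: "k = 6 - i - j" and i: "i \<in> {0,1,2,3,4,5,6}" and j: "j \<in> {..6-i}" unfolding atMost_explicit[symmetric] by auto
    let ?T = "{(6,0,0), (0,6,0), (0,0,6), (4,2,0), (4,0,2), (2,4,0), (0,4,2), (2,0,4), (0,2,4), (2,2,2),
      (5,1,0), (1,5,0), (1,1,4), (3,3,0), (3,1,2), (1,3,2), (1,0,5), (5,0,1), (1,4,1), (3,0,3), (1,2,3), (3,2,1),
      (0,5,1), (0,1,5), (4,1,1), (0,3,3), (2,3,1), (2,1,3)} :: (nat \<times> nat \<times> nat) set"
    have "v \<in> ?T" using i j by (elim insertE emptyE; simp add: v k atMost_explicit; (elim disjE)?; simp)
    moreover have "\<forall>v\<in>?T. Poly_Mapping.lookup f v = Poly_Mapping.lookup g v" using assms(3-) by (simp add: parity_parts)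
    ultimately show ?thesis by (rule bspec[rotated])
  next
    case False
    then show ?thesis using assms(1,2) by (simp add: v lookup_homogeneous)
  qed
qed

lemma lookup_Const_mult: "Poly_Mapping.lookup (Const c * f) v = c * Poly_Mapping.lookup f v"
proof -
  have "Const c * f = Poly_Mapping.map ((*) c) f" unfolding Const_def by (rule mult_map_scale_conv_mult[symmetric])
  then show ?thesis by (simp add: Poly_Mapping.map.rep_eq when_def)
qed

lemma homogeneous_Const_mult: "homogeneous d f \<Longrightarrow> homogeneous d (Const c * f)"
  unfolding homogeneous_def by (auto simp: Poly_Mapping.in_keys_iff lookup_Const_mult)

lemma parts_add: "even_coeffs (f + g) = even_coeffs f + even_coeffs g" "xy_coeffs (f + g) = xy_coeffs f + xy_coeffs g" "zx_coeffs (f + g) = zx_coeffs f + zx_coeffs g" "yz_coeffs (f + g) = yz_coeffs f + yz_coeffs g"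
  by (simp_all add: parity_parts lookup_add)

lemma parts_Const_mult: "even_coeffs (Const c * f) = c *\<^sub>R even_coeffs f" "xy_coeffs (Const c * f) = c *\<^sub>R xy_coeffs f" "zx_coeffs (Const c * f) = c *\<^sub>R zx_coeffs f" "yz_coeffs (Const c * f) = c *\<^sub>R yz_coeffs f"
  by (simp_all add: parity_parts lookup_Const_mult)

lemma even_substitution:
  "eval3 Const g (X^2) (Y^2) (Z^2) = (\<Sum>(i,j,k)\<in>Poly_Mapping.keys g. Poly_Mapping.single (2*i,2*j,2*k) (Poly_Mapping.lookup g (i,j,k)))"
proof -
  have pw: "Poly_Mapping.single (a,b,c) (1::real) ^ n = Poly_Mapping.single (n*a,n*b,n*c) 1" for a b c n :: nat
    by (induction n) (simp_all add: mult_single flip: single_one, simp add: zero_prod_def)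
  show ?thesis unfolding eval3_def X_def Y_def Z_def Const_def
    by (intro sum.cong refl) (auto simp: pw mult_single zero_prod_def mult.commute)
qed

text \<open>Halving all exponents inverts the substitution of squares.\<close>

lemma even_polys_iff: "f \<in> even_polys \<longleftrightarrow> (\<forall>i j k. Poly_Mapping.lookup f (i,j,k) \<noteq> 0 \<longrightarrow> even i \<and> even j \<and> even k)"
proof
  assume "f \<in> even_polys"
  then obtain g where f: "f = eval3 Const g (X^2) (Y^2) (Z^2)" unfolding even_polys_def by blast
  show "\<forall>i j k. Poly_Mapping.lookup f (i,j,k) \<noteq> 0 \<longrightarrow> even i \<and> even j \<and> even k"
  proof (intro allI impI)
    fix i j k assume "Poly_Mapping.lookup f (i,j,k) \<noteq> 0"
    then obtain v where "v \<in> Poly_Mapping.keys g" "Poly_Mapping.lookup (case v of (a,b,c) \<Rightarrow> Poly_Mapping.single (2*a,2*b,2*c) (Poly_Mapping.lookup g (a,b,c))) (i,j,k) \<noteq> 0"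
      unfolding f even_substitution lookup_sum by (meson sum.not_neutral_contains_not_neutral)
    then show "even i \<and> even j \<and> even k" by (cases v) (auto simp: lookup_single when_def split: if_splits)
  qed
next
  assume ev: "\<forall>i j k. Poly_Mapping.lookup f (i,j,k) \<noteq> 0 \<longrightarrow> even i \<and> even j \<and> even k"
  let ?d = "\<lambda>(i,j,k). (2*i,2*j,2*k) :: nat \<times> nat \<times> nat"
  have inj: "inj ?d" by (auto simp: inj_def split_paired_All)
  have "finite {v. Poly_Mapping.lookup f (?d v) \<noteq> 0}"
  proof -
    have "{v. Poly_Mapping.lookup f (?d v) \<noteq> 0} = ?d -` Poly_Mapping.keys f" by (auto simp: Poly_Mapping.in_keys_iff)
    then show ?thesis using finite_vimageI[OF _ inj] by simp
  qed
  from lookup_Abs_poly_mapping[OF this]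
  have g: "Poly_Mapping.lookup (Abs_poly_mapping (\<lambda>v. Poly_Mapping.lookup f (?d v))) v = Poly_Mapping.lookup f (?d v)" for v
    by (rule fun_cong)
  define g where "g = Abs_poly_mapping (\<lambda>v. Poly_Mapping.lookup f (?d v))"
  note g = g[folded g_def]
  have "f = eval3 Const g (X^2) (Y^2) (Z^2)"
  proof (rule poly_mapping_eqI)
    fix w
    have s: "Poly_Mapping.lookup (eval3 Const g (X^2) (Y^2) (Z^2)) w = (\<Sum>v\<in>Poly_Mapping.keys g. (Poly_Mapping.lookup g v when ?d v = w))"
      unfolding even_substitution lookup_sum by (intro sum.cong refl) (auto simp: lookup_single)
    show "Poly_Mapping.lookup f w = Poly_Mapping.lookup (eval3 Const g (X^2) (Y^2) (Z^2)) w"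
    proof (cases "\<exists>v. w = ?d v")
      case True
      then obtain v where w: "w = ?d v" by blast
      have "(\<Sum>u\<in>Poly_Mapping.keys g. (Poly_Mapping.lookup g u when ?d u = w)) = (\<Sum>u\<in>Poly_Mapping.keys g. (if u = v then Poly_Mapping.lookup g v else 0))"
        by (intro sum.cong refl) (simp only: w inj_eq[OF inj] when_def, simp)
      also have "\<dots> = Poly_Mapping.lookup g v" by (simp add: Poly_Mapping.in_keys_iff)
      finally show ?thesis unfolding s by (simp add: g w)
    next
      case False
      obtain i j k where w: "w = (i,j,k)" by (cases w)
      have "\<not> (even i \<and> even j \<and> even k)"
      proof
        assume "even i \<and> even j \<and> even k"
        then have "w = ?d (i div 2, j div 2, k div 2)" by (simp add: w)
        with False show False by blast
      qed
      then have "Poly_Mapping.lookup f w = 0" using ev w by blast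
      moreover have "(\<Sum>u\<in>Poly_Mapping.keys g. (Poly_Mapping.lookup g u when ?d u = w)) = 0"
      proof (intro sum.neutral ballI)
        fix u
        have "?d u \<noteq> w" using False by blast
        then show "(Poly_Mapping.lookup g u when ?d u = w) = 0" by (simp only: when_def if_False)
      qed
      ultimately show ?thesis unfolding s by simp
    qed
  qed
  then show "f \<in> even_polys" unfolding even_polys_def by blast
qed

lemma even_parts: "f \<in> even_polys \<Longrightarrow> xy_coeffs f = 0" "f \<in> even_polys \<Longrightarrow> zx_coeffs f = 0" "f \<in> even_polys \<Longrightarrow> yz_coeffs f = 0"
proof -
  assume "f \<in> even_polys"
  then have "Poly_Mapping.lookup f (i,j,k) = 0" if "odd i \<or> odd j \<or> odd k" for i j k
    using that unfolding even_polys_iff by blast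
  then show "xy_coeffs f = 0" "zx_coeffs f = 0" "yz_coeffs f = 0" by (simp_all add: parity_parts zero_prod_def)
qed

fun even_sextic :: "cubic \<Rightarrow> poly3" where
  "even_sextic (a,b,c,d,e,f,g,h,i,j) = Poly_Mapping.single (6,0,0) a + Poly_Mapping.single (0,6,0) b + Poly_Mapping.single (0,0,6) c
   + Poly_Mapping.single (4,2,0) d + Poly_Mapping.single (4,0,2) e + Poly_Mapping.single (2,4,0) f
   + Poly_Mapping.single (0,4,2) g + Poly_Mapping.single (2,0,4) h + Poly_Mapping.single (0,2,4) i + Poly_Mapping.single (2,2,2) j"

lemma even_coeffs_even_sextic: "even_coeffs (even_sextic F) = F"
  by (cases F rule: cubic_exhaust) (simp add: parity_parts lookup_add lookup_single)

lemma lookup_even_sextic_nonzero: "Poly_Mapping.lookup (even_sextic F) v \<noteq> 0 \<Longrightarrow>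
  v \<in> {(6,0,0),(0,6,0),(0,0,6),(4,2,0),(4,0,2),(2,4,0),(0,4,2),(2,0,4),(0,2,4),(2,2,2)}"
  by (cases F rule: cubic_exhaust) (rule ccontr, auto simp: lookup_add lookup_single)

lemma even_sextic_even: "even_sextic F \<in> even_polys" unfolding even_polys_iff using lookup_even_sextic_nonzero[of F] by fastforce

lemma even_sextic_homogeneous: "homogeneous 6 (even_sextic F)"
  unfolding homogeneous_def using lookup_even_sextic_nonzero[of F] by (fastforce simp: Poly_Mapping.in_keys_iff)

lemma even_sextic_psd: "copositive F \<Longrightarrow> even_sextic F \<in> even_psd_forms 6"
  unfolding even_psd_forms_def psd_forms_def
  by (auto simp: even_sextic_homogeneous even_sextic_even eval_sextic[OF even_sextic_homogeneous] even_coeffs_even_sextic even_parts[OF even_sextic_even] copositive_def zero_prod_def)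

lemma even_psd_form_eq: "f \<in> even_psd_forms 6 \<Longrightarrow> f = even_sextic (even_coeffs f)"
  by (rule sextic_eqI) (auto simp: even_psd_forms_def psd_forms_def even_sextic_homogeneous even_coeffs_even_sextic even_parts even_sextic_even)

lemma even_sextic_add: "even_sextic (F + G) = even_sextic F + even_sextic G"
proof -
  have h: "homogeneous 6 (even_sextic F + even_sextic G)" 
    using even_sextic_homogeneous[of F] even_sextic_homogeneous[of G] Poly_Mapping.keys_add[of "even_sextic F" "even_sextic G"] unfolding homogeneous_def by blast
  show ?thesis by (rule sextic_eqI) (simp_all add: h even_sextic_homogeneous parts_add even_coeffs_even_sextic even_parts even_sextic_even)
qed

text \<open>If \<open>|C| \<le> k F\<close>, then \<open>F\<close> is the sum of the two copositive cubics \<open>F/2 \<plusminus> C/K\<close> for large \<open>K\<close>.\<close>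

lemma extremal_cubic_of_extremal_form:
  assumes f: "f \<in> extremal (even_psd_forms 6)" shows "extremal_cubic (even_coeffs f)"
  unfolding extremal_cubic_def
proof (intro conjI allI impI)
  have fp: "f \<in> even_psd_forms 6" and f0: "f \<noteq> 0" and
    fe: "\<And>g h. g \<in> even_psd_forms 6 \<Longrightarrow> h \<in> even_psd_forms 6 \<Longrightarrow> f = g + h \<Longrightarrow> \<exists>c. g = Const c * f"
    using f unfolding extremal_def by blast+
  show copositive_F: "copositive (even_coeffs f)" using fp by (intro psd_parts) (auto simp: even_psd_forms_def)
  show "even_coeffs f \<noteq> 0"
  proof
    assume "even_coeffs f = 0"
    then have "f = even_sextic 0" using even_psd_form_eq[OF fp] by simp
    then show False using f0 by (simp add: zero_prod_def)
  qed
  fix C assume "dominated C (even_coeffs f)"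
  then obtain k where k: "\<And>v. nonneg v \<Longrightarrow> \<bar>ev C v\<bar> \<le> k * ev (even_coeffs f) v" unfolding dominated_def by blast
  \<comment> \<open>positive, and large enough for both summands below to be copositive\<close>
  define K where "K = 2 * max k 1"
  have K: "K > 0" by (simp add: K_def)
  have bound: "\<bar>ev C v\<bar> \<le> K / 2 * ev (even_coeffs f) v" if v: "nonneg v" for v
  proof -
    have "k * ev (even_coeffs f) v \<le> K / 2 * ev (even_coeffs f) v" using copositive_F v unfolding copositive_def by (intro mult_right_mono) (auto simp: K_def)
    then show ?thesis using k[OF v] by linarith
  qed
  let ?g = "(1/2) *\<^sub>R even_coeffs f + (1/K) *\<^sub>R C" and ?h = "(1/2) *\<^sub>R even_coeffs f + (-1/K) *\<^sub>R C"
  have "copositive ?g" "copositive ?h" unfolding copositive_def ev_add ev_scale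
  proof (safe)
    fix v assume v: "nonneg v"
    have "- (K/2 * ev (even_coeffs f) v) \<le> ev C v" "ev C v \<le> K/2 * ev (even_coeffs f) v" using bound[OF v] by linarith+
    then show "0 \<le> 1 / 2 * ev (even_coeffs f) v + 1 / K * ev C v" "0 \<le> 1 / 2 * ev (even_coeffs f) v + - 1 / K * ev C v"
      using K by (simp_all add: field_simps)
  qed
  then have gh: "even_sextic ?g \<in> even_psd_forms 6" "even_sextic ?h \<in> even_psd_forms 6" by (auto intro: even_sextic_psd)
  have "?g + ?h = (1/2 + 1/2) *\<^sub>R even_coeffs f" unfolding scaleR_left_distrib by simp
  then have "f = even_sextic ?g + even_sextic ?h" using even_psd_form_eq[OF fp] unfolding even_sextic_add[symmetric] by simp
  from fe[OF gh this] obtain c where "even_sextic ?g = Const c * f" by blast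
  then have "?g = c *\<^sub>R even_coeffs f" using even_coeffs_even_sextic[of ?g] parts_Const_mult(1)[of c f] by simp
  then have "(1/K) *\<^sub>R C = (c - 1/2) *\<^sub>R even_coeffs f" by (simp add: scaleR_left_diff_distrib algebra_simps)
  then have "K *\<^sub>R ((1/K) *\<^sub>R C) = K *\<^sub>R ((c - 1/2) *\<^sub>R even_coeffs f)" by simp
  then have "C = (K * (c - 1/2)) *\<^sub>R even_coeffs f" using K by simp
  then show "\<exists>c. C = c *\<^sub>R even_coeffs f" by blast
qed

lemma square_bounded_scale: "square_bounded Q (c *\<^sub>R F) \<Longrightarrow> square_bounded Q F"
proof -
  assume "square_bounded Q (c *\<^sub>R F)"
  then obtain k where k: "\<And>x y z. 0 \<le> x \<Longrightarrow> 0 \<le> y \<Longrightarrow> 0 \<le> z \<Longrightarrow> x * y * (qv Q (x,y,z))^2 \<le> k * (c * ev F (x,y,z))^2"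
    unfolding square_bounded_def ev_scale by blast
  then show ?thesis unfolding square_bounded_def
    by (intro exI[of _ "k * c^2"]) (simp add: power_mult_distrib mult.assoc)
qed

lemma cycle_scale: "cycle (c *\<^sub>R F) = c *\<^sub>R cycle F"
  by (cases F rule: cubic_exhaust) simp

text \<open>The even part of a summand is a multiple of \<open>f\<close>, and the odd parts vanish by \<open>extremal_cubic_main\<close>.\<close>

lemma psd_summand:
  assumes f: "f \<in> extremal (even_psd_forms 6)" and g: "g \<in> psd_forms 6" and h: "h \<in> psd_forms 6" and fgh: "f = g + h"
  shows "\<exists>c. g = Const c * f"
proof -
  have F: "extremal_cubic (even_coeffs f)" by (rule extremal_cubic_of_extremal_form[OF f])
  have fp: "f \<in> psd_forms 6" "f \<in> even_polys" using f by (auto simp: extremal_def even_psd_forms_def)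
  have "dominated (even_coeffs g) (even_coeffs f)" by (rule dominated_summand[OF psd_parts(1)[OF g] psd_parts(1)[OF h]]) (simp add: fgh parts_add)
  then obtain c where c: "even_coeffs g = c *\<^sub>R even_coeffs f" using F unfolding extremal_cubic_def by blast
  have "xy_coeffs g = 0" using extremal_cubic_main[OF F] psd_parts(2)[OF g] square_bounded_scale unfolding c by blast
  moreover have "zx_coeffs g = 0"
    using extremal_cubic_main[OF extremal_cubic_cycle[OF F]] psd_parts(3)[OF g] square_bounded_scale unfolding c cycle_scale by blast
  moreover have "yz_coeffs g = 0"
    using extremal_cubic_main[OF extremal_cubic_cycle[OF extremal_cubic_cycle[OF F]]] psd_parts(4)[OF g] square_bounded_scale unfolding c cycle_scale by blast
  ultimately have "g = Const c * f"
    by (intro sextic_eqI) (use g fp in \<open>auto simp: psd_forms_def homogeneous_Const_mult parts_Const_mult c even_parts\<close>)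
  then show ?thesis by blast
qed

theorem corollary1p8: "extremal (even_psd_forms 6) \<subseteq> extremal (psd_forms 6)"
proof
  fix f assume f: "f \<in> extremal (even_psd_forms 6)"
  then have "f \<in> psd_forms 6" "f \<noteq> 0" by (auto simp: extremal_def even_psd_forms_def)
  moreover have "(\<exists>c. g = Const c * f) \<and> (\<exists>c. h = Const c * f)"
    if "g \<in> psd_forms 6" "h \<in> psd_forms 6" "f = g + h" for g h
    using psd_summand[OF f that] psd_summand[OF f that(2,1)] that(3) by (simp add: add.commute)
  ultimately show "f \<in> extremal (psd_forms 6)" unfolding extremal_def by blast
qed

end
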